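(* Let $1 \leq k \leq 3$ and $A > 0$. There exist positive numbers $\varepsilon_A$ and $K_A$, depending only on $A$, such that the following holds for any $0 < \varepsilon < \varepsilon_A$. Let $\Psi \in X^{k+1}(\mathbb{R})$ with $E(\Psi) < \frac{2\sqrt2}{3}$, let $N_\varepsilon$ and $\Theta_\varepsilon$ be the associated rescaled functions, and assume that $$\mathcal{E}_j(N_\varepsilon, \Theta_\varepsilon) \leq A \quad \text{for any } 1 \leq j \leq k+1.$$ Then, for either choice of the sign $\pm$ (the same throughout), $$\Big| \mathcal{E}_k(N_\varepsilon, \Theta_\varepsilon) \pm \sqrt{2}\, \mathcal{P}_k(N_\varepsilon, \Theta_\varepsilon) - E_{k-1}^{KdV} \Big( \frac{N_\varepsilon \pm \partial_x \Theta_\varepsilon}{2} \Big) \Big| \leq K_A \varepsilon^2.$$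
   Context: For $u : \mathbb{R} \to \mathbb{C}$, $E(u) = \frac12 \int_{\mathbb{R}} |\partial_{\mathrm{x}} u|^2 + \frac14 \int_{\mathbb{R}} (1 - |u|^2)^2$, and $X^k(\mathbb{R}) = \{ u \in L^1_{\rm loc}(\mathbb{R}, \mathbb{C}) : E(u) < +\infty,\ \partial_{\mathrm{x}} u \in H^{k-1}(\mathbb{R}) \}$. Any $\Psi\in X^1(\mathbb{R})$ with $E(\Psi) < \frac{2\sqrt2}{3}$ vanishes nowhere, so $\Psi = \varrho \exp i\varphi$ with $\varrho=|\Psi|$ and $\varphi$ a continuous real-valued phase. Put $\eta = 1 - |\Psi|^2$, $\langle z_1, z_2 \rangle = \mathrm{Re}(z_1 \overline{z_2})$, $\partial = \partial_{\mathrm{x}}$. Rescaled functions: $N_\varepsilon(x) = \frac{6}{\varepsilon^2}\eta\big(\frac{x}{\varepsilon}\big)$, $\Theta_\varepsilon(x) = \frac{6\sqrt2}{\varepsilon}\varphi\big(\frac{x}{\varepsilon}\big)$. Rescaled invariants: $E_k(\Psi) = \frac{\varepsilon^{2k+1}}{18}\mathcal{E}_k(N_\varepsilon,\Theta_\varepsilon)$ and $p_k(\Psi) = \frac{\varepsilon^{2k+1}}{18}\mathcal{P}_k(N_\varepsilon,\Theta_\varepsilon)$, where (integrals over $\mathbb{R}$) $E_1 = E$, $$E_2(\Psi) = \frac12 \int |\partial^2 \Psi|^2 - \frac32 \int \eta |\partial \Psi|^2 + \frac14 \int (\partial \eta)^2 - \frac14 \int \eta^3,$$ $$E_3(\Psi)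 = \frac12 \int |\partial^3 \Psi|^2 + \frac14 \int |\partial^2 \eta|^2 + \frac54 \int |\partial \Psi|^4 + \frac52 \int \partial^2 \eta |\partial \Psi|^2 - \frac52 \int \eta |\partial^2 \Psi|^2 - \frac54 \int \eta (\partial \eta)^2 + \frac{15}{4} \int \eta^2 |\partial \Psi|^2 + \frac{5}{16} \int \eta^4,$$ $$\begin{aligned} E_4(\Psi) = {} & \frac12 \int |\partial^4 \Psi|^2 + \frac14 \int |\partial^3 \eta|^2 - \frac74 \int \eta (\partial^2 \eta)^2 - \frac72 \int \eta |\partial^3 \Psi|^2 + \frac{35}{8} \int \eta^2 (\partial \eta)^2 + \frac{35}{4} \int \eta^2 |\partial^2 \Psi|^2 \\ & - \frac{35}{4} \int (\partial \eta)^2 |\partial \Psi|^2 - \frac72 \int |\partial \Psi|^2 |\partial^2 \Psi|^2 - 7 \int \partial^2 \eta \langle \partial \Psi, \partial^3 \Psi\rangle - 7 \int |\partial \Psi|^2 \langle \partial \Psi, \partial^3 \Psi \rangle \\ & - \frac{35}{2} \int \eta\, \partial^2 \eta |\partial \Psi|^2 - \frac{35}{4} \int \eta^3 |\partial \Psi|^2 - \frac{35}{4} \int \eta |\partial \Psi|^4 - \frac{7}{16} \int \eta^5, \end{aligned}$$ and $p_1(\Psi) = \frac12\int \eta\,\partial\varphi$, $p_2 = P_2 - \frac32 p_1$, $p_3 = P_3 + \frac52 p_1$, with $$P_2(\Psi) = \frac12 \int \langle i \partial^2 \Psi, \partial \Psi \rangle - \frac34 \int \eta \langle i \partial \Psi,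 \Psi \rangle,$$ $$P_3(\Psi) = \frac12 \int \langle i \partial^3 \Psi, \partial^2 \Psi \rangle - \frac52 \int \eta \langle i \partial^2 \Psi, \partial \Psi \rangle + \frac54 \int (\eta^2 + \eta) \langle i \partial \Psi, \Psi \rangle.$$ KdV invariants: $E^{KdV}_0(v) = \frac12 \int v^2$, $E^{KdV}_1(v) = \frac12 \int (\partial_x v)^2 - \frac16 \int v^3$, $E^{KdV}_2(v) = \frac12 \int (\partial_x^2 v)^2 - \frac56 \int v (\partial_x v)^2 + \frac{5}{72} \int v^4$. *)

theory Defs
  imports "HOL-Analysis.Analysis"
begin

section \<open>Weak derivatives and Sobolev spaces on the real line\<close>

text \<open>Elements of the function spaces below are Borel representatives of the usual classes of
  functions modulo equality almost everywhere; all notions are invariant under a change of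
  representative.\<close>

definition test_function :: "(real \<Rightarrow> real) \<Rightarrow> bool" where
  "test_function \<phi> \<longleftrightarrow>
     (\<forall>n x. (deriv ^^ n) \<phi> field_differentiable (at x)) \<and> compact (closure {x. \<phi> x \<noteq> 0})"

definition locally_integrable :: "(real \<Rightarrow> 'a::euclidean_space) \<Rightarrow> bool" where
  "locally_integrable u \<longleftrightarrow> (\<forall>a b. set_integrable lborel {a..b} u)"

definition has_weak_deriv ::
    "(real \<Rightarrow> 'a::euclidean_space) \<Rightarrow> (real \<Rightarrow> 'a) \<Rightarrow> bool" where
  "has_weak_deriv u v \<longleftrightarrow> locally_integrable u \<and> locally_integrable v \<and>
     (\<forall>\<phi>. test_function \<phi> \<longrightarrow>
        (LBINT x. deriv \<phi> x *\<^sub>R u x) = - (LBINT x. \<phi> x *\<^sub>R v x))"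

text \<open>If it exists, the weak derivative is unique only up to null sets; an arbitrary
  representative is selected, which is only ever used under integrals or in the spaces below.\<close>

definition weak_deriv :: "(real \<Rightarrow> 'a::euclidean_space) \<Rightarrow> real \<Rightarrow> 'a" where
  "weak_deriv u = (SOME v. has_weak_deriv u v)"

abbreviation wD :: "nat \<Rightarrow> (real \<Rightarrow> 'a::euclidean_space) \<Rightarrow> real \<Rightarrow> 'a" where
  "wD j u \<equiv> (weak_deriv ^^ j) u"

definition square_integrable :: "(real \<Rightarrow> 'a::euclidean_space) \<Rightarrow> bool" where
  "square_integrable f \<longleftrightarrow>
     f \<in> borel_measurable lborel \<and> integrable lborel (\<lambda>x. (norm (f x))\<^sup>2)"

definition sobolev_H :: "nat \<Rightarrow> (real \<Rightarrow> 'a::euclidean_space) set" where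
  "sobolev_H m = {f. (\<forall>j\<le>m. square_integrable (wD j f)) \<and>
                     (\<forall>j<m. \<exists>v. has_weak_deriv (wD j f) v)}"


section \<open>The Ginzburg--Landau energy and the energy spaces\<close>

definition eta :: "(real \<Rightarrow> complex) \<Rightarrow> real \<Rightarrow> real" where
  "eta \<Psi> x = 1 - (cmod (\<Psi> x))\<^sup>2"

definition GL_energy :: "(real \<Rightarrow> complex) \<Rightarrow> real" where
  "GL_energy \<Psi> = 1/2 * (LBINT x. (cmod (wD 1 \<Psi> x))\<^sup>2)
                + 1/4 * (LBINT x. (1 - (cmod (\<Psi> x))\<^sup>2)\<^sup>2)"

text \<open>The Bochner integral of a non-integrable function is 0, so finiteness of the energy has to
  be expressed by integrability of the two nonnegative densities.\<close>

definition finite_GL_energy :: "(real \<Rightarrow> complex) \<Rightarrow> bool" where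
  "finite_GL_energy \<Psi> \<longleftrightarrow> (\<exists>v. has_weak_deriv \<Psi> v) \<and>
     integrable lborel (\<lambda>x. (cmod (wD 1 \<Psi> x))\<^sup>2) \<and>
     integrable lborel (\<lambda>x. (1 - (cmod (\<Psi> x))\<^sup>2)\<^sup>2)"

definition X_space :: "nat \<Rightarrow> (real \<Rightarrow> complex) set" where
  "X_space k = {u. locally_integrable u \<and> finite_GL_energy u \<and> wD 1 u \<in> sobolev_H (k - 1)}"

text \<open>The equality is required almost everywhere because \<open>\<Psi>\<close> need not be the continuous
  representative of its class.\<close>

definition phase_of :: "(real \<Rightarrow> complex) \<Rightarrow> (real \<Rightarrow> real) \<Rightarrow> bool" where
  "phase_of \<Psi> \<phi> \<longleftrightarrow> continuous_on UNIV \<phi> \<and>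
     (AE x in lborel. \<Psi> x = complex_of_real (cmod (\<Psi> x)) * exp (\<i> * complex_of_real (\<phi> x)))"


section \<open>Invariants of the Gross--Pitaevskii equation\<close>

text \<open>The real inner product \<open>z\<^sub>1 \<bullet> z\<^sub>2\<close> on \<^typ>\<open>complex\<close> is \<open>Re (z\<^sub>1 * cnj z\<^sub>2)\<close>.\<close>

definition GP_E2 :: "(real \<Rightarrow> complex) \<Rightarrow> real" where
  "GP_E2 \<Psi> = 
       1/2 * (LBINT x. (cmod (wD 2 \<Psi> x))\<^sup>2)
     - 3/2 * (LBINT x. eta \<Psi> x * (cmod (wD 1 \<Psi> x))\<^sup>2)
     + 1/4 * (LBINT x. (wD 1 (eta \<Psi>) x)\<^sup>2)
     - 1/4 * (LBINT x. (eta \<Psi> x)^3)"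

definition GP_E3 :: "(real \<Rightarrow> complex) \<Rightarrow> real" where
  "GP_E3 \<Psi> = 
       1/2 * (LBINT x. (cmod (wD 3 \<Psi> x))\<^sup>2)
     + 1/4 * (LBINT x. (wD 2 (eta \<Psi>) x)\<^sup>2)
     + 5/4 * (LBINT x. (cmod (wD 1 \<Psi> x))^4)
     + 5/2 * (LBINT x. wD 2 (eta \<Psi>) x * (cmod (wD 1 \<Psi> x))\<^sup>2)
     - 5/2 * (LBINT x. eta \<Psi> x * (cmod (wD 2 \<Psi> x))\<^sup>2)
     - 5/4 * (LBINT x. eta \<Psi> x * (wD 1 (eta \<Psi>) x)\<^sup>2)
     + 15/4 * (LBINT x. (eta \<Psi> x)\<^sup>2 * (cmod (wD 1 \<Psi> x))\<^sup>2)
     + 5/16 * (LBINT x. (eta \<Psi> x)^4)"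

definition GP_E4 :: "(real \<Rightarrow> complex) \<Rightarrow> real" where
  "GP_E4 \<Psi> = 
       1/2 * (LBINT x. (cmod (wD 4 \<Psi> x))\<^sup>2)
     + 1/4 * (LBINT x. (wD 3 (eta \<Psi>) x)\<^sup>2)
     - 7/4 * (LBINT x. eta \<Psi> x * (wD 2 (eta \<Psi>) x)\<^sup>2)
     - 7/2 * (LBINT x. eta \<Psi> x * (cmod (wD 3 \<Psi> x))\<^sup>2)
     + 35/8 * (LBINT x. (eta \<Psi> x)\<^sup>2 * (wD 1 (eta \<Psi>) x)\<^sup>2)
     + 35/4 * (LBINT x. (eta \<Psi> x)\<^sup>2 * (cmod (wD 2 \<Psi> x))\<^sup>2)
     - 35/4 * (LBINT x. (wD 1 (eta \<Psi>) x)\<^sup>2 * (cmod (wD 1 \<Psi> x))\<^sup>2)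
     - 7/2 * (LBINT x. (cmod (wD 1 \<Psi> x))\<^sup>2 * (cmod (wD 2 \<Psi> x))\<^sup>2)
     - 7 * (LBINT x. wD 2 (eta \<Psi>) x * (wD 1 \<Psi> x \<bullet> wD 3 \<Psi> x))
     - 7 * (LBINT x. (cmod (wD 1 \<Psi> x))\<^sup>2 * (wD 1 \<Psi> x \<bullet> wD 3 \<Psi> x))
     - 35/2 * (LBINT x. eta \<Psi> x * wD 2 (eta \<Psi>) x * (cmod (wD 1 \<Psi> x))\<^sup>2)
     - 35/4 * (LBINT x. (eta \<Psi> x)^3 * (cmod (wD 1 \<Psi> x))\<^sup>2)
     - 35/4 * (LBINT x. eta \<Psi> x * (cmod (wD 1 \<Psi> x))^4)
     - 7/16 * (LBINT x. (eta \<Psi> x)^5)"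

text \<open>Only the indices 1 to 4 are meaningful here (and 1 to 3 for the momenta).\<close>

definition GP_E :: "nat \<Rightarrow> (real \<Rightarrow> complex) \<Rightarrow> real" where
  "GP_E k \<Psi> =
     (if k = 1 then GL_energy \<Psi> else
      if k = 2 then GP_E2 \<Psi> else
      if k = 3 then GP_E3 \<Psi> else
      if k = 4 then GP_E4 \<Psi> else undefined)"

definition GP_p1 :: "(real \<Rightarrow> complex) \<Rightarrow> (real \<Rightarrow> real) \<Rightarrow> real" where
  "GP_p1 \<Psi> \<phi> = 1/2 * (LBINT x. eta \<Psi> x * wD 1 \<phi> x)"

definition GP_P2 :: "(real \<Rightarrow> complex) \<Rightarrow> real" where
  "GP_P2 \<Psi> = 
       1/2 * (LBINT x. (\<i> * wD 2 \<Psi> x) \<bullet> wD 1 \<Psi> x)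
     - 3/4 * (LBINT x. eta \<Psi> x * ((\<i> * wD 1 \<Psi> x) \<bullet> \<Psi> x))"

definition GP_P3 :: "(real \<Rightarrow> complex) \<Rightarrow> real" where
  "GP_P3 \<Psi> = 
       1/2 * (LBINT x. (\<i> * wD 3 \<Psi> x) \<bullet> wD 2 \<Psi> x)
     - 5/2 * (LBINT x. eta \<Psi> x * ((\<i> * wD 2 \<Psi> x) \<bullet> wD 1 \<Psi> x))
     + 5/4 * (LBINT x. ((eta \<Psi> x)\<^sup>2 + eta \<Psi> x) * ((\<i> * wD 1 \<Psi> x) \<bullet> \<Psi> x))"

definition GP_p :: "nat \<Rightarrow> (real \<Rightarrow> complex) \<Rightarrow> (real \<Rightarrow> real) \<Rightarrow> real" where
  "GP_p k \<Psi> \<phi> =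
     (if k = 1 then GP_p1 \<Psi> \<phi> else
      if k = 2 then GP_P2 \<Psi> - 3/2 * GP_p1 \<Psi> \<phi> else
      if k = 3 then GP_P3 \<Psi> + 5/2 * GP_p1 \<Psi> \<phi> else undefined)"


section \<open>Rescaled functions and rescaled invariants\<close>

definition N_resc :: "real \<Rightarrow> (real \<Rightarrow> complex) \<Rightarrow> real \<Rightarrow> real" where
  "N_resc \<epsilon> \<Psi> x = 6 / \<epsilon>\<^sup>2 * eta \<Psi> (x / \<epsilon>)"

definition Theta_resc :: "real \<Rightarrow> (real \<Rightarrow> real) \<Rightarrow> real \<Rightarrow> real" where
  "Theta_resc \<epsilon> \<phi> x = 6 * sqrt 2 / \<epsilon> * \<phi> (x / \<epsilon>)"

text \<open>The rescaled invariants, evaluated at the rescaled functions of \<open>\<Psi>\<close> and its phase \<open>\<phi>\<close>, are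
  defined through \<open>E\<^sub>k(\<Psi>) = \<epsilon>^(2k+1) / 18 * \<E>\<^sub>k(N\<^sub>\<epsilon>, \<Theta>\<^sub>\<epsilon>)\<close>, and likewise for the momenta.\<close>

definition resc_E :: "nat \<Rightarrow> real \<Rightarrow> (real \<Rightarrow> complex) \<Rightarrow> real" where
  "resc_E k \<epsilon> \<Psi> = 18 / \<epsilon> ^ (2 * k + 1) * GP_E k \<Psi>"

definition resc_P :: "nat \<Rightarrow> real \<Rightarrow> (real \<Rightarrow> complex) \<Rightarrow> (real \<Rightarrow> real) \<Rightarrow> real" where
  "resc_P k \<epsilon> \<Psi> \<phi> = 18 / \<epsilon> ^ (2 * k + 1) * GP_p k \<Psi> \<phi>"


section \<open>Invariants of the Korteweg--de Vries equation\<close>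

definition KdV_E :: "nat \<Rightarrow> (real \<Rightarrow> real) \<Rightarrow> real" where
  "KdV_E k v =
     (if k = 0 then 1/2 * (LBINT x. (v x)\<^sup>2) else
      if k = 1 then 1/2 * (LBINT x. (wD 1 v x)\<^sup>2) - 1/6 * (LBINT x. (v x)^3) else
      if k = 2 then 1/2 * (LBINT x. (wD 2 v x)\<^sup>2) - 5/6 * (LBINT x. v x * (wD 1 v x)\<^sup>2)
                    + 5/72 * (LBINT x. (v x)^4) else undefined)"

end

theory Submission
  imports Defs "HOL-Real_Asymp.Real_Asymp"
begin

text \<open>Write \<open>q = \<Psi>' / \<Psi> = g + i w\<close>, so that \<open>w = \<phi>'\<close> and \<open>\<eta>' = - 2 (1 - \<eta>) g\<close>. The bounds on the energies,
  used successively with Agmon's inequality, show that \<open>\<eta>\<^sup>(\<^sup>j\<^sup>)\<close> and \<open>w\<^sup>(\<^sup>j\<^sup>)\<close> have size \<open>\<epsilon>\<close> to the power \<open>j + 2\<close>, whereas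
  \<open>g\<^sup>(\<^sup>j\<^sup>)\<close> has size \<open>\<epsilon>\<close> to the power \<open>j + 3\<close>. In these variables the densities of the invariants are
  polynomials, whose terms of lowest order add up, after integrations by parts, to the density
  of the KdV invariant of \<open>\<eta> \<plusminus> \<surd>2 w\<close>; all remaining terms are smaller by a factor \<open>\<epsilon>\<^sup>2\<close>.\<close>

section \<open>Primitives of locally integrable functions\<close>

text \<open>Weights organise the estimates: \<open>eta\<close> and \<open>w\<close> count 2, each
  derivative adds 1, and \<open>g = - eta' / (2 (1 - eta))\<close> counts 3. Up to exact
  derivatives, \<open>E_k + sigma p_k\<close> with \<open>sigma^2 = 2\<close> has lowest weight
  \<open>2 k + 2\<close> and next weight \<open>2 k + 4\<close>. The multiples of \<open>p_1\<close>
  in \<open>p_2\<close> and \<open>p_3\<close> remove precisely the weight 4 term in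
  \<open>eta w\<close>. Bounds up to \<open>E_(k+1)\<close> are required because the order of the
  top derivative of \<open>g\<close> is read off from one more derivative of \<open>eta\<close>. The
  energies have terms without sign, which must be absorbed before they control anything, and
  \<open>q\<close> makes sense only where \<open>Psi\<close> does not vanish; hence a crude bound
  \<open>1/2\<close> on \<open>eta\<close> comes first, from \<open>E_1\<close> alone. Uniform
  constants are obtained by treating all admissible pairs of a scale and a function as one indexed
  family, with constants chosen before the index. No rescaling takes place until the end. Weak
  derivatives are traded for absolutely continuous representatives: \<open>is_primitive u v\<close>
  needs no pointwise derivative of \<open>u\<close>, so the product rule rests on Fubini, and
  boundary terms vanish because the primitives are integrable.\<close>

definition is_primitive :: "(real \<Rightarrow> 'a::euclidean_space) \<Rightarrow> (real \<Rightarrow> 'a) \<Rightarrow> bool" where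
  "is_primitive u v \<longleftrightarrow> locally_integrable v \<and>
     (\<forall>a b. a \<le> b \<longrightarrow> u b - u a = (LBINT x:{a..b}. v x))"

lemma locally_integrableD: "locally_integrable u \<Longrightarrow> set_integrable lborel {a..b} u"
  by (simp add: locally_integrable_def)

lemma locally_integrable_borel:
  fixes u :: "real \<Rightarrow> 'a::euclidean_space"
  assumes "locally_integrable u"
  shows "u \<in> borel_measurable borel"
proof (rule borel_measurable_LIMSEQ_metric)
  fix n :: nat
  have "set_integrable lborel {- real n..real n} u"
    using assms by (rule locally_integrableD)
  then show "(\<lambda>x. indicator {- real n..real n} x *\<^sub>R u x) \<in> borel_measurable borel"
    unfolding set_integrable_def by (auto dest: borel_measurable_integrable)
next
  fix x :: real
  show "(\<lambda>n. indicator {- real n..real n} x *\<^sub>R u x) \<longlonglongrightarrow> u x"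
  proof (rule tendsto_eventually)
    obtain N :: nat where N: "\<bar>x\<bar> \<le> real N"
      using real_arch_simple by blast
    show "\<forall>\<^sub>F n in sequentially. indicator {- real n..real n} x *\<^sub>R u x = u x"
      using eventually_ge_at_top[of N]
      by eventually_elim (use N in \<open>auto simp: indicator_def\<close>)
  qed
qed

lemma locally_integrable_continuous:
  fixes u :: "real \<Rightarrow> 'a::euclidean_space"
  assumes "continuous_on UNIV u"
  shows "locally_integrable u"
  unfolding locally_integrable_def
  by (intro allI borel_integrable_atLeastAtMost' continuous_on_subset[OF assms]) auto

lemma locally_integrable_add:
  "locally_integrable u \<Longrightarrow> locally_integrable v \<Longrightarrow> locally_integrable (\<lambda>x. u x + v x)"
  unfolding locally_integrable_def by auto

lemma locally_integrable_diff:
  "locally_integrable u \<Longrightarrow> locally_integrable v \<Longrightarrow> locally_integrable (\<lambda>x. u x - v x)"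
  unfolding locally_integrable_def by auto

lemma locally_integrable_bounded_linear:
  assumes "bounded_linear h" "locally_integrable u"
  shows "locally_integrable (\<lambda>x. h (u x))"
proof -
  interpret bounded_linear h by fact
  have "integrable lborel (\<lambda>x. h (indicator {a..b} x *\<^sub>R u x))" for a b
    using assms by (intro integrable_bounded_linear[OF assms(1)])
       (simp add: locally_integrable_def set_integrable_def)
  then show ?thesis
    by (simp add: locally_integrable_def set_integrable_def scaleR)
qed

lemma set_integrable_bilinear_continuous:
  fixes h :: "'a::euclidean_space \<Rightarrow> 'b::euclidean_space \<Rightarrow> 'c::euclidean_space" and a b :: real
  assumes h: "bounded_bilinear h" and u: "set_integrable lborel {a..b} u"
    and v: "continuous_on {a..b} v"
  shows "set_integrable lborel {a..b} (\<lambda>x. h (u x) (v x))"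
proof -
  interpret h: bounded_bilinear h by fact
  obtain K where K: "K > 0" "\<And>x y. norm (h x y) \<le> norm x * norm y * K"
    using h.pos_bounded by blast
  have "bounded (v ` {a..b})"
    by (rule compact_imp_bounded[OF compact_continuous_image[OF v compact_Icc]])
  then obtain B where B: "\<And>x. x \<in> {a..b} \<Longrightarrow> norm (v x) \<le> B"
    unfolding bounded_iff by (metis image_eqI)
  have mu: "(\<lambda>x. indicator {a..b} x *\<^sub>R u x) \<in> borel_measurable lborel"
    using u unfolding set_integrable_def by (auto dest: borel_measurable_integrable)
  have mv: "(\<lambda>x. indicator {a..b} x *\<^sub>R v x) \<in> borel_measurable lborel"
    using borel_integrable_atLeastAtMost'[OF v] unfolding set_integrable_def
    by (auto dest: borel_measurable_integrable)
  have c: "continuous_on UNIV (\<lambda>p. h (fst p) (snd p))"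
    by (intro h.continuous_on continuous_intros)
  have eq: "indicator {a..b} x *\<^sub>R h (u x) (v x) =
      h (indicator {a..b} x *\<^sub>R u x) (indicator {a..b} x *\<^sub>R v x)" for x :: real
    by (auto simp: indicator_def h.zero_left)
  have "integrable lborel (\<lambda>x. h (indicator {a..b} x *\<^sub>R u x) (indicator {a..b} x *\<^sub>R v x))"
  proof (rule Bochner_Integration.integrable_bound)
    show "integrable lborel (\<lambda>x. K * B * norm (indicator {a..b} x *\<^sub>R u x))"
      using u unfolding set_integrable_def by (intro integrable_mult_right integrable_norm)
    show "(\<lambda>x. h (indicator {a..b} x *\<^sub>R u x) (indicator {a..b} x *\<^sub>R v x)) \<in> borel_measurable lborel"
      using borel_measurable_continuous_on[OF c, of "\<lambda>x. (indicator {a..b} x *\<^sub>R u x, indicator {a..b} x *\<^sub>R v x)" lborel] mu mv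
      by simp
    have "norm (h (u x) (v x)) \<le> K * B * norm (u x)" if "x \<in> {a..b}" for x
    proof -
      have "norm (h (u x) (v x)) \<le> norm (u x) * norm (v x) * K" by (rule K)
      also have "\<dots> \<le> norm (u x) * B * K"
        using B[OF that] K(1) by (intro mult_right_mono mult_left_mono) auto
      finally show ?thesis by (simp add: algebra_simps)
    qed
    then show "AE x in lborel. norm (h (indicator {a..b} x *\<^sub>R u x) (indicator {a..b} x *\<^sub>R v x))
        \<le> norm (K * B * norm (indicator {a..b} x *\<^sub>R u x))"
      by (intro AE_I2) (smt (verit) eq h.zero_left indicator_simps(1) indicator_simps(2) norm_ge_zero norm_zero real_norm_def scaleR_one scaleR_zero_left)
  qed
  then show ?thesis by (simp add: set_integrable_def eq)
qed

lemma is_primitive_locally_integrable: "is_primitive u v \<Longrightarrow> locally_integrable v"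
  by (simp add: is_primitive_def)

lemma is_primitive_eq:
  "is_primitive u v \<Longrightarrow> a \<le> b \<Longrightarrow> (LBINT x:{a..b}. v x) = u b - u a"
  by (simp add: is_primitive_def)

lemma is_primitive_eq_integral:
  assumes "is_primitive u v" "a \<le> b"
  shows "u b = u a + integral {a..b} v"
  using is_primitive_eq[OF assms] set_borel_integral_eq_integral(2)[OF locally_integrableD[OF is_primitive_locally_integrable[OF assms(1)]]]
  by (simp add: algebra_simps)

lemma is_primitive_continuous:
  assumes "is_primitive u v"
  shows "continuous_on UNIV u"
proof (rule continuous_at_imp_continuous_on, rule ballI)
  fix x :: real
  have "v integrable_on {x-1..x+1}"
    by (intro set_borel_integral_eq_integral(1) locally_integrableD is_primitive_locally_integrable[OF assms])
  then have "continuous_on {x-1..x+1} (\<lambda>y. u (x-1) + integral {x-1..y} v)"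
    by (intro continuous_intros indefinite_integral_continuous_1)
  then have "continuous_on {x-1..x+1} u"
    by (rule continuous_on_eq) (use is_primitive_eq_integral[OF assms] in auto)
  then show "isCont u x"
    using continuous_on_interior[of "{x-1..x+1}" u x] by (simp add: interior_atLeastAtMost_real)
qed

lemma is_primitive_borel: "is_primitive u v \<Longrightarrow> u \<in> borel_measurable borel"
  by (intro borel_measurable_continuous_onI is_primitive_continuous)

lemma is_primitive_has_vector_derivative:
  assumes "is_primitive u v" "continuous_on UNIV v"
  shows "(u has_vector_derivative v x) (at x)"
proof -
  have "((\<lambda>y. integral {x-1..y} v) has_vector_derivative v x) (at x within {x-1..x+1})"
    by (rule integral_has_vector_derivative) (auto intro: continuous_on_subset[OF assms(2)])
  then have "((\<lambda>y. u (x-1) + integral {x-1..y} v) has_vector_derivative v x) (at x within {x-1..x+1})"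
    by (auto intro: derivative_eq_intros)
  then have "(u has_vector_derivative v x) (at x within {x-1..x+1})"
    by (rule has_vector_derivative_transform[rotated 2])
       (use is_primitive_eq_integral[OF assms(1)] in auto)
  then show ?thesis
    using at_within_interior[of x "{x-1..x+1}"] by (simp add: interior_atLeastAtMost_real)
qed

lemma is_primitive_C1:
  assumes "\<And>x. (u has_vector_derivative v x) (at x)" "continuous_on UNIV v"
  shows "is_primitive u v"
  unfolding is_primitive_def
proof (intro conjI allI impI)
  show "locally_integrable v" by (rule locally_integrable_continuous) fact
  fix a b :: real assume "a \<le> b"
  then show "u b - u a = (LBINT x:{a..b}. v x)"
    unfolding set_lebesgue_integral_def
    by (intro integral_FTC_atLeastAtMost[symmetric])
       (auto intro: has_vector_derivative_at_within assms continuous_on_subset[OF assms(2)])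
qed

lemma is_primitive_integral:
  fixes v :: "real \<Rightarrow> 'a::euclidean_space"
  assumes v: "locally_integrable v"
  obtains u where "is_primitive u v"
proof
  let ?I = "\<lambda>a b. integral {a..b} v"
  \<comment> \<open>The integral over an interval with reversed ends is 0 here, so the sign for
    negative \<open>x\<close> is put in by hand.\<close>
  define u where "u x = (if x \<ge> 0 then ?I 0 x else - ?I x 0)" for x
  have i: "v integrable_on {a..b}" for a b
    by (intro set_borel_integral_eq_integral(1) locally_integrableD v)
  have c: "?I a b + ?I b c = ?I a c" if "a \<le> b" "b \<le> c" for a b c
    using Henstock_Kurzweil_Integration.integral_combine[OF that i] .
  show "is_primitive u v"
    unfolding is_primitive_def
  proof (intro conjI allI impI v)
    fix a b :: real assume ab: "a \<le> b"
    have "u b - u a = ?I a b"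
      using c[of 0 a b] c[of a 0 b] c[of a b 0] ab by (auto simp: u_def algebra_simps)
    then show "u b - u a = (LBINT x:{a..b}. v x)"
      using set_borel_integral_eq_integral(2)[OF locally_integrableD[OF v]] by simp
  qed
qed

lemma is_primitive_const: "is_primitive (\<lambda>x. c) (\<lambda>x. 0)"
  by (simp add: is_primitive_def locally_integrable_def set_integrable_def)

lemma is_primitive_add:
  assumes "is_primitive u v" "is_primitive u' v'"
  shows "is_primitive (\<lambda>x. u x + u' x) (\<lambda>x. v x + v' x)"
  using assms unfolding is_primitive_def
  by (auto intro: locally_integrable_add simp: locally_integrable_def algebra_simps)

lemma is_primitive_diff:
  assumes "is_primitive u v" "is_primitive u' v'"
  shows "is_primitive (\<lambda>x. u x - u' x) (\<lambda>x. v x - v' x)"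
  using assms unfolding is_primitive_def
  by (auto intro: locally_integrable_diff simp: locally_integrable_def algebra_simps)

lemma is_primitive_bounded_linear:
  assumes h: "bounded_linear h" and u: "is_primitive u v"
  shows "is_primitive (\<lambda>x. h (u x)) (\<lambda>x. h (v x))"
  unfolding is_primitive_def
proof (intro conjI allI impI)
  interpret bounded_linear h by fact
  show "locally_integrable (\<lambda>x. h (v x))"
    by (intro locally_integrable_bounded_linear[OF h] is_primitive_locally_integrable[OF u])
  fix a b :: real assume "a \<le> b"
  have "(LBINT x:{a..b}. h (v x)) = h (LBINT x:{a..b}. v x)"
    unfolding set_lebesgue_integral_def
    using locally_integrableD[OF is_primitive_locally_integrable[OF u], of a b]
    by (simp add: integral_bounded_linear[OF h, symmetric] scaleR[symmetric] set_integrable_def)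
  then show "h (u b) - h (u a) = (LBINT x:{a..b}. h (v x))"
    using is_primitive_eq[OF u \<open>a \<le> b\<close>] by (simp add: diff)
qed

lemmas is_primitive_cmult = is_primitive_bounded_linear[OF bounded_linear_mult_right]
lemmas is_primitive_Re = is_primitive_bounded_linear[OF bounded_linear_Re]
lemmas is_primitive_Im = is_primitive_bounded_linear[OF bounded_linear_Im]

section \<open>Product rule for absolutely continuous functions\<close>

text \<open>The product of the two increments is a double integral over a square; its two halves on
  either side of the diagonal are the two terms of the product rule.\<close>

lemma bilinear_increments:
  fixes h :: "'a::euclidean_space \<Rightarrow> 'b::euclidean_space \<Rightarrow> 'c::euclidean_space"
  assumes h: "bounded_bilinear h" and u1: "is_primitive u1 v1" and u2: "is_primitive u2 v2"
    and ab: "a \<le> b"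
  shows "h (u1 b - u1 a) (u2 b - u2 a) =
    (LBINT x:{a..b}. h (v1 x) (u2 x - u2 a)) + (LBINT y:{a..b}. h (u1 y - u1 a) (v2 y))"
proof -
  interpret h: bounded_bilinear h by fact
  define f where "f x = indicator {a..b} x *\<^sub>R v1 x" for x
  define g where "g x = indicator {a..b} x *\<^sub>R v2 x" for x
  have f: "integrable lborel f" and g: "integrable lborel g"
    using locally_integrableD[OF is_primitive_locally_integrable[OF u1], of a b]
      locally_integrableD[OF is_primitive_locally_integrable[OF u2], of a b]
    by (simp_all add: f_def[abs_def] g_def[abs_def] set_integrable_def)
  note [measurable] = borel_measurable_integrable[OF f] borel_measurable_integrable[OF g]
  obtain K where K: "K > 0" "\<And>x y. norm (h x y) \<le> norm x * norm y * K"
    using h.pos_bounded by blast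
  have ch: "continuous_on UNIV (\<lambda>p. h (fst p) (snd p))"
    by (intro h.continuous_on continuous_intros)
  \<comment> \<open>\<open>Q\<close> is the half of the square above the diagonal. Fubini is needed
    for this half alone: \<open>sp\<close> splits every slice in \<open>x\<close>, and
    \<open>E1\<close> evaluates its part below the diagonal at once.\<close>
  define Q where "Q x y = indicator {p. fst p < snd p} (x, y) *\<^sub>R h (f x) (g y)" for x y
  have mh: "(\<lambda>p. h (f (fst p)) (g (snd p))) \<in> borel_measurable (lborel \<Otimes>\<^sub>M lborel)"
    using borel_measurable_continuous_on[OF ch, of "\<lambda>p. (f (fst p), g (snd p))" "lborel \<Otimes>\<^sub>M lborel"]
    by simp
  have [measurable]: "case_prod Q \<in> borel_measurable (lborel \<Otimes>\<^sub>M lborel)"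
  proof -
    have "{p. fst p < snd p} \<in> sets (lborel \<Otimes>\<^sub>M (lborel :: real measure))"
      using borel_measurable_less[of fst "lborel \<Otimes>\<^sub>M (lborel :: real measure)" snd]
      by (simp add: space_pair_measure)
    then have "(\<lambda>p. indicator {p. fst p < snd p} p *\<^sub>R h (f (fst p)) (g (snd p)))
        \<in> borel_measurable (lborel \<Otimes>\<^sub>M lborel)"
      using mh by (intro borel_measurable_scaleR borel_measurable_indicator)
    moreover have "(\<lambda>p. indicator {p. fst p < snd p} p *\<^sub>R h (f (fst p)) (g (snd p))) = case_prod Q"
      by (auto simp: Q_def fun_eq_iff)
    ultimately show ?thesis by simp
  qed
  have gi: "integrable lborel (\<lambda>y. indicator A y *\<^sub>R g y)" if "A \<in> sets borel" for A
    using integrable_mult_indicator[OF _ g, of A] that by simp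
  have fi: "integrable lborel (\<lambda>y. indicator A y *\<^sub>R f y)" if "A \<in> sets borel" for A
    using integrable_mult_indicator[OF _ f, of A] that by simp
  have hf: "(\<integral>y. h z (w y) \<partial>lborel) = h z (\<integral>y. w y \<partial>lborel)" "integrable lborel (\<lambda>y. h z (w y))"
    if "integrable lborel w" for z w
    using integral_bounded_linear[OF h.bounded_linear_right that]
      integrable_bounded_linear[OF h.bounded_linear_right that] by auto
  have hg: "(\<integral>y. h (w y) z \<partial>lborel) = h (\<integral>y. w y \<partial>lborel) z" "integrable lborel (\<lambda>y. h (w y) z)"
    if "integrable lborel w" for z w
    using integral_bounded_linear[OF h.bounded_linear_left that]
      integrable_bounded_linear[OF h.bounded_linear_left that] by auto
  have Q1: "Q x y = h (f x) (indicator {x<..} y *\<^sub>R g y)" for x y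
    by (auto simp: Q_def indicator_def h.zero_right)
  have Q2: "Q x y = h (indicator {..<y} x *\<^sub>R f x) (g y)" for x y
    by (auto simp: Q_def indicator_def h.zero_left)
  have QI: "integrable (lborel \<Otimes>\<^sub>M lborel) (case_prod Q)"
  proof (rule lborel_pair.Fubini_integrable)
    show "AE x in lborel. integrable lborel (\<lambda>y. case_prod Q (x, y))"
      by (simp add: Q1 hf gi)
    let ?G = "\<integral>y. norm (g y) \<partial>lborel"
    have "(\<integral>y. norm (Q x y) \<partial>lborel) \<le> norm (f x) * ?G * K" for x
    proof -
      have "(\<integral>y. norm (Q x y) \<partial>lborel) \<le> (\<integral>y. norm (f x) * norm (g y) * K \<partial>lborel)"
      proof (rule integral_mono)
        show "integrable lborel (\<lambda>y. norm (Q x y))"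
          by (auto simp: Q1 intro!: integrable_norm hf gi)
        show "norm (Q x y) \<le> norm (f x) * norm (g y) * K" for y
          using K by (auto simp: Q_def indicator_def)
      qed (use g in auto)
      then show ?thesis by simp
    qed
    then have le: "norm (\<integral>y. norm (Q x y) \<partial>lborel) \<le> norm (norm (f x) * ?G * K)" for x
      unfolding real_norm_def abs_of_nonneg[OF Bochner_Integration.integral_nonneg[OF norm_ge_zero]]
      by (rule order_trans[OF _ abs_ge_self])
    show "integrable lborel (\<lambda>x. \<integral>y. norm (case_prod Q (x, y)) \<partial>lborel)"
    proof (rule Bochner_Integration.integrable_bound)
      show "integrable lborel (\<lambda>x. norm (f x) * ?G * K)"
        by (intro integrable_mult_left integrable_norm f)
      show "(\<lambda>x. \<integral>y. norm (case_prod Q (x, y)) \<partial>lborel) \<in> borel_measurable lborel"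
        by measurable
      show "AE x in lborel. norm (\<integral>y. norm (case_prod Q (x, y)) \<partial>lborel) \<le> norm (norm (f x) * ?G * K)"
        using le by simp
    qed
  qed simp
  have I1: "(\<integral>y. indicator {..x} y *\<^sub>R g y \<partial>lborel) = u2 x - u2 a" if "x \<in> {a..b}" for x
  proof -
    have "(\<integral>y. indicator {..x} y *\<^sub>R g y \<partial>lborel) = (LBINT y:{a..x}. v2 y)"
      unfolding set_lebesgue_integral_def
      by (rule Bochner_Integration.integral_cong) (use that in \<open>auto simp: g_def indicator_def\<close>)
    then show ?thesis using is_primitive_eq[OF u2, of a x] that by simp
  qed
  have I2: "(\<integral>y. indicator {..<x} y *\<^sub>R f y \<partial>lborel) = u1 x - u1 a" if "x \<in> {a..b}" for x
  proof -
    \<comment> \<open>The strict inequality in \<open>Q\<close> makes this interval half open; the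
      missing endpoint is a null set.\<close>
    have "(\<integral>y. indicator {..<x} y *\<^sub>R f y \<partial>lborel) = (\<integral>y. indicator {a..x} y *\<^sub>R v1 y \<partial>lborel)"
    proof (rule integral_cong_AE)
      show "AE y in lborel. indicator {..<x} y *\<^sub>R f y = indicator {a..x} y *\<^sub>R v1 y"
        using AE_lborel_singleton[of x]
        by eventually_elim (use that in \<open>auto simp: f_def indicator_def\<close>)
      show "(\<lambda>y. indicator {a..x} y *\<^sub>R v1 y) \<in> borel_measurable lborel"
        using locally_integrable_borel[OF is_primitive_locally_integrable[OF u1]] by simp
    qed simp
    also have "\<dots> = (LBINT y:{a..x}. v1 y)" by (simp add: set_lebesgue_integral_def)
    finally show ?thesis using is_primitive_eq[OF u1, of a x] that by simp
  qed
  have F1: "integrable lborel (\<lambda>x. h (f x) (u2 x - u2 a))"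
    and F2: "integrable lborel (\<lambda>x. h (u1 x - u1 a) (g x))"
  proof -
    have c: "continuous_on {a..b} (\<lambda>x. u2 x - u2 a)" "continuous_on {a..b} (\<lambda>x. u1 x - u1 a)"
      by (intro continuous_intros continuous_on_subset[OF is_primitive_continuous[OF u2]]
          continuous_on_subset[OF is_primitive_continuous[OF u1]]; simp)+
    have "set_integrable lborel {a..b} (\<lambda>x. h (v1 x) (u2 x - u2 a))"
      by (intro set_integrable_bilinear_continuous[OF h] c locally_integrableD is_primitive_locally_integrable[OF u1])
    then show "integrable lborel (\<lambda>x. h (f x) (u2 x - u2 a))"
      unfolding set_integrable_def f_def by (simp add: h.scaleR_left)
    have "set_integrable lborel {a..b} (\<lambda>x. h (u1 x - u1 a) (v2 x))"
      by (intro set_integrable_bilinear_continuous[OF bounded_bilinear.flip[OF h]] c locally_integrableD is_primitive_locally_integrable[OF u2])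
    then show "integrable lborel (\<lambda>x. h (u1 x - u1 a) (g x))"
      unfolding set_integrable_def g_def by (simp add: h.scaleR_right)
  qed
  have E1: "(\<integral>y. h (f x) (indicator {..x} y *\<^sub>R g y) \<partial>lborel) = h (f x) (u2 x - u2 a)" for x
    by (subst hf(1), rule gi, simp, cases "x \<in> {a..b}") (simp add: I1, simp add: f_def h.zero_left)
  have E2: "(\<integral>x. Q x y \<partial>lborel) = h (u1 y - u1 a) (g y)" for y
    unfolding Q2
    by (subst hg(1), rule fi, simp, cases "y \<in> {a..b}") (simp add: I2, simp add: g_def h.zero_right)
  have sp: "(\<integral>y. h (f x) (indicator {..x} y *\<^sub>R g y) \<partial>lborel) + (\<integral>y. Q x y \<partial>lborel) = h (f x) (\<integral>y. g y \<partial>lborel)" for x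
  proof -
    have "(\<integral>y. h (f x) (indicator {..x} y *\<^sub>R g y) \<partial>lborel) + (\<integral>y. Q x y \<partial>lborel) =
      (\<integral>y. h (f x) (indicator {..x} y *\<^sub>R g y) + Q x y \<partial>lborel)"
      by (intro Bochner_Integration.integral_add[symmetric]) (auto simp: Q1 intro!: hf gi)
    also have "\<dots> = (\<integral>y. h (f x) (g y) \<partial>lborel)"
      by (intro Bochner_Integration.integral_cong) (auto simp: Q1 indicator_def h.zero_right)
    finally show ?thesis using hf(1)[OF g] by simp
  qed
  have intg: "(\<integral>y. g y \<partial>lborel) = u2 b - u2 a" "(\<integral>y. f y \<partial>lborel) = u1 b - u1 a"
    using is_primitive_eq[OF u2 ab] is_primitive_eq[OF u1 ab]
    by (auto simp: g_def f_def set_lebesgue_integral_def)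
  have "h (u1 b - u1 a) (u2 b - u2 a) = (\<integral>x. h (f x) (u2 b - u2 a) \<partial>lborel)"
    using hg(1)[OF f] intg by simp
  also have "\<dots> = (\<integral>x. h (f x) (u2 x - u2 a) + (\<integral>y. Q x y \<partial>lborel) \<partial>lborel)"
    using sp intg by (simp add: E1)
  also have "\<dots> = (\<integral>x. h (f x) (u2 x - u2 a) \<partial>lborel) + (\<integral>x. (\<integral>y. Q x y \<partial>lborel) \<partial>lborel)"
    by (rule Bochner_Integration.integral_add) (use F1 lborel_pair.integrable_fst[OF QI] in auto)
  also have "(\<integral>x. (\<integral>y. Q x y \<partial>lborel) \<partial>lborel) = (\<integral>y. (\<integral>x. Q x y \<partial>lborel) \<partial>lborel)"
    by (rule lborel_pair.Fubini_integral[symmetric]) (rule QI)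
  finally show ?thesis
    by (simp add: E2 set_lebesgue_integral_def f_def g_def h.scaleR_left h.scaleR_right)
qed

lemma is_primitive_bilinear:
  fixes h :: "'a::euclidean_space \<Rightarrow> 'b::euclidean_space \<Rightarrow> 'c::euclidean_space"
  assumes h: "bounded_bilinear h" and u1: "is_primitive u1 v1" and u2: "is_primitive u2 v2"
  shows "is_primitive (\<lambda>x. h (u1 x) (u2 x)) (\<lambda>x. h (v1 x) (u2 x) + h (u1 x) (v2 x))"
proof -
  interpret h: bounded_bilinear h by fact
  have i: "set_integrable lborel {a..b} (\<lambda>x. h (v1 x) (u2 x))"
      "set_integrable lborel {a..b} (\<lambda>x. h (u1 x) (v2 x))" for a b
    by (intro set_integrable_bilinear_continuous[OF h] set_integrable_bilinear_continuous[OF bounded_bilinear.flip[OF h]]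
        locally_integrableD is_primitive_locally_integrable[OF u1] is_primitive_locally_integrable[OF u2]
        continuous_on_subset[OF is_primitive_continuous[OF u1]] continuous_on_subset[OF is_primitive_continuous[OF u2]]; simp)+
  show ?thesis
    unfolding is_primitive_def
  proof (intro conjI allI impI)
    show "locally_integrable (\<lambda>x. h (v1 x) (u2 x) + h (u1 x) (v2 x))"
      by (intro locally_integrable_add) (simp_all add: locally_integrable_def i)
    fix a b :: real assume ab: "a \<le> b"
    have l: "is_primitive (\<lambda>x. h (u1 x) (u2 a)) (\<lambda>x. h (v1 x) (u2 a))"
         "is_primitive (\<lambda>x. h (u1 a) (u2 x)) (\<lambda>x. h (u1 a) (v2 x))"
      by (intro is_primitive_bounded_linear[OF h.bounded_linear_left u1] is_primitive_bounded_linear[OF h.bounded_linear_right u2])+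
    have li: "set_integrable lborel {a..b} (\<lambda>x. h (v1 x) (u2 a))" "set_integrable lborel {a..b} (\<lambda>x. h (u1 a) (v2 x))"
      using l by (auto intro: locally_integrableD is_primitive_locally_integrable)
    have "h (u1 b - u1 a) (u2 b - u2 a) = (LBINT x:{a..b}. h (v1 x) (u2 x)) - (LBINT x:{a..b}. h (v1 x) (u2 a))
       + ((LBINT x:{a..b}. h (u1 x) (v2 x)) - (LBINT x:{a..b}. h (u1 a) (v2 x)))"
      unfolding bilinear_increments[OF h u1 u2 ab]
      by (simp add: h.diff_left h.diff_right set_integral_diff i li)
    also have "\<dots> = (LBINT x:{a..b}. h (v1 x) (u2 x) + h (u1 x) (v2 x))
        - (h (u1 b) (u2 a) - h (u1 a) (u2 a)) - (h (u1 a) (u2 b) - h (u1 a) (u2 a))"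
      using is_primitive_eq[OF l(1) ab] is_primitive_eq[OF l(2) ab] by (simp add: i)
    finally show "h (u1 b) (u2 b) - h (u1 a) (u2 a) = (LBINT x:{a..b}. h (v1 x) (u2 x) + h (u1 x) (v2 x))"
      by (simp add: h.diff_left h.diff_right algebra_simps)
  qed
qed

lemma is_primitive_mult:
  fixes u1 u2 :: "real \<Rightarrow> 'a::{euclidean_space, real_normed_algebra}"
  shows "is_primitive u1 v1 \<Longrightarrow> is_primitive u2 v2 \<Longrightarrow>
    is_primitive (\<lambda>x. u1 x * u2 x) (\<lambda>x. v1 x * u2 x + u1 x * v2 x)"
  by (rule is_primitive_bilinear[OF bounded_bilinear_mult])

lemma is_primitive_inner:
  "is_primitive u1 v1 \<Longrightarrow> is_primitive u2 v2 \<Longrightarrow>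
    is_primitive (\<lambda>x. u1 x \<bullet> u2 x) (\<lambda>x. v1 x \<bullet> u2 x + u1 x \<bullet> v2 x)"
  by (rule is_primitive_bilinear[OF bounded_bilinear_inner])

section \<open>Integrable primitives at infinity\<close>

text \<open>Otherwise \<open>S\<close> would lie in a superlevel set of \<open>norm F\<close>, whose
  measure is finite by Markov's inequality.\<close>

lemma not_integrable_bounded_below:
  fixes F :: "real \<Rightarrow> 'a::euclidean_space"
  assumes F: "integrable lborel F" and d: "\<delta> > 0" and S: "emeasure lborel S = \<infinity>" "S \<in> sets borel"
  shows "\<exists>x\<in>S. norm (F x) < \<delta>"
proof (rule ccontr)
  assume "\<not> ?thesis"
  then have sub: "S \<subseteq> {x \<in> space lborel. norm (F x) \<ge> \<delta>}" by (auto simp: not_less)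
  note [measurable] = borel_measurable_integrable[OF F]
  have "emeasure lborel S \<le> emeasure lborel {x \<in> space lborel. norm (F x) \<ge> \<delta>}"
    by (rule emeasure_mono[OF sub]) measurable
  also have "\<dots> \<le> ennreal ((1/\<delta>) * (\<integral>x. norm (F x) \<partial>lborel))"
    by (rule integral_Markov_inequality) (use F d in auto)
  also have "\<dots> < \<infinity>" by simp
  finally show False using S by simp
qed

lemma emeasure_lborel_half_lines:
  fixes M :: real
  shows "emeasure lborel {M..} = \<infinity>" "emeasure lborel {..M} = \<infinity>"
proof -
  have *: "x = \<infinity>" if "\<And>n::nat. ennreal (real n) \<le> x" for x :: ennreal
  proof (rule ccontr)
    assume "x \<noteq> \<infinity>"
    then obtain r where r: "x = ennreal r" "r \<ge> 0" by (cases x) auto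
    obtain n :: nat where "real n > r" using reals_Archimedean2 by blast
    with that[of n] r show False by (simp add: ennreal_le_iff)
  qed
  show "emeasure lborel {M..} = \<infinity>"
  proof (rule *)
    fix n :: nat
    have "ennreal (real n) = emeasure lborel {M..M + real n}" by simp
    also have "\<dots> \<le> emeasure lborel {M..}" by (rule emeasure_mono) auto
    finally show "ennreal (real n) \<le> emeasure lborel {M..}" .
  qed
  show "emeasure lborel {..M} = \<infinity>"
  proof (rule *)
    fix n :: nat
    have "ennreal (real n) = emeasure lborel {M - real n..M}" by simp
    also have "\<dots> \<le> emeasure lborel {..M}" by (rule emeasure_mono) auto
    finally show "ennreal (real n) \<le> emeasure lborel {..M}" .
  qed
qed

text \<open>An integrable function need not tend to 0 at infinity, but it is small somewhere on
  every half line. Two such sequences suffice to dispose of boundary terms.\<close>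

lemma small_at_infinity:
  fixes F :: "real \<Rightarrow> 'a::euclidean_space"
  assumes F: "integrable lborel F"
  obtains a b :: "nat \<Rightarrow> real" where "\<And>n. a n \<le> - real n" "\<And>n. real n \<le> b n"
    "(\<lambda>n. F (a n)) \<longlonglongrightarrow> 0" "(\<lambda>n. F (b n)) \<longlonglongrightarrow> 0"
proof -
  have "\<exists>x. x \<le> - real n \<and> norm (F x) < 1 / real (Suc n)" for n
    using not_integrable_bounded_below[OF F, of "1 / real (Suc n)" "{..- real n}"] emeasure_lborel_half_lines by auto
  then obtain a where a: "\<And>n. a n \<le> - real n" "\<And>n. norm (F (a n)) < 1 / real (Suc n)" by metis
  have "\<exists>x. x \<ge> real n \<and> norm (F x) < 1 / real (Suc n)" for n
    using not_integrable_bounded_below[OF F, of "1 / real (Suc n)" "{real n..}"] emeasure_lborel_half_lines by auto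
  then obtain b where b: "\<And>n. b n \<ge> real n" "\<And>n. norm (F (b n)) < 1 / real (Suc n)" by metis
  show ?thesis
  proof (rule that)
    show "(\<lambda>n. F (a n)) \<longlonglongrightarrow> 0"
      by (rule Lim_null_comparison[OF _ LIMSEQ_inverse_real_of_nat])
         (use a(2) in \<open>auto simp: inverse_eq_divide intro!: always_eventually less_imp_le\<close>)
    show "(\<lambda>n. F (b n)) \<longlonglongrightarrow> 0"
      by (rule Lim_null_comparison[OF _ LIMSEQ_inverse_real_of_nat])
         (use b(2) in \<open>auto simp: inverse_eq_divide intro!: always_eventually less_imp_le\<close>)
  qed (use a b in auto)
qed

text \<open>This is integration by parts on the whole line: the integral over
  \<open>{a n..b n}\<close> is a difference of boundary values that tends to 0, and dominated
  convergence identifies its limit. No decay of \<open>F\<close> beyond integrability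
  enters.\<close>

lemma integral_derivative_eq_0:
  assumes p: "is_primitive F G" and F: "integrable lborel F" and G: "integrable lborel G"
  shows "(LBINT x. G x) = 0"
proof -
  obtain a b where ab: "\<And>n. a n \<le> - real n" "\<And>n. real n \<le> b n"
    and lim: "(\<lambda>n. F (a n)) \<longlonglongrightarrow> 0" "(\<lambda>n. F (b n)) \<longlonglongrightarrow> 0"
    using small_at_infinity[OF F] by metis
  have "(\<lambda>n. \<integral>x. indicator {a n..b n} x *\<^sub>R G x \<partial>lborel) \<longlonglongrightarrow> (\<integral>x. G x \<partial>lborel)"
  proof (rule integral_dominated_convergence[where w="\<lambda>x. norm (G x)"])
    show "AE x in lborel. (\<lambda>n. indicator {a n..b n} x *\<^sub>R G x) \<longlonglongrightarrow> G x"
    proof (rule AE_I2)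
      fix x :: real
      obtain N :: nat where N: "\<bar>x\<bar> \<le> real N" using real_arch_simple by blast
      have "indicator {a n..b n} x *\<^sub>R G x = G x" if "n \<ge> N" for n
      proof -
        have "real N \<le> real n" using that by simp
        then have "x \<in> {a n..b n}" using N ab(1)[of n] ab(2)[of n] by (auto simp: abs_le_iff)
        then show ?thesis by simp
      qed
      then show "(\<lambda>n. indicator {a n..b n} x *\<^sub>R G x) \<longlonglongrightarrow> G x"
        by (intro tendsto_eventually) (auto simp: eventually_sequentially)
    qed
  qed (use G in \<open>auto simp: indicator_def\<close>)
  moreover have "(\<integral>x. indicator {a n..b n} x *\<^sub>R G x \<partial>lborel) = F (b n) - F (a n)" for n
    using is_primitive_eq[OF p, of "a n" "b n"] ab(1)[of n] ab(2)[of n]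
    by (simp add: set_lebesgue_integral_def)
  moreover have "(\<lambda>n. F (b n) - F (a n)) \<longlonglongrightarrow> 0 - 0" using lim by (intro tendsto_diff)
  ultimately show ?thesis using LIMSEQ_unique by fastforce
qed

text \<open>The value at \<open>x\<close> is compared with values at points far to the left where
  \<open>F\<close> is small. Both Agmon's inequality and the first bound on \<open>eta\<close> come
  from here.\<close>

lemma norm_le_integral_derivative:
  assumes p: "is_primitive F G" and F: "integrable lborel F" and G: "integrable lborel G"
  shows "norm (F x) \<le> (LBINT x. norm (G x))"
proof -
  obtain a b where ab: "\<And>n. a n \<le> - real n" "\<And>n. real n \<le> b n"
    and lim: "(\<lambda>n. F (a n)) \<longlonglongrightarrow> 0" "(\<lambda>n. F (b n)) \<longlonglongrightarrow> 0"
    using small_at_infinity[OF F] by metis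
  obtain N :: nat where N: "\<bar>x\<bar> \<le> real N" using real_arch_simple by blast
  have "norm (F x - F (a n)) \<le> (LBINT x. norm (G x))" if "n \<ge> N" for n
  proof -
    have "real N \<le> real n" using that by simp
    then have "a n \<le> x" using N ab(1)[of n] by linarith
    then have "norm (F x - F (a n)) = norm (\<integral>y. indicator {a n..x} y *\<^sub>R G y \<partial>lborel)"
      using is_primitive_eq[OF p, of "a n" x] by (simp add: set_lebesgue_integral_def)
    also have "\<dots> \<le> (\<integral>y. norm (indicator {a n..x} y *\<^sub>R G y) \<partial>lborel)"
      by (rule integral_norm_bound)
    also have "\<dots> \<le> (LBINT x. norm (G x))"
      using G by (intro integral_mono integrable_norm integrable_mult_indicator) (auto simp: indicator_def)
    finally show ?thesis .
  qed
  moreover have "(\<lambda>n. norm (F x - F (a n))) \<longlonglongrightarrow> norm (F x - 0)"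
    using lim by (intro tendsto_intros)
  ultimately show ?thesis
    using tendsto_upperbound[of "\<lambda>n. norm (F x - F (a n))" "norm (F x)" sequentially]
    by (auto simp: eventually_sequentially)
qed

section \<open>Test functions\<close>

text \<open>The span of the functions \<open>x\<^sup>l y\<^sup>-\<^sup>m exp (- c / y)\<close> with \<open>y = (x - a) (b - x)\<close>, extended by zero, is stable under
  differentiation; for \<open>l = m = 0\<close> they tend to the indicator of \<open>(a, b)\<close> as \<open>c\<close> tends to zero.\<close>

definition exp_bump :: "real \<Rightarrow> nat \<Rightarrow> real \<Rightarrow> real" where
  "exp_bump c m y = (if y > 0 then exp (- c / y) / y ^ m else 0)"

text \<open>Away from 0 this is the chain rule. At 0 the exponential beats every power of
  \<open>y\<close>, so both one-sided difference quotients tend to 0.\<close>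

lemma exp_bump_has_derivative:
  assumes c: "c > 0"
  shows "(exp_bump c m has_real_derivative - real m * exp_bump c (Suc m) y + c * exp_bump c (Suc (Suc m)) y) (at y)"
proof -
  consider "y > 0" | "y < 0" | "y = 0" by linarith
  then show ?thesis
  proof cases
    case 1
    have "((\<lambda>y. exp (- c / y) / y ^ m) has_real_derivative
       - real m * exp_bump c (Suc m) y + c * exp_bump c (Suc (Suc m)) y) (at y)"
    proof (rule DERIV_cong)
      have "((\<lambda>y. - c / y) has_real_derivative c / y\<^sup>2) (at y)"
        using 1 by (auto intro!: derivative_eq_intros simp: power2_eq_square)
      then have "((\<lambda>y. exp (- c / y)) has_real_derivative exp (- c / y) * (c / y\<^sup>2)) (at y)"
        by (rule DERIV_fun_exp)
      then show "((\<lambda>y. exp (- c / y) / y ^ m) has_real_derivative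
        (exp (- c / y) * (c / y\<^sup>2) * y ^ m - exp (- c / y) * (real m * y ^ (m - Suc 0))) / (y ^ m * y ^ m)) (at y)"
        using 1 by (intro DERIV_divide DERIV_pow) auto
      show "(exp (- c / y) * (c / y\<^sup>2) * y ^ m - exp (- c / y) * (real m * y ^ (m - Suc 0))) / (y ^ m * y ^ m) =
         - real m * exp_bump c (Suc m) y + c * exp_bump c (Suc (Suc m)) y"
        using 1 by (cases m) (simp_all add: exp_bump_def field_simps power2_eq_square)
    qed
    then show ?thesis
      by (rule DERIV_cong_ev[THEN iffD1, rotated -1])
         (use 1 in \<open>auto simp: exp_bump_def intro!: eventually_mono[OF eventually_gt_at_top] eventually_nhds_in_open[of "{0<..}", THEN eventually_mono]\<close>)
  next
    case 2
    have "((\<lambda>y. 0) has_real_derivative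
       - real m * exp_bump c (Suc m) y + c * exp_bump c (Suc (Suc m)) y) (at y)"
      using 2 by (auto simp: exp_bump_def intro!: derivative_eq_intros)
    then show ?thesis
      by (rule DERIV_cong_ev[THEN iffD1, rotated -1])
         (use 2 in \<open>auto simp: exp_bump_def intro!: eventually_nhds_in_open[of "{..<0}", THEN eventually_mono]\<close>)
  next
    case 3
    have "((\<lambda>y. exp (- c / y) / y ^ m / y) \<longlongrightarrow> 0) (at_right 0)"
      using c by real_asymp
    then have "((\<lambda>y. exp_bump c m y / y) \<longlongrightarrow> 0) (at_right 0)"
      by (rule Lim_transform_eventually)
         (auto simp: exp_bump_def eventually_at_right_less intro: eventually_mono[OF eventually_at_right_less])
    moreover have "((\<lambda>y. exp_bump c m y / y) \<longlongrightarrow> 0) (at_left 0)"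
      by (rule Lim_transform_eventually[OF tendsto_const])
         (auto simp: exp_bump_def eventually_at_filter)
    ultimately have "((\<lambda>y. exp_bump c m y / y) \<longlongrightarrow> 0) (at 0)"
      by (intro filterlim_split_at)
    then show ?thesis
      using 3 by (simp add: has_field_derivative_iff exp_bump_def)
  qed
qed

inductive_set bumps :: "(real \<Rightarrow> real) set" where
  bump: "c > 0 \<Longrightarrow> (\<lambda>x. x ^ l * exp_bump c m ((x - a) * (b - x))) \<in> bumps"
| add: "f \<in> bumps \<Longrightarrow> g \<in> bumps \<Longrightarrow> (\<lambda>x. f x + g x) \<in> bumps"
| scale: "f \<in> bumps \<Longrightarrow> (\<lambda>x. r * f x) \<in> bumps"

lemma bumps_derivative: "f \<in> bumps \<Longrightarrow> \<exists>f'\<in>bumps. \<forall>x. (f has_real_derivative f' x) (at x)"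
proof (induction rule: bumps.induct)
  case (bump c l m a b)
  define B where "B l m x = x ^ l * exp_bump c m ((x - a) * (b - x))" for l m x
  have B: "B l m \<in> bumps" for l m
    using bumps.bump[OF bump, of l m a b] by (simp add: B_def[abs_def])
  \<comment> \<open>The inner derivative \<open>a + b - 2 * x\<close> splits each of the two terms
    from \<open>exp_bump\<close> into one with \<open>l\<close> and one with \<open>Suc l\<close>.
    For \<open>l = 0\<close> the truncated \<open>l - 1\<close> is harmless, since its coefficient
    is 0.\<close>
  define f' where "f' x = real l * B (l - 1) m x + ((- real m * (a + b)) * B l (Suc m) x
      + (2 * real m) * B (Suc l) (Suc m) x + (c * (a + b)) * B l (Suc (Suc m)) x + (- 2 * c) * B (Suc l) (Suc (Suc m)) x)" for x
  have "f' \<in> bumps"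
    unfolding f'_def[abs_def] by (intro bumps.add bumps.scale B)
  moreover have "((\<lambda>x. x ^ l * exp_bump c m ((x - a) * (b - x))) has_real_derivative f' x) (at x)" for x
  proof -
    have 1: "((\<lambda>x. (x - a) * (b - x)) has_real_derivative (a + b - 2 * x)) (at x)"
      by (auto intro!: derivative_eq_intros)
    have "((\<lambda>x. x ^ l * exp_bump c m ((x - a) * (b - x))) has_real_derivative
      real l * x ^ (l - 1) * exp_bump c m ((x - a) * (b - x)) +
      ((- real m * exp_bump c (Suc m) ((x - a) * (b - x)) + c * exp_bump c (Suc (Suc m)) ((x - a) * (b - x)))
        * (a + b - 2 * x)) * x ^ l) (at x)"
      by (intro DERIV_mult DERIV_chain2[OF exp_bump_has_derivative[OF bump] 1])
         (auto intro!: derivative_eq_intros)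
    then show ?thesis by (rule DERIV_cong) (simp add: f'_def B_def algebra_simps)
  qed
  ultimately show ?case by blast
next
  case (add f g)
  then obtain f' g' where "f' \<in> bumps" "g' \<in> bumps" "\<And>x. (f has_real_derivative f' x) (at x)"
    "\<And>x. (g has_real_derivative g' x) (at x)" by blast
  then show ?case
    by (intro bexI[of _ "\<lambda>x. f' x + g' x"] bumps.add) (auto intro!: derivative_eq_intros)
next
  case (scale f r)
  then obtain f' where "f' \<in> bumps" "\<And>x. (f has_real_derivative f' x) (at x)" by blast
  then show ?case
    by (intro bexI[of _ "\<lambda>x. r * f' x"] bumps.scale) (auto intro!: derivative_eq_intros)
qed

lemma bumps_support: "f \<in> bumps \<Longrightarrow> \<exists>M. \<forall>x. \<bar>x\<bar> > M \<longrightarrow> f x = 0"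
proof (induction rule: bumps.induct)
  case (bump c l m a b)
  have "x ^ l * exp_bump c m ((x - a) * (b - x)) = 0" if "\<bar>x\<bar> > \<bar>a\<bar> + \<bar>b\<bar>" for x
  proof -
    have "(x - a) * (b - x) \<le> 0"
      using that by (cases "x \<ge> 0") (intro mult_nonneg_nonpos mult_nonpos_nonneg; linarith)+
    then show ?thesis by (simp add: exp_bump_def)
  qed
  then show ?case by blast
next
  case (add f g)
  then obtain M N where M: "\<forall>x. \<bar>x\<bar> > M \<longrightarrow> f x = 0" "\<forall>x. \<bar>x\<bar> > N \<longrightarrow> g x = 0" by blast
  then show ?case by (intro exI[of _ "max M N"]) auto
qed auto

lemma compact_support:
  fixes f :: "real \<Rightarrow> real"
  assumes "\<And>x. \<bar>x\<bar> > M \<Longrightarrow> f x = 0"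
  shows "compact (closure {x. f x \<noteq> 0})"
proof -
  have "{x. f x \<noteq> 0} \<subseteq> {-M..M}"
  proof
    fix x assume "x \<in> {x. f x \<noteq> 0}"
    with assms[of x] have "\<bar>x\<bar> \<le> M" by force
    then show "x \<in> {-M..M}" by auto
  qed
  then have "bounded {x. f x \<noteq> 0}" by (rule bounded_subset[OF bounded_closed_interval])
  then show ?thesis by (simp add: compact_closure)
qed

lemma bumps_deriv: "f \<in> bumps \<Longrightarrow> deriv f \<in> bumps"
proof -
  assume "f \<in> bumps"
  then obtain f' where f': "f' \<in> bumps" "\<And>x. (f has_real_derivative f' x) (at x)"
    using bumps_derivative by blast
  have "deriv f = f'" using f'(2) DERIV_imp_deriv by blast
  with f' show ?thesis by simp
qed

lemma bumps_smooth: "f \<in> bumps \<Longrightarrow> (deriv ^^ n) f field_differentiable (at x)"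
proof -
  assume "f \<in> bumps"
  then have "(deriv ^^ n) f \<in> bumps" by (induction n) (auto intro: bumps_deriv)
  then show ?thesis using bumps_derivative unfolding field_differentiable_def by blast
qed

lemma bumps_continuous: "f \<in> bumps \<Longrightarrow> continuous_on S f"
  using bumps_derivative by (metis DERIV_isCont continuous_at_imp_continuous_on)

lemma bumps_integrable:
  assumes f: "f \<in> bumps" shows "integrable lborel f"
proof -
  obtain M where M: "\<forall>x. \<bar>x\<bar> > M \<longrightarrow> f x = 0" using bumps_support[OF f] by blast
  have "set_integrable lborel {-M..M} f"
    by (intro borel_integrable_atLeastAtMost' bumps_continuous f)
  moreover have "indicator {-M..M} x *\<^sub>R f x = f x" for x
  proof (cases "\<bar>x\<bar> > M")
    case False then have "x \<in> {-M..M}" by auto then show ?thesis by simp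
  qed (use M in auto)
  ultimately show ?thesis by (simp only: set_integrable_def)
qed

text \<open>A compactly supported primitive of a bump need not itself belong to
  \<open>bumps\<close>; its smoothness is inherited from the derivative by shifting the
  index.\<close>

lemma test_functionI:
  assumes "\<And>x. (f has_real_derivative f' x) (at x)" "f' \<in> bumps" "\<And>x. \<bar>x\<bar> > M \<Longrightarrow> f x = 0"
  shows "test_function f" "deriv f = f'"
proof -
  show d: "deriv f = f'" using assms(1) DERIV_imp_deriv by blast
  have "(deriv ^^ n) f field_differentiable (at x)" for n x
  proof (cases n)
    case 0 then show ?thesis using assms(1) by (auto simp: field_differentiable_def)
  next
    case (Suc m)
    then have "(deriv ^^ n) f = (deriv ^^ m) f'" by (simp only: funpow_Suc_right o_def d)
    then show ?thesis using bumps_smooth[OF assms(2)] by simp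
  qed
  then show "test_function f" using compact_support[OF assms(3)] by (simp add: test_function_def)
qed

lemma bumps_test_function: "f \<in> bumps \<Longrightarrow> test_function f"
  using bumps_smooth bumps_support compact_support by (auto simp: test_function_def) metis

text \<open>The primitive normalised to vanish on the left is constant on the right of the support,
  and that constant is the mean of \<open>f\<close>. So the functions with mean zero are the ones
  that are derivatives of test functions.\<close>

lemma bumps_primitive:
  assumes f: "f \<in> bumps" and z: "(LBINT x. f x) = 0"
  obtains F where "test_function F" "deriv F = f"
proof -
  obtain F where F: "is_primitive F f"
    using is_primitive_integral[OF locally_integrable_continuous[OF bumps_continuous[OF f]]] by blast
  obtain M where M: "\<forall>x. \<bar>x\<bar> > M \<longrightarrow> f x = 0" using bumps_support[OF f] by blast
  \<comment> \<open>A point to the left of the support, with \<open>- a\<close> to its right; the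
    absolute value guards against a negative \<open>M\<close>.\<close>
  define a where "a = - \<bar>M\<bar> - 1"
  define G where "G x = F x - F a" for x
  have f0: "f x = 0" if "x \<le> a \<or> x \<ge> - a" for x
    using M that by (auto simp: a_def abs_if split: if_splits)
  have G0: "G x = 0" if "x \<le> a" for x
  proof -
    have "F a - F x = (\<integral>y. indicator {x..a} y *\<^sub>R f y \<partial>lborel)"
      using F that by (simp add: is_primitive_def set_lebesgue_integral_def)
    also have "\<dots> = (\<integral>y. 0 \<partial>(lborel :: real measure))"
      by (rule Bochner_Integration.integral_cong) (auto simp: indicator_def f0)
    finally show ?thesis by (simp add: G_def)
  qed
  have G1: "G x = 0" if "x \<ge> - a" for x
  proof -
    have "a \<le> x" using that by (auto simp: a_def)
    then have "F x - F a = (\<integral>y. indicator {a..x} y *\<^sub>R f y \<partial>lborel)"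
      using F that by (simp add: is_primitive_def set_lebesgue_integral_def)
    also have "\<dots> = (\<integral>y. f y \<partial>lborel)"
    proof (rule Bochner_Integration.integral_cong)
      fix y show "indicator {a..x} y *\<^sub>R f y = f y"
        using that f0[of y] by (cases "y \<in> {a..x}") auto
    qed simp
    finally show ?thesis using z by (simp add: G_def)
  qed
  have "(F has_vector_derivative f x) (at x)" for x
    by (rule is_primitive_has_vector_derivative[OF F bumps_continuous[OF f]])
  then have "(G has_real_derivative f x) (at x)" for x
    unfolding G_def[abs_def] has_real_derivative_iff_has_vector_derivative
    by (auto intro!: derivative_eq_intros)
  moreover have "G x = 0" if "\<bar>x\<bar> > - a" for x using G0[of x] G1[of x] that by (auto simp: abs_if split: if_splits)
  ultimately show ?thesis using test_functionI[of G f "-a"] f that by blast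
qed

section \<open>Weak derivatives\<close>

lemma bump_scaleR_integrable:
  fixes f :: "real \<Rightarrow> 'a::euclidean_space"
  assumes M: "\<And>x. \<bar>x\<bar> > M \<Longrightarrow> \<psi> x = 0" and c: "continuous_on UNIV \<psi>" and f: "locally_integrable f"
  shows "integrable lborel (\<lambda>x. \<psi> x *\<^sub>R f x)" "(LBINT x. \<psi> x *\<^sub>R f x) = (LBINT x:{-M..M}. \<psi> x *\<^sub>R f x)"
proof -
  have "set_integrable lborel {-M..M} (\<lambda>x. \<psi> x *\<^sub>R f x)"
    using set_integrable_bilinear_continuous[OF bounded_bilinear.flip[OF bounded_bilinear_scaleR] locally_integrableD[OF f]]
      continuous_on_subset[OF c] by (metis subset_UNIV)
  moreover have *: "indicator {-M..M} x *\<^sub>R \<psi> x *\<^sub>R f x = \<psi> x *\<^sub>R f x" for x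
  proof (cases "\<bar>x\<bar> > M")
    case False then have "x \<in> {-M..M}" by auto then show ?thesis by simp
  qed (use M in auto)
  ultimately show "integrable lborel (\<lambda>x. \<psi> x *\<^sub>R f x)" by (simp only: set_integrable_def)
  show "(LBINT x. \<psi> x *\<^sub>R f x) = (LBINT x:{-M..M}. \<psi> x *\<^sub>R f x)"
    by (simp only: set_lebesgue_integral_def *)
qed

lemma bumps_scaleR_integrable:
  fixes f :: "real \<Rightarrow> 'a::euclidean_space"
  assumes "\<psi> \<in> bumps" "locally_integrable f"
  shows "integrable lborel (\<lambda>x. \<psi> x *\<^sub>R f x)"
  using bumps_support[OF assms(1)] bump_scaleR_integrable(1)[OF _ bumps_continuous[OF assms(1)] assms(2)] by metis

text \<open>The bumps with \<open>l = m = 0\<close> and \<open>c\<close> tending to 0 converge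
  pointwise to the indicator, and \<open>norm h\<close> on \<open>{a..b}\<close> dominates the
  products because these bumps lie between 0 and 1.\<close>

lemma bumps_zero_box:
  fixes h :: "real \<Rightarrow> 'a::euclidean_space"
  assumes h: "locally_integrable h" and z: "\<And>\<psi>. \<psi> \<in> bumps \<Longrightarrow> (LBINT x. \<psi> x *\<^sub>R h x) = 0"
  shows "(LBINT x. indicator {a<..<b} x *\<^sub>R h x) = 0"
proof -
  \<comment> \<open>The factor \<open>x ^ 0\<close> keeps the shape demanded by
    \<open>bumps.bump\<close>, and \<open>Suc n\<close> avoids a division by 0.\<close>
  define \<psi> where "\<psi> n x = x ^ 0 * exp_bump (1 / real (Suc n)) 0 ((x - a) * (b - x))" for n x
  have \<psi>: "\<psi> n \<in> bumps" for n
    unfolding \<psi>_def[abs_def] by (rule bumps.bump) simp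
  note [measurable] = locally_integrable_borel[OF h]
  have out: "\<psi> n x = 0" if "x \<notin> {a<..<b}" "a \<le> b" for n x
  proof -
    have "(x - a) * (b - x) \<le> 0"
      using that by (cases "x \<le> a") (intro mult_nonneg_nonpos mult_nonpos_nonneg; simp)+
    then show ?thesis by (simp add: \<psi>_def exp_bump_def)
  qed
  show ?thesis
  proof (cases "a < b")
    case False
    then show ?thesis by simp
  next
    case True
    have "(\<lambda>n. \<integral>x. \<psi> n x *\<^sub>R h x \<partial>lborel) \<longlonglongrightarrow> (\<integral>x. indicator {a<..<b} x *\<^sub>R h x \<partial>lborel)"
    proof (rule integral_dominated_convergence)
      show "integrable lborel (\<lambda>x. norm (indicator {a..b} x *\<^sub>R h x))"
        using locally_integrableD[OF h] unfolding set_integrable_def by (intro integrable_norm)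
      show "(\<lambda>x. \<psi> n x *\<^sub>R h x) \<in> borel_measurable lborel" for n
        using borel_measurable_continuous_onI[OF bumps_continuous[OF \<psi>]] by simp
      show "AE x in lborel. norm (\<psi> n x *\<^sub>R h x) \<le> norm (indicator {a..b} x *\<^sub>R h x)" for n
      proof (rule AE_I2)
        fix x :: real
        show "norm (\<psi> n x *\<^sub>R h x) \<le> norm (indicator {a..b} x *\<^sub>R h x)"
        proof (cases "x \<in> {a<..<b}")
          case True
          have "\<bar>\<psi> n x\<bar> \<le> 1" by (simp add: \<psi>_def exp_bump_def)
          then show ?thesis using True by (simp add: mult_left_le_one_le)
        qed (use out True in simp)
      qed
      show "AE x in lborel. (\<lambda>n. \<psi> n x *\<^sub>R h x) \<longlonglongrightarrow> indicator {a<..<b} x *\<^sub>R h x"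
      proof (rule AE_I2)
        fix x :: real
        show "(\<lambda>n. \<psi> n x *\<^sub>R h x) \<longlonglongrightarrow> indicator {a<..<b} x *\<^sub>R h x"
        proof (cases "x \<in> {a<..<b}")
          case True
          then have p: "(x - a) * (b - x) > 0" by simp
          have "(\<lambda>n. - (1 / ((x - a) * (b - x))) * inverse (real (Suc n))) \<longlonglongrightarrow> - (1 / ((x - a) * (b - x))) * 0"
            by (intro tendsto_intros LIMSEQ_inverse_real_of_nat)
          moreover have "- (1 / ((x - a) * (b - x))) * inverse (real (Suc n)) = - (1 / real (Suc n)) / ((x - a) * (b - x))" for n
            by (simp add: divide_simps)
          ultimately have "(\<lambda>n. - (1 / real (Suc n)) / ((x - a) * (b - x))) \<longlonglongrightarrow> 0"
            by simp
          then have "(\<lambda>n. exp (- (1 / real (Suc n)) / ((x - a) * (b - x))) *\<^sub>R h x) \<longlonglongrightarrow> exp 0 *\<^sub>R h x"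
            by (intro tendsto_intros)
          then show ?thesis using p True by (simp add: \<psi>_def exp_bump_def)
        qed (use out True in simp)
      qed
    qed measurable
    then show ?thesis by (simp add: z[OF \<psi>] LIMSEQ_const_iff)
  qed
qed

text \<open>The integrals of \<open>h\<close> over bounded open intervals vanish; these form an
  intersection-stable generator, so the integrals over all Borel sets vanish by a Dynkin argument.
  Truncation to \<open>(-n, n)\<close> makes \<open>h\<close> integrable, which complements and
  countable unions require.\<close>

lemma bumps_zero_AE:
  fixes h :: "real \<Rightarrow> 'a::euclidean_space"
  assumes h: "locally_integrable h" and z: "\<And>\<psi>. \<psi> \<in> bumps \<Longrightarrow> (LBINT x. \<psi> x *\<^sub>R h x) = 0"
  shows "AE x in lborel. h x = 0"
proof -
  note [measurable] = locally_integrable_borel[OF h]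
  note box0 = bumps_zero_box[OF h z]
  have "AE x in lborel. indicator {-real n<..<real n} x *\<^sub>R h x = 0" for n
  proof (rule sigma_finite_measure.density_zero[OF lborel.sigma_finite_measure_axioms])
    define f where "f x = indicator {-real n<..<real n} x *\<^sub>R h x" for x
    have "set_integrable lborel {-real n<..<real n} h"
      by (rule set_integrable_subset[OF locally_integrableD[OF h, of "- real n" "real n"]]) auto
    then have f: "integrable lborel f" by (simp add: f_def[abs_def] set_integrable_def)
    then show "integrable lborel (\<lambda>x. indicator {-real n<..<real n} x *\<^sub>R h x)"
      by (simp add: f_def[abs_def])
    have fA: "integrable lborel (\<lambda>x. indicator A x *\<^sub>R f x)" if "A \<in> sets borel" for A
      using integrable_mult_indicator[OF _ f, of A] that by simp
    have tot: "(LBINT x. f x) = 0" unfolding f_def by (rule box0)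
    fix A :: "real set" assume "A \<in> sets lborel"
    then have "A \<in> sigma_sets UNIV (range (\<lambda>(a, b). box a b))"
      by (simp add: borel_eq_box)
    have "Int_stable (range (\<lambda>(a, b). box a b :: real set))"
      by (auto simp: Int_stable_def box_Int_box)
    moreover have "range (\<lambda>(a, b). box a b :: real set) \<subseteq> Pow UNIV" by simp
    moreover note \<open>A \<in> sigma_sets UNIV _\<close>
    ultimately have "(LBINT x. indicator A x *\<^sub>R f x) = 0"
    proof (induction A rule: sigma_sets_induct_disjoint)
      case (basic A)
      then obtain a b where A: "A = {a<..<b}" by (auto simp: box_real)
      have "indicator A x *\<^sub>R f x = indicator {max a (- real n)<..<min b (real n)} x *\<^sub>R h x" for x
        by (auto simp: A f_def indicator_def)
      then show ?case using box0 by simp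
    next
      case (compl A)
      then have A: "A \<in> sets borel" by (simp add: borel_eq_box)
      have "(LBINT x. indicator (UNIV - A) x *\<^sub>R f x) = (LBINT x. f x - indicator A x *\<^sub>R f x)"
        by (rule Bochner_Integration.integral_cong) (auto simp: indicator_def)
      also have "\<dots> = 0" using compl.IH tot f fA[OF A] by simp
      finally show ?case .
    next
      case (union A)
      then have A: "A i \<in> sets borel" for i by (auto simp: borel_eq_box)
      have "(LBINT x:(\<Union>i. A i). f x) = (\<Sum>i. (LBINT x:(A i). f x))"
        by (rule lebesgue_integral_countable_add)
           (use A union(1) fA in \<open>auto simp: disjoint_family_on_def set_integrable_def\<close>)
      then show ?case using union.IH by (simp add: set_lebesgue_integral_def)
    qed auto
    then show "set_lebesgue_integral lborel A (\<lambda>x. indicator {-real n<..<real n} x *\<^sub>R h x) = 0"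
      by (simp add: set_lebesgue_integral_def f_def)
  qed
  then have "AE x in lborel. \<forall>n. indicator {-real n<..<real n} x *\<^sub>R h x = 0"
    by (subst AE_all_countable) auto
  then show ?thesis
  proof eventually_elim
    case (elim x)
    obtain n :: nat where "\<bar>x\<bar> < real n" using reals_Archimedean2 by blast
    then have "x \<in> {-real n<..<real n}" by auto
    with elim[rule_format, of n] show ?case by simp
  qed
qed

text \<open>If all bumps had integral 0, then \<open>bumps_zero_box\<close> with the constant
  function 1 would give the unit interval measure 0.\<close>

lemma bump_integral_1:
  obtains \<kappa> where "\<kappa> \<in> bumps" "(LBINT x. \<kappa> x) = 1"
proof -
  have "\<exists>\<psi>\<in>bumps. (LBINT x. \<psi> x) \<noteq> 0"
  proof (rule ccontr)
    assume *: "\<not> ?thesis"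
    have "(LBINT x. indicator {0<..<1::real} x *\<^sub>R (1::real)) = 0"
      by (rule bumps_zero_box) (use * in \<open>auto intro: locally_integrable_continuous\<close>)
    then show False by simp
  qed
  then obtain \<psi> where \<psi>: "\<psi> \<in> bumps" "(LBINT x. \<psi> x) \<noteq> 0" by blast
  show ?thesis
    by (rule that[OF bumps.scale[OF \<psi>(1), of "1 / (LBINT x. \<psi> x)"]]) (use \<psi>(2) in simp)
qed

text \<open>Subtracting from a bump the multiple of \<open>\<kappa>\<close> with the same integral
  leaves the derivative of a test function. Hence every bump integrates \<open>f\<close> to its own
  mean times \<open>c\<close>, the mean of \<open>f\<close> against \<open>\<kappa>\<close>.\<close>

lemma du_Bois_Reymond:
  fixes f :: "real \<Rightarrow> 'a::euclidean_space"
  assumes f: "locally_integrable f" and z: "\<And>\<phi>. test_function \<phi> \<Longrightarrow> (LBINT x. deriv \<phi> x *\<^sub>R f x) = 0"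
  obtains c where "AE x in lborel. f x = c"
proof -
  obtain \<kappa> where \<kappa>: "\<kappa> \<in> bumps" "(LBINT x. \<kappa> x) = 1" by (rule bump_integral_1)
  define c where "c = (LBINT x. \<kappa> x *\<^sub>R f x)"
  have "AE x in lborel. f x - c = 0"
  proof (rule bumps_zero_AE)
    show "locally_integrable (\<lambda>x. f x - c)"
      by (intro locally_integrable_diff f locally_integrable_continuous) simp
    fix \<psi> assume \<psi>: "\<psi> \<in> bumps"
    define r where "r = (LBINT x. \<psi> x)"
    have g: "(\<lambda>x. \<psi> x + (- r) * \<kappa> x) \<in> bumps"
      by (intro bumps.add bumps.scale \<psi> \<kappa>)
    have "(LBINT x. \<psi> x + (- r) * \<kappa> x) = 0"
      using bumps_integrable[OF \<psi>] bumps_integrable[OF \<kappa>(1)] \<kappa>(2) by (simp add: r_def)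
    then obtain F where F: "test_function F" "deriv F = (\<lambda>x. \<psi> x + (- r) * \<kappa> x)"
      using bumps_primitive[OF g] by blast
    note i = bumps_scaleR_integrable[OF \<psi> f] bumps_scaleR_integrable[OF \<kappa>(1) f]
    have "0 = (LBINT x. \<psi> x *\<^sub>R f x - r *\<^sub>R \<kappa> x *\<^sub>R f x)"
      using z[OF F(1)] by (simp add: F(2) scaleR_diff_left)
    also have "\<dots> = (LBINT x. \<psi> x *\<^sub>R f x) - r *\<^sub>R c"
      unfolding c_def using i
      by (subst Bochner_Integration.integral_diff) (auto simp del: scaleR_scaleR)
    also have "r *\<^sub>R c = (LBINT x. \<psi> x *\<^sub>R c)"
      using bumps_integrable[OF \<psi>] by (simp add: r_def)
    finally show "(LBINT x. \<psi> x *\<^sub>R (f x - c)) = 0"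
      using i bumps_integrable[OF \<psi>] by (simp add: scaleR_diff_right)
  qed
  then show ?thesis using that[of c] by simp
qed

section \<open>Weak derivatives and absolutely continuous representatives\<close>

lemma test_functionD:
  assumes "test_function \<phi>"
  shows "(\<phi> has_real_derivative deriv \<phi> x) (at x)" "continuous_on UNIV \<phi>" "continuous_on UNIV (deriv \<phi>)"
    "\<exists>M\<ge>0. \<forall>x. \<bar>x\<bar> > M \<longrightarrow> \<phi> x = 0 \<and> deriv \<phi> x = 0"
proof -
  have d: "(deriv ^^ n) \<phi> field_differentiable (at x)" for n x
    using assms by (simp add: test_function_def)
  show D: "(\<phi> has_real_derivative deriv \<phi> x) (at x)" for x
    using d[of 0 x] by (simp add: field_differentiable_derivI)
  have D2: "(deriv \<phi> has_real_derivative deriv (deriv \<phi>) x) (at x)" for x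
    using d[of 1 x] by (simp add: field_differentiable_derivI)
  show "continuous_on UNIV \<phi>" "continuous_on UNIV (deriv \<phi>)"
    by (rule continuous_at_imp_continuous_on, rule ballI, rule DERIV_isCont, rule D D2)+
  have "bounded {x. \<phi> x \<noteq> 0}"
    using assms by (intro bounded_subset[OF compact_imp_bounded closure_subset]) (simp add: test_function_def)
  then obtain M where "\<forall>x\<in>{x. \<phi> x \<noteq> 0}. norm x \<le> M"
    unfolding bounded_iff by blast
  then have M: "\<bar>x\<bar> \<le> M" if "\<phi> x \<noteq> 0" for x using that by simp
  have z: "\<phi> x = 0" if "\<bar>x\<bar> > \<bar>M\<bar>" for x using M[of x] that by force
  have "deriv \<phi> x = 0" if "\<bar>x\<bar> > \<bar>M\<bar>" for x
  proof -
    have "open {x::real. \<bar>x\<bar> > \<bar>M\<bar>}" by (intro open_Collect_less continuous_intros)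
    then have "\<forall>\<^sub>F y in nhds x. \<phi> y = 0"
      using that z by (intro eventually_mono[OF eventually_nhds_in_open]) auto
    then have "deriv \<phi> x = deriv (\<lambda>x. 0) x" by (intro deriv_cong_ev) auto
    then show ?thesis by simp
  qed
  with z show "\<exists>M\<ge>0. \<forall>x. \<bar>x\<bar> > M \<longrightarrow> \<phi> x = 0 \<and> deriv \<phi> x = 0"
    by (intro exI[of _ "\<bar>M\<bar>"]) auto
qed

lemma is_primitive_imp_weak_deriv:
  assumes p: "is_primitive u v"
  shows "has_weak_deriv u v"
  unfolding has_weak_deriv_def
proof (intro conjI allI impI)
  show u: "locally_integrable u" by (intro locally_integrable_continuous is_primitive_continuous[OF p])
  show v: "locally_integrable v" by (rule is_primitive_locally_integrable[OF p])
  fix \<phi> assume t: "test_function \<phi>"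
  note T = test_functionD[OF t]
  obtain M where M: "M \<ge> 0" "\<And>x. \<bar>x\<bar> > M \<Longrightarrow> \<phi> x = 0" "\<And>x. \<bar>x\<bar> > M \<Longrightarrow> deriv \<phi> x = 0" using T(4) by blast
  \<comment> \<open>The bound on the support is strict, so \<open>M\<close> itself may still carry a
    nonzero value; one unit further out the test function vanishes.\<close>
  define a where "a = M + 1"
  have a: "\<phi> a = 0" "\<phi> (- a) = 0" using M by (auto simp: a_def)
  have "is_primitive \<phi> (deriv \<phi>)"
    using T by (intro is_primitive_C1) (auto simp: has_real_derivative_iff_has_vector_derivative)
  then have "is_primitive (\<lambda>x. \<phi> x *\<^sub>R u x) (\<lambda>x. deriv \<phi> x *\<^sub>R u x + \<phi> x *\<^sub>R v x)"
    by (rule is_primitive_bilinear[OF bounded_bilinear_scaleR _ p])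
  from is_primitive_eq[OF this, of "-a" a] M a
  have 1: "(LBINT x:{-a..a}. deriv \<phi> x *\<^sub>R u x + \<phi> x *\<^sub>R v x) = 0" by (simp add: a_def)
  have z: "\<bar>x\<bar> > a \<Longrightarrow> \<phi> x = 0" "\<bar>x\<bar> > a \<Longrightarrow> deriv \<phi> x = 0" for x using M by (auto simp: a_def)
  have I: "integrable lborel (\<lambda>x. deriv \<phi> x *\<^sub>R u x)"
      "(LBINT x. deriv \<phi> x *\<^sub>R u x) = (LBINT x:{-a..a}. deriv \<phi> x *\<^sub>R u x)"
    by (rule bump_scaleR_integrable[OF _ T(3) u], erule z(2))+
  have J: "integrable lborel (\<lambda>x. \<phi> x *\<^sub>R v x)"
      "(LBINT x. \<phi> x *\<^sub>R v x) = (LBINT x:{-a..a}. \<phi> x *\<^sub>R v x)"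
    by (rule bump_scaleR_integrable[OF _ T(2) v], erule z(1))+
  have "(LBINT x:{-a..a}. deriv \<phi> x *\<^sub>R u x + \<phi> x *\<^sub>R v x) = (LBINT x. deriv \<phi> x *\<^sub>R u x) + (LBINT x. \<phi> x *\<^sub>R v x)"
    unfolding I(2) J(2) using I(1) J(1)
    by (intro set_integral_add) (simp_all add: set_integrable_def integrable_mult_indicator del: scaleR_scaleR)
  with 1 show "(LBINT x. deriv \<phi> x *\<^sub>R u x) = - (LBINT x. \<phi> x *\<^sub>R v x)"
    by (simp add: add_eq_0_iff2)
qed

text \<open>Any primitive of \<open>v\<close> has the same weak derivative as \<open>u\<close>, so
  their difference is almost everywhere a constant, which is added to the primitive.\<close>

lemma weak_deriv_imp_is_primitive:
  fixes u :: "real \<Rightarrow> 'a::euclidean_space"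
  assumes w: "has_weak_deriv u v"
  obtains U where "is_primitive U v" "AE x in lborel. u x = U x"
proof -
  have u: "locally_integrable u" and v: "locally_integrable v" using w by (auto simp: has_weak_deriv_def)
  obtain U where U: "is_primitive U v" using is_primitive_integral[OF v] by blast
  have wU: "has_weak_deriv U v" by (rule is_primitive_imp_weak_deriv[OF U])
  obtain c where c: "AE x in lborel. u x - U x = c"
  proof (rule du_Bois_Reymond[of "\<lambda>x. u x - U x"])
    show "locally_integrable (\<lambda>x. u x - U x)"
      using u wU by (auto simp: has_weak_deriv_def intro: locally_integrable_diff)
    fix \<phi> assume t: "test_function \<phi>"
    note T = test_functionD[OF t]
    obtain M where "\<And>x. \<bar>x\<bar> > M \<Longrightarrow> deriv \<phi> x = 0" using T(4) by blast
    then have "integrable lborel (\<lambda>x. deriv \<phi> x *\<^sub>R u x)" "integrable lborel (\<lambda>x. deriv \<phi> x *\<^sub>R U x)"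
      using T(3) u wU by (auto simp: has_weak_deriv_def intro: bump_scaleR_integrable(1))
    then show "(LBINT x. deriv \<phi> x *\<^sub>R (u x - U x)) = 0"
      using w wU t by (simp add: scaleR_diff_right has_weak_deriv_def)
  qed
  show ?thesis
  proof (rule that)
    show "is_primitive (\<lambda>x. U x + c) v" using is_primitive_add[OF U is_primitive_const] by simp
    show "AE x in lborel. u x = U x + c" using c by eventually_elim (simp add: algebra_simps)
  qed
qed

lemma weak_deriv_unique:
  fixes u :: "real \<Rightarrow> 'a::euclidean_space"
  assumes "has_weak_deriv u v" "has_weak_deriv u v'"
  shows "AE x in lborel. v x = v' x"
proof -
  have "AE x in lborel. v x - v' x = 0"
  proof (rule bumps_zero_AE)
    show "locally_integrable (\<lambda>x. v x - v' x)"
      using assms by (auto simp: has_weak_deriv_def intro: locally_integrable_diff)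
    fix \<psi> assume \<psi>: "\<psi> \<in> bumps"
    have "integrable lborel (\<lambda>x. \<psi> x *\<^sub>R v x)" "integrable lborel (\<lambda>x. \<psi> x *\<^sub>R v' x)"
      using assms by (auto simp: has_weak_deriv_def intro: bumps_scaleR_integrable[OF \<psi>])
    moreover have "(LBINT x. \<psi> x *\<^sub>R v x) = (LBINT x. \<psi> x *\<^sub>R v' x)"
      using assms bumps_test_function[OF \<psi>] by (simp add: has_weak_deriv_def)
    ultimately show "(LBINT x. \<psi> x *\<^sub>R (v x - v' x)) = 0"
      by (simp add: scaleR_diff_right)
  qed
  then show ?thesis by simp
qed

lemma has_weak_deriv_AE:
  fixes u :: "real \<Rightarrow> 'a::euclidean_space"
  assumes u: "u \<in> borel_measurable borel" and ae: "AE x in lborel. u x = U x" and p: "is_primitive U v"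
  shows "has_weak_deriv u v"
proof -
  have w: "has_weak_deriv U v" by (rule is_primitive_imp_weak_deriv[OF p])
  have U: "U \<in> borel_measurable borel" by (rule is_primitive_borel[OF p])
  have "set_integrable lborel {a..b} u \<longleftrightarrow> set_integrable lborel {a..b} U" for a b
    unfolding set_integrable_def
    by (rule integrable_cong_AE) (use u U ae in \<open>auto elim: AE_mp\<close>)
  moreover have "(LBINT x. deriv \<phi> x *\<^sub>R u x) = (LBINT x. deriv \<phi> x *\<^sub>R U x)" if "test_function \<phi>" for \<phi>
    using borel_measurable_continuous_onI[OF test_functionD(3)[OF that]]
    by (intro integral_cong_AE) (use u U ae in \<open>auto elim: AE_mp\<close>)
  ultimately show ?thesis using w by (simp add: has_weak_deriv_def locally_integrable_def)
qed

lemma weak_deriv_AE: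
  fixes u :: "real \<Rightarrow> 'a::euclidean_space"
  assumes "u \<in> borel_measurable borel" "AE x in lborel. u x = U x" "is_primitive U v"
  shows "has_weak_deriv u (weak_deriv u)" "AE x in lborel. weak_deriv u x = v x"
    "weak_deriv u \<in> borel_measurable borel"
proof -
  have w: "has_weak_deriv u v" by (rule has_weak_deriv_AE[OF assms])
  then show 1: "has_weak_deriv u (weak_deriv u)" unfolding weak_deriv_def by (rule someI[of "has_weak_deriv u"])
  then show "AE x in lborel. weak_deriv u x = v x" using w by (rule weak_deriv_unique)
  show "weak_deriv u \<in> borel_measurable borel"
    using 1 by (auto simp: has_weak_deriv_def intro: locally_integrable_borel)
qed

text \<open>Each \<open>weak_deriv\<close> is an arbitrary choice and agrees with the chain
  \<open>U\<close> only almost everywhere. Measurability is carried through the induction because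
  the next derivative is identified from it.\<close>

lemma wD_AE:
  fixes u :: "real \<Rightarrow> 'a::euclidean_space"
  assumes "u \<in> borel_measurable borel" "AE x in lborel. u x = U 0 x" "\<And>j. j < n \<Longrightarrow> is_primitive (U j) (U (Suc j))"
  shows "(AE x in lborel. wD n u x = U n x) \<and> wD n u \<in> borel_measurable borel"
  using assms(3)
proof (induction n)
  case 0 then show ?case using assms by simp
next
  case (Suc n)
  then show ?case using weak_deriv_AE[of "wD n u" "U n" "U (Suc n)"] by simp
qed

section \<open>Families of functions bounded by powers of the scale\<close>

lemma integrable_square_bound:
  fixes F :: "real \<Rightarrow> 'a::euclidean_space" and G :: "real \<Rightarrow> 'b::euclidean_space"
  assumes "F \<in> borel_measurable borel" "G \<in> borel_measurable borel"
    "integrable lborel (\<lambda>x. (norm (F x))\<^sup>2)" "integrable lborel (\<lambda>x. (norm (G x))\<^sup>2)"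
  shows "integrable lborel (\<lambda>x. norm (F x) * norm (G x))"
proof (rule Bochner_Integration.integrable_bound)
  show "integrable lborel (\<lambda>x. (norm (F x))\<^sup>2 + (norm (G x))\<^sup>2)" using assms by simp
  show "(\<lambda>x. norm (F x) * norm (G x)) \<in> borel_measurable lborel" using assms(1,2) by simp
  show "AE x in lborel. norm (norm (F x) * norm (G x)) \<le> norm ((norm (F x))\<^sup>2 + (norm (G x))\<^sup>2)"
  proof (rule AE_I2)
    fix x
    have "2 * norm (F x) * norm (G x) \<le> (norm (F x))\<^sup>2 + (norm (G x))\<^sup>2" by (rule sum_squares_bound)
    moreover have "0 \<le> norm (F x) * norm (G x)" by simp
    ultimately show "norm (norm (F x) * norm (G x)) \<le> norm ((norm (F x))\<^sup>2 + (norm (G x))\<^sup>2)"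
      unfolding real_norm_def by linarith
  qed
qed

text \<open>The squared norm of \<open>u\<close> has derivative
  \<open>2 * (u x \<bullet> v x)\<close> and is integrable, so it is bounded by the integral of the
  norm of that derivative. The factor 2 reflects that only one side of \<open>x\<close> is
  used.\<close>

lemma agmon_inequality:
  fixes u v :: "real \<Rightarrow> 'a::euclidean_space"
  assumes p: "is_primitive u v"
    and u: "integrable lborel (\<lambda>x. (norm (u x))\<^sup>2)" and v: "integrable lborel (\<lambda>x. (norm (v x))\<^sup>2)"
  shows "(norm (u x))\<^sup>2 \<le> 2 * (LBINT x. norm (u x) * norm (v x))"
proof -
  have mu: "u \<in> borel_measurable borel" by (rule is_primitive_borel[OF p])
  have mv: "v \<in> borel_measurable borel" by (rule locally_integrable_borel[OF is_primitive_locally_integrable[OF p]])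
  note i = integrable_square_bound[OF mu mv u v]
  have pr: "is_primitive (\<lambda>x. u x \<bullet> u x) (\<lambda>x. v x \<bullet> u x + u x \<bullet> v x)"
    by (rule is_primitive_inner[OF p p])
  have b: "norm (v x \<bullet> u x + u x \<bullet> v x) \<le> 2 * (norm (u x) * norm (v x))" for x
    using Cauchy_Schwarz_ineq2[of "u x" "v x"] by (simp add: inner_commute)
  have G: "integrable lborel (\<lambda>x. v x \<bullet> u x + u x \<bullet> v x)"
  proof (rule Bochner_Integration.integrable_bound)
    show "integrable lborel (\<lambda>x. 2 * (norm (u x) * norm (v x)))" using i by simp
    show "AE x in lborel. norm (v x \<bullet> u x + u x \<bullet> v x) \<le> norm (2 * (norm (u x) * norm (v x)))"
      using b by (intro AE_I2) (simp add: abs_mult)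
  qed (use mu mv in measurable)
  have "norm (u x \<bullet> u x) \<le> (LBINT x. norm (v x \<bullet> u x + u x \<bullet> v x))"
    by (rule norm_le_integral_derivative[OF pr _ G]) (use u in \<open>simp add: power2_norm_eq_inner\<close>)
  also have "\<dots> \<le> (LBINT x. 2 * (norm (u x) * norm (v x)))"
    by (rule integral_mono) (use G b i in auto)
  finally show ?thesis by (simp add: power2_norm_eq_inner)
qed

section \<open>A calculus of orders, uniform over a family\<close>

locale scale_family =
  fixes I :: "'i set" and e :: "'i \<Rightarrow> real"
  assumes e_pos: "i \<in> I \<Longrightarrow> 0 < e i" and e_le_1: "i \<in> I \<Longrightarrow> e i \<le> 1"
begin

text \<open>The additional factor \<open>e i\<close> accounts for the integrals over the length scale \<open>1 / e i\<close>; with it the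
  orders of the factors of a product add up.\<close>

definition bigO :: "nat \<Rightarrow> ('i \<Rightarrow> real) \<Rightarrow> bool" where
  "bigO m f \<longleftrightarrow> (\<exists>C\<ge>0. \<forall>i\<in>I. e i * \<bar>f i\<bar> \<le> C * e i ^ m)"

text \<open>Integrability is part of the notion: a non-integrable function would have Bochner
  integral 0 and satisfy every bound.\<close>

definition B1 :: "nat \<Rightarrow> ('i \<Rightarrow> real \<Rightarrow> real) \<Rightarrow> bool" where
  "B1 m F \<longleftrightarrow> (\<exists>C\<ge>0. \<forall>i\<in>I. integrable lborel (F i) \<and> e i * (LBINT x. \<bar>F i x\<bar>) \<le> C * e i ^ m)"

text \<open>The order \<open>m\<close> refers to the norm and not to its square, so that in a
  product of two such families the orders add and give a \<open>B1\<close> order. The weight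
  \<open>e i\<close> is then counted once.\<close>

definition B2 :: "nat \<Rightarrow> ('i \<Rightarrow> real \<Rightarrow> 'a::euclidean_space) \<Rightarrow> bool" where
  "B2 m F \<longleftrightarrow> (\<exists>C\<ge>0. \<forall>i\<in>I. F i \<in> borel_measurable borel \<and> integrable lborel (\<lambda>x. (norm (F i x))\<^sup>2)
      \<and> e i * (LBINT x. (norm (F i x))\<^sup>2) \<le> C * e i ^ (2 * m))"

definition Bs :: "nat \<Rightarrow> ('i \<Rightarrow> real \<Rightarrow> 'a::euclidean_space) \<Rightarrow> bool" where
  "Bs m F \<longleftrightarrow> (\<exists>C\<ge>0. \<forall>i\<in>I. F i \<in> borel_measurable borel \<and> (\<forall>x. norm (F i x) \<le> C * e i ^ m))"

lemma bigO_weaken: "bigO n f \<Longrightarrow> m \<le> n \<Longrightarrow> bigO m f"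
  unfolding bigO_def
  by (meson e_le_1 e_pos less_imp_le mult_left_mono order_trans power_decreasing)

lemma bigO_add: "bigO m f \<Longrightarrow> bigO m g \<Longrightarrow> bigO m (\<lambda>i. f i + g i)"
proof -
  assume "bigO m f" "bigO m g"
  then obtain C D where C: "C \<ge> 0" "\<And>i. i \<in> I \<Longrightarrow> e i * \<bar>f i\<bar> \<le> C * e i ^ m"
    and D: "D \<ge> 0" "\<And>i. i \<in> I \<Longrightarrow> e i * \<bar>g i\<bar> \<le> D * e i ^ m" by (auto simp: bigO_def)
  have "e i * \<bar>f i + g i\<bar> \<le> (C + D) * e i ^ m" if i: "i \<in> I" for i
  proof -
    have "e i * \<bar>f i + g i\<bar> \<le> e i * (\<bar>f i\<bar> + \<bar>g i\<bar>)" using e_pos[OF i] by (intro mult_left_mono) auto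
    then show ?thesis using C(2)[OF i] D(2)[OF i] by (simp add: algebra_simps)
  qed
  then show ?thesis unfolding bigO_def using C D by (intro exI[of _ "C + D"]) auto
qed

lemma bigO_cmult: "bigO m f \<Longrightarrow> bigO m (\<lambda>i. c * f i)"
proof -
  assume "bigO m f"
  then obtain C where C: "C \<ge> 0" "\<And>i. i \<in> I \<Longrightarrow> e i * \<bar>f i\<bar> \<le> C * e i ^ m" by (auto simp: bigO_def)
  have "e i * \<bar>c * f i\<bar> \<le> (\<bar>c\<bar> * C) * e i ^ m" if i: "i \<in> I" for i
    using mult_left_mono[OF C(2)[OF i], of "\<bar>c\<bar>"] by (simp add: abs_mult algebra_simps)
  then show ?thesis unfolding bigO_def using C by (intro exI[of _ "\<bar>c\<bar> * C"]) auto
qed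

lemma bigO_diff: "bigO m f \<Longrightarrow> bigO m g \<Longrightarrow> bigO m (\<lambda>i. f i - g i)"
  using bigO_add[of m f "\<lambda>i. (-1) * g i"] bigO_cmult[of m g "-1"] by simp

lemma bigO_const: "bigO m (\<lambda>i. e i ^ m / e i)"
  unfolding bigO_def using e_pos by (intro exI[of _ 1]) (auto simp: less_imp_le abs_of_nonneg)

lemma bigO_mono: "bigO m g \<Longrightarrow> (\<And>i. i \<in> I \<Longrightarrow> \<bar>f i\<bar> \<le> g i) \<Longrightarrow> bigO m f"
proof -
  assume "bigO m g" and le: "\<And>i. i \<in> I \<Longrightarrow> \<bar>f i\<bar> \<le> g i"
  then obtain C where C: "C \<ge> 0" "\<And>i. i \<in> I \<Longrightarrow> e i * \<bar>g i\<bar> \<le> C * e i ^ m" by (auto simp: bigO_def)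
  have "e i * \<bar>f i\<bar> \<le> C * e i ^ m" if i: "i \<in> I" for i
  proof -
    have "e i * \<bar>f i\<bar> \<le> e i * \<bar>g i\<bar>"
      using le[OF i] e_pos[OF i] by (intro mult_left_mono) auto
    then show ?thesis using C(2)[OF i] by simp
  qed
  then show ?thesis unfolding bigO_def using C by blast
qed

lemma bigO_cong: "bigO m f \<Longrightarrow> (\<And>i. i \<in> I \<Longrightarrow> f i = g i) \<Longrightarrow> bigO m g"
  by (auto simp: bigO_def)

lemma B1_integrable: "B1 m F \<Longrightarrow> i \<in> I \<Longrightarrow> integrable lborel (F i)"
  by (auto simp: B1_def)

lemma B1_bigO_abs: "B1 m F \<Longrightarrow> bigO m (\<lambda>i. LBINT x. \<bar>F i x\<bar>)"
  unfolding B1_def bigO_def by (auto simp: abs_of_nonneg)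

lemma B1_bigO: "B1 m F \<Longrightarrow> bigO m (\<lambda>i. LBINT x. F i x)"
  by (rule bigO_mono[OF B1_bigO_abs]) (auto intro: integral_abs_bound)

lemma B1I:
  assumes "\<And>i. i \<in> I \<Longrightarrow> integrable lborel (F i)" "bigO m (\<lambda>i. LBINT x. \<bar>F i x\<bar>)"
  shows "B1 m F"
  using assms unfolding B1_def bigO_def by (auto simp: abs_of_nonneg)

lemma B1_weaken: "B1 n F \<Longrightarrow> m \<le> n \<Longrightarrow> B1 m F"
  by (meson B1I B1_bigO_abs B1_integrable bigO_weaken)

lemma B1_bound:
  assumes G: "B1 m G" and m: "\<And>i. i \<in> I \<Longrightarrow> F i \<in> borel_measurable borel"
    and le: "\<And>i x. i \<in> I \<Longrightarrow> \<bar>F i x\<bar> \<le> G i x"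
  shows "B1 m F"
proof -
  have F: "integrable lborel (F i)" if i: "i \<in> I" for i
  proof (rule Bochner_Integration.integrable_bound[OF B1_integrable[OF G i]])
    show "AE x in lborel. norm (F i x) \<le> norm (G i x)"
      unfolding real_norm_def by (rule AE_I2, rule order_trans[OF le[OF i] abs_ge_self])
  qed (use m[OF i] in simp)
  show ?thesis
  proof (rule B1I[OF F], assumption, rule bigO_mono[OF B1_bigO[OF G]])
    fix i assume i: "i \<in> I"
    have "(LBINT x. \<bar>F i x\<bar>) \<le> (LBINT x. G i x)"
      using F[OF i] B1_integrable[OF G i] le[OF i] by (intro integral_mono) auto
    then show "\<bar>LBINT x. \<bar>F i x\<bar>\<bar> \<le> (LBINT x. G i x)" by (simp add: abs_of_nonneg)
  qed
qed

lemma B1_add: "B1 m F \<Longrightarrow> B1 n G \<Longrightarrow> B1 (min m n) (\<lambda>i x. F i x + G i x)"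
proof -
  assume F: "B1 m F" and G: "B1 n G"
  have F: "B1 (min m n) F" and G: "B1 (min m n) G" using F G by (auto intro: B1_weaken)
  show ?thesis
  proof (rule B1I, intro Bochner_Integration.integrable_add B1_integrable[OF F] B1_integrable[OF G];
      (rule bigO_mono[OF bigO_add[OF B1_bigO_abs[OF F] B1_bigO_abs[OF G]]])?)
    fix i assume i: "i \<in> I"
    note [simp] = B1_integrable[OF F i] B1_integrable[OF G i]
    have "(LBINT x. \<bar>F i x + G i x\<bar>) \<le> (LBINT x. \<bar>F i x\<bar> + \<bar>G i x\<bar>)"
      by (rule integral_mono) auto
    then show "\<bar>LBINT x. \<bar>F i x + G i x\<bar>\<bar> \<le> (LBINT x. \<bar>F i x\<bar>) + (LBINT x. \<bar>G i x\<bar>)"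
      by (simp add: abs_of_nonneg)
  qed
qed

lemma B1_cmult: "B1 m F \<Longrightarrow> B1 m (\<lambda>i x. c * F i x)"
proof (rule B1I)
  assume F: "B1 m F"
  show "\<And>i. i \<in> I \<Longrightarrow> integrable lborel (\<lambda>x. c * F i x)" using B1_integrable[OF F] by simp
  show "bigO m (\<lambda>i. LBINT x. \<bar>c * F i x\<bar>)"
    using bigO_cmult[OF B1_bigO_abs[OF F], of "\<bar>c\<bar>"] by (simp add: abs_mult)
qed

lemma B1_uminus: "B1 m F \<Longrightarrow> B1 m (\<lambda>i x. - F i x)"
  using B1_cmult[of m F "-1"] by simp

lemma B1_diff: "B1 m F \<Longrightarrow> B1 n G \<Longrightarrow> B1 (min m n) (\<lambda>i x. F i x - G i x)"
  using B1_add[OF _ B1_uminus, of m F n G] by simp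

lemma B2_measurable: "B2 m F \<Longrightarrow> i \<in> I \<Longrightarrow> F i \<in> borel_measurable borel"
  by (auto simp: B2_def)

lemma B2_integrable: "B2 m F \<Longrightarrow> i \<in> I \<Longrightarrow> integrable lborel (\<lambda>x. (norm (F i x))\<^sup>2)"
  by (auto simp: B2_def)

lemma Bs_measurable: "Bs m F \<Longrightarrow> i \<in> I \<Longrightarrow> F i \<in> borel_measurable borel"
  by (auto simp: Bs_def)

lemma B2_iff_B1:
  "B2 m F \<longleftrightarrow> (\<forall>i\<in>I. F i \<in> borel_measurable borel) \<and> B1 (2 * m) (\<lambda>i x. (norm (F i x))\<^sup>2)"
  unfolding B2_def B1_def by auto

lemma B2I:
  assumes "\<And>i. i \<in> I \<Longrightarrow> F i \<in> borel_measurable borel"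
    "\<And>i. i \<in> I \<Longrightarrow> integrable lborel (\<lambda>x. (norm (F i x))\<^sup>2)" "bigO (2 * m) (\<lambda>i. LBINT x. (norm (F i x))\<^sup>2)"
  shows "B2 m F"
  unfolding B2_iff_B1 using assms by (auto intro!: B1I)

lemma B2_weaken: "B2 n F \<Longrightarrow> m \<le> n \<Longrightarrow> B2 m F"
  unfolding B2_iff_B1 by (auto elim: B1_weaken)

lemma Bs_weaken: "Bs n F \<Longrightarrow> m \<le> n \<Longrightarrow> Bs m F"
  unfolding Bs_def
  by (meson e_le_1 e_pos less_imp_le mult_left_mono order_trans power_decreasing)

lemma B2_cong: "B2 m F \<Longrightarrow> (\<And>i x. i \<in> I \<Longrightarrow> F i x = G i x) \<Longrightarrow> B2 m G"
proof -
  assume F: "B2 m F" and "\<And>i x. i \<in> I \<Longrightarrow> F i x = G i x"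
  then have "F i = G i" if "i \<in> I" for i using that by blast
  with F show ?thesis by (simp add: B2_def cong: ball_cong)
qed

lemma Bs_cong: "Bs m F \<Longrightarrow> (\<And>i x. i \<in> I \<Longrightarrow> F i x = G i x) \<Longrightarrow> Bs m G"
proof -
  assume F: "Bs m F" and "\<And>i x. i \<in> I \<Longrightarrow> F i x = G i x"
  then have "F i = G i" if "i \<in> I" for i using that by blast
  with F show ?thesis by (simp add: Bs_def cong: ball_cong)
qed

lemma B2_bound:
  assumes G: "B2 m G" and m: "\<And>i. i \<in> I \<Longrightarrow> F i \<in> borel_measurable borel"
    and le: "\<And>i x. i \<in> I \<Longrightarrow> norm (F i x) \<le> c * norm (G i x)"
  shows "B2 m F"
  unfolding B2_iff_B1
proof (intro conjI ballI m)
  show "B1 (2 * m) (\<lambda>i x. (norm (F i x))\<^sup>2)"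
  proof (rule B1_bound)
    show "B1 (2 * m) (\<lambda>i x. c\<^sup>2 * (norm (G i x))\<^sup>2)"
      using G unfolding B2_iff_B1 by (intro B1_cmult) auto
    show "\<bar>(norm (F i x))\<^sup>2\<bar> \<le> c\<^sup>2 * (norm (G i x))\<^sup>2" if "i \<in> I" for i x
      using power_mono[OF le[OF that, of x] norm_ge_zero, of 2] by (simp add: power_mult_distrib)
  qed (use m in simp)
qed

lemma Bs_bound:
  assumes G: "Bs m G" and m: "\<And>i. i \<in> I \<Longrightarrow> F i \<in> borel_measurable borel"
    and le: "\<And>i x. i \<in> I \<Longrightarrow> norm (F i x) \<le> c * norm (G i x)"
  shows "Bs m F"
proof -
  obtain C where C: "C \<ge> 0" "\<And>i x. i \<in> I \<Longrightarrow> norm (G i x) \<le> C * e i ^ m" using G by (auto simp: Bs_def)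
  have "norm (F i x) \<le> (\<bar>c\<bar> * C) * e i ^ m" if i: "i \<in> I" for i x
  proof -
    have "norm (F i x) \<le> \<bar>c\<bar> * norm (G i x)"
      using le[OF i, of x] by (rule order_trans) (intro mult_right_mono; simp)
    also have "\<dots> \<le> \<bar>c\<bar> * (C * e i ^ m)" using C(2)[OF i] by (intro mult_left_mono) auto
    finally show ?thesis by (simp add: mult.assoc)
  qed
  then show ?thesis unfolding Bs_def using m C by (intro exI[of _ "\<bar>c\<bar> * C"]) auto
qed

lemma B2_norm: "B2 m F \<Longrightarrow> B2 m (\<lambda>i x. norm (F i x))"
  by (rule B2_bound[where c = 1]) (auto dest: B2_measurable)

lemma Bs_norm: "Bs m F \<Longrightarrow> Bs m (\<lambda>i x. norm (F i x))"
  by (rule Bs_bound[where c = 1]) (auto dest: Bs_measurable)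

lemma B2_add: "B2 m F \<Longrightarrow> B2 n G \<Longrightarrow> B2 (min m n) (\<lambda>i x. F i x + G i x)"
proof -
  assume F: "B2 m F" and G: "B2 n G"
  have F: "B2 (min m n) F" and G: "B2 (min m n) G" using F G by (auto intro: B2_weaken)
  show ?thesis
    unfolding B2_iff_B1
  proof (intro conjI ballI)
    have "B1 (min (2 * min m n) (2 * min m n)) (\<lambda>i x. 2 * (norm (F i x))\<^sup>2 + 2 * (norm (G i x))\<^sup>2)"
      using F G unfolding B2_iff_B1 by (intro B1_add B1_cmult) auto
    then show "B1 (2 * min m n) (\<lambda>i x. (norm (F i x + G i x))\<^sup>2)"
    proof (rule B1_bound[OF B1_weaken])
      fix i x
      have "(norm (F i x + G i x))\<^sup>2 \<le> (norm (F i x) + norm (G i x))\<^sup>2"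
        by (intro power_mono norm_triangle_ineq) auto
      also have "\<dots> \<le> 2 * (norm (F i x))\<^sup>2 + 2 * (norm (G i x))\<^sup>2"
        using sum_squares_bound[of "norm (F i x)" "norm (G i x)"] by (simp add: power2_sum)
      finally show "\<bar>(norm (F i x + G i x))\<^sup>2\<bar> \<le> 2 * (norm (F i x))\<^sup>2 + 2 * (norm (G i x))\<^sup>2" by simp
    qed (use B2_measurable[OF F] B2_measurable[OF G] in auto)
  qed (use B2_measurable[OF F] B2_measurable[OF G] in auto)
qed

lemma Bs_add: "Bs m F \<Longrightarrow> Bs n G \<Longrightarrow> Bs (min m n) (\<lambda>i x. F i x + G i x)"
proof -
  assume F: "Bs m F" and G: "Bs n G"
  have F: "Bs (min m n) F" and G: "Bs (min m n) G" using F G by (auto intro: Bs_weaken)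
  obtain C where C: "C \<ge> 0" "\<And>i x. i \<in> I \<Longrightarrow> norm (F i x) \<le> C * e i ^ min m n" using F by (auto simp: Bs_def)
  obtain D where D: "D \<ge> 0" "\<And>i x. i \<in> I \<Longrightarrow> norm (G i x) \<le> D * e i ^ min m n" using G by (auto simp: Bs_def)
  have "norm (F i x + G i x) \<le> (C + D) * e i ^ min m n" if i: "i \<in> I" for i x
    using norm_triangle_ineq[of "F i x" "G i x"] C(2)[OF i, of x] D(2)[OF i, of x]
    by (simp add: algebra_simps)
  then show ?thesis unfolding Bs_def using C D Bs_measurable[OF F] Bs_measurable[OF G]
    by (intro exI[of _ "C + D"]) auto
qed

lemma B2_uminus: "B2 m F \<Longrightarrow> B2 m (\<lambda>i x. - F i x)"
  by (rule B2_bound[where c = 1]) (auto dest: B2_measurable)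

lemma Bs_uminus: "Bs m F \<Longrightarrow> Bs m (\<lambda>i x. - F i x)"
  by (rule Bs_bound[where c = 1]) (auto dest: Bs_measurable)

lemma B2_diff: "B2 m F \<Longrightarrow> B2 n G \<Longrightarrow> B2 (min m n) (\<lambda>i x. F i x - G i x)"
  using B2_add[OF _ B2_uminus, of m F n G] by simp

lemma Bs_diff: "Bs m F \<Longrightarrow> Bs n G \<Longrightarrow> Bs (min m n) (\<lambda>i x. F i x - G i x)"
  using Bs_add[OF _ Bs_uminus, of m F n G] by simp

lemma Bs_const: "Bs 0 (\<lambda>i x. c)"
  unfolding Bs_def by (intro exI[of _ "norm c"]) auto

lemma Bs_mult:
  fixes F G :: "'i \<Rightarrow> real \<Rightarrow> 'a::{euclidean_space, real_normed_algebra}"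
  assumes F: "Bs m F" and G: "Bs n G"
  shows "Bs (m + n) (\<lambda>i x. F i x * G i x)"
proof -
  obtain C where C: "C \<ge> 0" "\<And>i x. i \<in> I \<Longrightarrow> norm (F i x) \<le> C * e i ^ m" using F by (auto simp: Bs_def)
  obtain D where D: "D \<ge> 0" "\<And>i x. i \<in> I \<Longrightarrow> norm (G i x) \<le> D * e i ^ n" using G by (auto simp: Bs_def)
  have "norm (F i x * G i x) \<le> (C * D) * e i ^ (m + n)" if i: "i \<in> I" for i x
  proof -
    have "norm (F i x * G i x) \<le> norm (F i x) * norm (G i x)" by (rule norm_mult_ineq)
    also have "\<dots> \<le> (C * e i ^ m) * (D * e i ^ n)"
      using C(2)[OF i, of x] D(2)[OF i, of x] by (intro mult_mono) (auto intro: order_trans[OF norm_ge_zero])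
    finally show ?thesis by (simp add: power_add algebra_simps)
  qed
  then show ?thesis unfolding Bs_def using C D Bs_measurable[OF F] Bs_measurable[OF G]
    by (intro exI[of _ "C * D"]) auto
qed

lemma B1_smult: "Bs m F \<Longrightarrow> B1 n G \<Longrightarrow> B1 (m + n) (\<lambda>i x. F i x * G i x)"
proof -
  assume F: "Bs m F" and G: "B1 n G"
  obtain C where C: "C \<ge> 0" "\<And>i x. i \<in> I \<Longrightarrow> \<bar>F i x\<bar> \<le> C * e i ^ m" using F by (auto simp: Bs_def)
  obtain D where D: "D \<ge> 0" "\<And>i. i \<in> I \<Longrightarrow> e i * (LBINT x. \<bar>G i x\<bar>) \<le> D * e i ^ n" using G by (auto simp: B1_def)
  have le: "\<bar>F i x * G i x\<bar> \<le> C * e i ^ m * \<bar>G i x\<bar>" if i: "i \<in> I" for i x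
    using C(2)[OF i, of x] by (simp add: abs_mult mult_right_mono)
  have int: "integrable lborel (\<lambda>x. F i x * G i x)" if i: "i \<in> I" for i
  proof (rule Bochner_Integration.integrable_bound)
    show "integrable lborel (\<lambda>x. C * e i ^ m * \<bar>G i x\<bar>)"
      using B1_integrable[OF G i] by (intro integrable_mult_right integrable_abs)
    show "(\<lambda>x. F i x * G i x) \<in> borel_measurable lborel"
      using Bs_measurable[OF F i] B1_integrable[OF G i] by simp
    show "AE x in lborel. norm (F i x * G i x) \<le> norm (C * e i ^ m * \<bar>G i x\<bar>)"
      unfolding real_norm_def by (rule AE_I2, rule order_trans[OF le[OF i] abs_ge_self])
  qed
  have "e i * (LBINT x. \<bar>F i x * G i x\<bar>) \<le> (C * D) * e i ^ (m + n)" if i: "i \<in> I" for i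
  proof -
    have "(LBINT x. \<bar>F i x * G i x\<bar>) \<le> (LBINT x. C * e i ^ m * \<bar>G i x\<bar>)"
      using int[OF i] B1_integrable[OF G i] le[OF i]
      by (intro integral_mono integrable_mult_right integrable_abs) auto
    then have "e i * (LBINT x. \<bar>F i x * G i x\<bar>) \<le> e i * (C * e i ^ m * (LBINT x. \<bar>G i x\<bar>))"
      using e_pos[OF i] by (intro mult_left_mono) auto
    also have "\<dots> = C * e i ^ m * (e i * (LBINT x. \<bar>G i x\<bar>))" by simp
    also have "\<dots> \<le> C * e i ^ m * (D * e i ^ n)"
      using D(2)[OF i] C(1) e_pos[OF i] by (intro mult_left_mono) auto
    finally show ?thesis by (simp add: power_add algebra_simps)
  qed
  then show ?thesis unfolding B1_def using C D int by (intro exI[of _ "C * D"]) auto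
qed

lemma B2_mult:
  fixes F G :: "'i \<Rightarrow> real \<Rightarrow> 'a::{euclidean_space, real_normed_algebra}"
  assumes F: "Bs m F" and G: "B2 n G"
  shows "B2 (m + n) (\<lambda>i x. F i x * G i x)"
  unfolding B2_iff_B1
proof (intro conjI ballI)
  have "B1 ((m + m) + 2 * n) (\<lambda>i x. (norm (F i x) * norm (F i x)) * (norm (G i x))\<^sup>2)"
    using F G unfolding B2_iff_B1 by (intro B1_smult Bs_mult Bs_norm) auto
  then show "B1 (2 * (m + n)) (\<lambda>i x. (norm (F i x * G i x))\<^sup>2)"
  proof (rule B1_bound[OF B1_weaken])
    fix i x
    have "(norm (F i x * G i x))\<^sup>2 \<le> (norm (F i x) * norm (G i x))\<^sup>2"
      by (intro power_mono norm_mult_ineq) auto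
    then show "\<bar>(norm (F i x * G i x))\<^sup>2\<bar> \<le> (norm (F i x) * norm (F i x)) * (norm (G i x))\<^sup>2"
      by (simp add: power2_eq_square mult_ac)
  qed (use Bs_measurable[OF F] B2_measurable[OF G] in auto)
qed (use Bs_measurable[OF F] B2_measurable[OF G] in auto)

lemma B2_mult':
  fixes F G :: "'i \<Rightarrow> real \<Rightarrow> 'a::{euclidean_space, real_normed_field}"
  assumes F: "B2 m F" and G: "Bs n G"
  shows "B2 (m + n) (\<lambda>i x. F i x * G i x)"
  using B2_mult[OF G F] by (simp add: mult.commute add.commute)

text \<open>The inequality of arithmetic and geometric means, weighted by the powers of the scale.\<close>

lemma B1_norm_mult:
  assumes F: "B2 m F" and G: "B2 n G"
  shows "B1 (m + n) (\<lambda>i x. norm (F i x) * norm (G i x))"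
proof -
  obtain C where C: "C \<ge> 0" "\<And>i. i \<in> I \<Longrightarrow> e i * (LBINT x. (norm (F i x))\<^sup>2) \<le> C * e i ^ (2 * m)" using F by (auto simp: B2_def)
  obtain D where D: "D \<ge> 0" "\<And>i. i \<in> I \<Longrightarrow> e i * (LBINT x. (norm (G i x))\<^sup>2) \<le> D * e i ^ (2 * n)" using G by (auto simp: B2_def)
  have int: "integrable lborel (\<lambda>x. norm (F i x) * norm (G i x))" if "i \<in> I" for i
    using that B2_measurable[OF F] B2_measurable[OF G] B2_integrable[OF F] B2_integrable[OF G]
    by (intro integrable_square_bound) auto
  have "e i * (LBINT x. \<bar>norm (F i x) * norm (G i x)\<bar>) \<le> ((C + D) / 2) * e i ^ (m + n)" if i: "i \<in> I" for i
  proof -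
    define a where "a = e i ^ m" define b where "b = e i ^ n"
    have ab: "a > 0" "b > 0" using e_pos[OF i] by (auto simp: a_def b_def)
    have le: "norm (F i x) * norm (G i x) \<le> (b / a) / 2 * (norm (F i x))\<^sup>2 + (a / b) / 2 * (norm (G i x))\<^sup>2" for x
    proof -
      have "0 \<le> (b * norm (F i x) - a * norm (G i x))\<^sup>2" by simp
      then have "2 * (a * b) * (norm (F i x) * norm (G i x)) \<le> b\<^sup>2 * (norm (F i x))\<^sup>2 + a\<^sup>2 * (norm (G i x))\<^sup>2"
        by (simp add: power2_diff power_mult_distrib mult_ac)
      then have "norm (F i x) * norm (G i x) \<le> (b\<^sup>2 * (norm (F i x))\<^sup>2 + a\<^sup>2 * (norm (G i x))\<^sup>2) / (2 * (a * b))"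
        using ab by (simp add: pos_le_divide_eq mult_ac)
      also have "\<dots> = (b / a) / 2 * (norm (F i x))\<^sup>2 + (a / b) / 2 * (norm (G i x))\<^sup>2"
        using ab by (simp add: field_simps power2_eq_square)
      finally show ?thesis .
    qed
    have "(LBINT x. norm (F i x) * norm (G i x)) \<le> (LBINT x. (b / a) / 2 * (norm (F i x))\<^sup>2 + (a / b) / 2 * (norm (G i x))\<^sup>2)"
      using int[OF i] B2_integrable[OF F i] B2_integrable[OF G i] le by (intro integral_mono) auto
    also have "\<dots> = (b / a) / 2 * (LBINT x. (norm (F i x))\<^sup>2) + (a / b) / 2 * (LBINT x. (norm (G i x))\<^sup>2)"
      using B2_integrable[OF F i] B2_integrable[OF G i] by simp
    finally have "e i * (LBINT x. norm (F i x) * norm (G i x)) \<le>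
       e i * ((b / a) / 2 * (LBINT x. (norm (F i x))\<^sup>2) + (a / b) / 2 * (LBINT x. (norm (G i x))\<^sup>2))"
      using e_pos[OF i] by (intro mult_left_mono) auto
    also have "\<dots> = (b / a) / 2 * (e i * (LBINT x. (norm (F i x))\<^sup>2)) + (a / b) / 2 * (e i * (LBINT x. (norm (G i x))\<^sup>2))"
      by (simp add: algebra_simps)
    also have "\<dots> \<le> (b / a) / 2 * (C * e i ^ (2 * m)) + (a / b) / 2 * (D * e i ^ (2 * n))"
      using ab C(2)[OF i] D(2)[OF i] by (intro add_mono mult_left_mono) auto
    also have "\<dots> = ((C + D) / 2) * (a * b)"
    proof -
      have "e i ^ (2 * m) = a * a" "e i ^ (2 * n) = b * b"
        by (simp_all add: a_def b_def mult_2 power_add)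
      then show ?thesis using ab by (simp add: field_simps)
    qed
    finally show ?thesis by (simp add: a_def b_def power_add)
  qed
  then show ?thesis unfolding B1_def using C D int by (intro exI[of _ "(C + D) / 2"]) auto
qed

lemma B1_mult: "B2 m F \<Longrightarrow> B2 n G \<Longrightarrow> B1 (m + n) (\<lambda>i x. F i x * G i x)"
  by (rule B1_bound[OF B1_norm_mult])
     (auto intro!: borel_measurable_times intro: B2_measurable simp: abs_mult)

lemma B1_inner: "B2 m F \<Longrightarrow> B2 n G \<Longrightarrow> B1 (m + n) (\<lambda>i x. F i x \<bullet> G i x)"
  by (rule B1_bound[OF B1_norm_mult])
     (auto intro!: borel_measurable_inner intro: B2_measurable simp: Cauchy_Schwarz_ineq2)

lemma B2_inner: "Bs m F \<Longrightarrow> B2 n G \<Longrightarrow> B2 (m + n) (\<lambda>i x. F i x \<bullet> G i x)"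
  by (rule B2_bound[OF B2_mult[OF Bs_norm B2_norm], where c = 1])
     (auto intro!: borel_measurable_inner intro: B2_measurable Bs_measurable simp: Cauchy_Schwarz_ineq2)

lemma Bs_inner:
  assumes F: "Bs m F" and G: "Bs n G"
  shows "Bs (m + n) (\<lambda>i x. F i x \<bullet> G i x)"
proof (rule Bs_bound[OF Bs_mult[OF Bs_norm[OF F] Bs_norm[OF G]], where c = 1])
  show "(\<lambda>x. F i x \<bullet> G i x) \<in> borel_measurable borel" if "i \<in> I" for i
    by (rule borel_measurable_inner[OF Bs_measurable[OF F that] Bs_measurable[OF G that]])
qed (simp add: Cauchy_Schwarz_ineq2)

lemma B1_power2: "B2 m F \<Longrightarrow> B1 (m + m) (\<lambda>i x. (F i x)\<^sup>2)"
  unfolding power2_eq_square by (rule B1_mult)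

lemma Bs_power: "Bs m F \<Longrightarrow> Bs (n * m) (\<lambda>i x. F i x ^ n :: real)"
  by (induction n) (use Bs_const[of 1] in \<open>auto dest: Bs_mult[rotated]\<close>)

text \<open>One factor must be square integrable while the others are taken in the sup norm, so the
  exponent 0 is excluded; a numeral exponent guarantees this.\<close>

lemma B2_power: "Bs m F \<Longrightarrow> B2 m F \<Longrightarrow> B2 (numeral n * m) (\<lambda>i x. F i x ^ numeral n :: real)"
proof -
  assume F: "Bs m F" "B2 m F"
  have "B2 (Suc n * m) (\<lambda>i x. F i x ^ Suc n :: real)" for n
    using B2_mult[OF Bs_power[OF F(1), of n] F(2)] by (simp add: mult.commute add.commute)
  then show ?thesis by (metis numeral_eq_Suc)
qed

lemma B1_power3: "Bs m F \<Longrightarrow> B2 m F \<Longrightarrow> B1 (3 * m) (\<lambda>i x. F i x ^ 3)"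
  and B1_power4: "Bs m F \<Longrightarrow> B2 m F \<Longrightarrow> B1 (4 * m) (\<lambda>i x. F i x ^ 4)"
  and B1_power5: "Bs m F \<Longrightarrow> B2 m F \<Longrightarrow> B1 (5 * m) (\<lambda>i x. F i x ^ 5)"
proof -
  assume F: "Bs m F" "B2 m F"
  \<comment> \<open>Two factors are paired in the mean and the other \<open>n\<close> are taken in
    the sup norm; the instances \<open>n = 1, 2, 3\<close> are used.\<close>
  have "B1 (n * m + (m + m)) (\<lambda>i x. F i x ^ n * (F i x)\<^sup>2)" for n
    by (intro B1_smult Bs_power B1_power2 F)
  from B1_weaken[OF this[of 1], of "3 * m"] B1_weaken[OF this[of 2], of "4 * m"] B1_weaken[OF this[of 3], of "5 * m"]
  show "B1 (3 * m) (\<lambda>i x. F i x ^ 3)" "B1 (4 * m) (\<lambda>i x. F i x ^ 4)" "B1 (5 * m) (\<lambda>i x. F i x ^ 5)"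
    by (simp_all add: power_add[symmetric] flip: power_Suc)
qed

text \<open>Agmon's inequality bounds the square of \<open>F\<close> by an integral of order
  \<open>m + Suc m\<close>. The extra power contributed by the derivative cancels the weight
  \<open>e i\<close> of that integral, so the sup norm has the same order \<open>m\<close> as the
  mean.\<close>

lemma Bs_agmon:
  assumes F: "B2 m F" and G: "B2 (Suc m) G" and p: "\<And>i. i \<in> I \<Longrightarrow> is_primitive (F i) (G i)"
  shows "Bs m F"
proof -
  have "B1 (m + Suc m) (\<lambda>i x. norm (F i x) * norm (G i x))" by (rule B1_norm_mult[OF F G])
  then obtain C where C: "C \<ge> 0" "\<And>i. i \<in> I \<Longrightarrow> e i * (LBINT x. norm (F i x) * norm (G i x)) \<le> C * e i ^ (m + Suc m)"
    by (auto simp: B1_def)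
  have "norm (F i x) \<le> sqrt (2 * C) * e i ^ m" if i: "i \<in> I" for i x
  proof -
    have "e i * (LBINT x. norm (F i x) * norm (G i x)) \<le> e i * (C * e i ^ (2 * m))"
    proof -
      have "C * e i ^ (m + Suc m) = e i * (C * e i ^ (2 * m))" by (simp add: mult_2 power_add)
      with C(2)[OF i] show ?thesis by (simp only:)
    qed
    then have "(LBINT x. norm (F i x) * norm (G i x)) \<le> C * e i ^ (2 * m)"
      using e_pos[OF i] by simp
    then have "(norm (F i x))\<^sup>2 \<le> 2 * C * e i ^ (2 * m)"
      using agmon_inequality[OF p[OF i] B2_integrable[OF F i] B2_integrable[OF G i], of x] by simp
    also have "\<dots> = (sqrt (2 * C) * e i ^ m)\<^sup>2"
      using C(1) by (simp add: power_mult_distrib power_even_eq)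
    finally show ?thesis
      using C(1) e_pos[OF i] by (intro power2_le_imp_le[of "norm (F i x)"]) auto
  qed
  then show ?thesis unfolding Bs_def using B2_measurable[OF F] C(1)
    by (intro exI[of _ "sqrt (2 * C)"]) auto
qed

end

section \<open>A priori estimates\<close>

text \<open>The derivatives of \<open>\<eta>\<close> in terms of the derivatives \<open>p 0, p 1, \<dots>\<close> of \<open>\<Psi>\<close>.\<close>

definition eta_deriv :: "nat \<Rightarrow> (nat \<Rightarrow> real \<Rightarrow> complex) \<Rightarrow> real \<Rightarrow> real" where
  "eta_deriv j p x =
     (if j = 0 then 1 - (cmod (p 0 x))\<^sup>2
      else if j = 1 then - 2 * (p 0 x \<bullet> p 1 x)
      else if j = 2 then - 2 * ((cmod (p 1 x))\<^sup>2 + p 0 x \<bullet> p 2 x)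
      else - 2 * (3 * (p 1 x \<bullet> p 2 x) + p 0 x \<bullet> p 3 x))"

text \<open>These counterparts of the invariants use a fixed chain \<open>p\<close> of
  representatives in place of \<open>wD\<close>, so that the densities can be handled pointwise;
  \<open>GP_E_eq\<close> makes the link.\<close>

definition energy1 :: "(nat \<Rightarrow> real \<Rightarrow> complex) \<Rightarrow> real" where
  "energy1 p = 1/2 * (LBINT x. (cmod (p 1 x))\<^sup>2) + 1/4 * (LBINT x. (eta_deriv 0 p x)\<^sup>2)"

definition energy2 :: "(nat \<Rightarrow> real \<Rightarrow> complex) \<Rightarrow> real" where
  "energy2 p =
       1/2 * (LBINT x. (cmod (p 2 x))\<^sup>2)
     - 3/2 * (LBINT x. eta_deriv 0 p x * (cmod (p 1 x))\<^sup>2)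
     + 1/4 * (LBINT x. (eta_deriv 1 p x)\<^sup>2)
     - 1/4 * (LBINT x. (eta_deriv 0 p x)^3)"

definition energy3 :: "(nat \<Rightarrow> real \<Rightarrow> complex) \<Rightarrow> real" where
  "energy3 p =
       1/2 * (LBINT x. (cmod (p 3 x))\<^sup>2)
     + 1/4 * (LBINT x. (eta_deriv 2 p x)\<^sup>2)
     + 5/4 * (LBINT x. (cmod (p 1 x))^4)
     + 5/2 * (LBINT x. eta_deriv 2 p x * (cmod (p 1 x))\<^sup>2)
     - 5/2 * (LBINT x. eta_deriv 0 p x * (cmod (p 2 x))\<^sup>2)
     - 5/4 * (LBINT x. eta_deriv 0 p x * (eta_deriv 1 p x)\<^sup>2)
     + 15/4 * (LBINT x. (eta_deriv 0 p x)\<^sup>2 * (cmod (p 1 x))\<^sup>2)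
     + 5/16 * (LBINT x. (eta_deriv 0 p x)^4)"

definition energy4 :: "(nat \<Rightarrow> real \<Rightarrow> complex) \<Rightarrow> real" where
  "energy4 p =
       1/2 * (LBINT x. (cmod (p 4 x))\<^sup>2)
     + 1/4 * (LBINT x. (eta_deriv 3 p x)\<^sup>2)
     - 7/4 * (LBINT x. eta_deriv 0 p x * (eta_deriv 2 p x)\<^sup>2)
     - 7/2 * (LBINT x. eta_deriv 0 p x * (cmod (p 3 x))\<^sup>2)
     + 35/8 * (LBINT x. (eta_deriv 0 p x)\<^sup>2 * (eta_deriv 1 p x)\<^sup>2)
     + 35/4 * (LBINT x. (eta_deriv 0 p x)\<^sup>2 * (cmod (p 2 x))\<^sup>2)
     - 35/4 * (LBINT x. (eta_deriv 1 p x)\<^sup>2 * (cmod (p 1 x))\<^sup>2)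
     - 7/2 * (LBINT x. (cmod (p 1 x))\<^sup>2 * (cmod (p 2 x))\<^sup>2)
     - 7 * (LBINT x. eta_deriv 2 p x * (p 1 x \<bullet> p 3 x))
     - 7 * (LBINT x. (cmod (p 1 x))\<^sup>2 * (p 1 x \<bullet> p 3 x))
     - 35/2 * (LBINT x. eta_deriv 0 p x * eta_deriv 2 p x * (cmod (p 1 x))\<^sup>2)
     - 35/4 * (LBINT x. (eta_deriv 0 p x)^3 * (cmod (p 1 x))\<^sup>2)
     - 35/4 * (LBINT x. eta_deriv 0 p x * (cmod (p 1 x))^4)
     - 7/16 * (LBINT x. (eta_deriv 0 p x)^5)"

definition energy :: "nat \<Rightarrow> (nat \<Rightarrow> real \<Rightarrow> complex) \<Rightarrow> real" where
  "energy j p = (if j = 1 then energy1 p else if j = 2 then energy2 p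
     else if j = 3 then energy3 p else energy4 p)"

lemma eta_deriv_primitive:
  assumes "j \<le> 2" "\<And>l. l \<le> j \<Longrightarrow> is_primitive (p l) (p (Suc l))"
  shows "is_primitive (eta_deriv j p) (eta_deriv (Suc j) p)"
proof -
  have p0: "is_primitive (p 0) (p 1)" using assms(2)[of 0] by simp
  consider "j = 0" | "j = 1" | "j = 2" using assms(1) by linarith
  then show ?thesis
  proof cases
    case 1
    have "is_primitive (\<lambda>x. 1 - p 0 x \<bullet> p 0 x) (\<lambda>x. 0 - (p 1 x \<bullet> p 0 x + p 0 x \<bullet> p 1 x))"
      by (intro is_primitive_diff is_primitive_const is_primitive_inner p0)
    then show ?thesis
      using 1 by (simp add: eta_deriv_def[abs_def] power2_norm_eq_inner inner_commute)
  next
    case 2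
    have p1: "is_primitive (p 1) (p 2)" using assms(2)[of 1] 2 by (simp add: numeral_2_eq_2)
    have "is_primitive (\<lambda>x. - 2 * (p 0 x \<bullet> p 1 x)) (\<lambda>x. - 2 * (p 1 x \<bullet> p 1 x + p 0 x \<bullet> p 2 x))"
      by (intro is_primitive_cmult is_primitive_inner p0 p1)
    then show ?thesis
      using 2 by (simp add: eta_deriv_def[abs_def] power2_norm_eq_inner inner_commute)
  next
    case 3
    have p1: "is_primitive (p 1) (p 2)" using assms(2)[of 1] 3 by (simp add: numeral_2_eq_2)
    have p2: "is_primitive (p 2) (p 3)" using assms(2)[of 2] 3 by (simp add: numeral_2_eq_2 numeral_3_eq_3)
    have "is_primitive (\<lambda>x. - 2 * (p 1 x \<bullet> p 1 x + p 0 x \<bullet> p 2 x))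
        (\<lambda>x. - 2 * ((p 2 x \<bullet> p 1 x + p 1 x \<bullet> p 2 x) + (p 1 x \<bullet> p 2 x + p 0 x \<bullet> p 3 x)))"
      by (intro is_primitive_cmult is_primitive_add is_primitive_inner p0 p1 p2)
    moreover have "- 2 * ((p 2 x \<bullet> p 1 x + p 1 x \<bullet> p 2 x) + (p 1 x \<bullet> p 2 x + p 0 x \<bullet> p 3 x))
        = - 2 * (3 * (p 1 x \<bullet> p 2 x) + p 0 x \<bullet> p 3 x)" for x
      by (simp add: inner_commute)
    ultimately show ?thesis
      using 3 by (simp add: eta_deriv_def[abs_def] power2_norm_eq_inner)
  qed
qed

text \<open>\<open>P j i\<close> stands for the \<open>j\<close>-th derivative. The last one,
  \<open>P (Suc k) i\<close>, is only a square integrable function, whereas all lower ones are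
  continuous. The constant 5 in \<open>e_small\<close> is tuned to
  \<open>eta_le_half\<close>.\<close>

locale gp_family = scale_family I e
  for I :: "'i set" and e :: "'i \<Rightarrow> real" +
  fixes P :: "nat \<Rightarrow> 'i \<Rightarrow> real \<Rightarrow> complex" and k :: nat and A :: real
  assumes k: "1 \<le> k" "k \<le> 3" and A: "0 < A"
    and e_small: "i \<in> I \<Longrightarrow> e i * (1 + 5 * A) < 1"
    and prim: "i \<in> I \<Longrightarrow> j \<le> k \<Longrightarrow> is_primitive (P j i) (P (Suc j) i)"
    and sq: "i \<in> I \<Longrightarrow> 1 \<le> j \<Longrightarrow> j \<le> Suc k \<Longrightarrow> integrable lborel (\<lambda>x. (cmod (P j i x))\<^sup>2)"
    and sq0: "i \<in> I \<Longrightarrow> integrable lborel (\<lambda>x. (eta_deriv 0 (\<lambda>l. P l i) x)\<^sup>2)"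
    and energy_le: "i \<in> I \<Longrightarrow> 1 \<le> j \<Longrightarrow> j \<le> Suc k \<Longrightarrow>
      18 / e i ^ (2 * j + 1) * energy j (\<lambda>l. P l i) \<le> A"
begin

abbreviation H :: "nat \<Rightarrow> 'i \<Rightarrow> real \<Rightarrow> real" where "H j i \<equiv> eta_deriv j (\<lambda>l. P l i)"

lemma measP: "i \<in> I \<Longrightarrow> j \<le> Suc k \<Longrightarrow> P j i \<in> borel_measurable borel"
  using is_primitive_borel[OF prim, of i j]
    locally_integrable_borel[OF is_primitive_locally_integrable[OF prim[of i k]]]
  by (cases "j \<le> k") (auto simp: le_Suc_eq)

lemma primH: "i \<in> I \<Longrightarrow> j \<le> 2 \<Longrightarrow> j \<le> k \<Longrightarrow> is_primitive (H j i) (H (Suc j) i)"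
  by (rule eta_deriv_primitive) (auto intro: prim)

lemma measH: "i \<in> I \<Longrightarrow> j \<le> 2 \<Longrightarrow> j \<le> k \<Longrightarrow> H j i \<in> borel_measurable borel"
  using is_primitive_borel[OF primH] by simp

lemma measH_Suc: "i \<in> I \<Longrightarrow> j \<le> 2 \<Longrightarrow> j \<le> k \<Longrightarrow> H (Suc j) i \<in> borel_measurable borel"
  using locally_integrable_borel[OF is_primitive_locally_integrable[OF primH]] by simp

section \<open>Coercivity of the energies, level by level\<close>

lemma energy_le':
  assumes "i \<in> I" "1 \<le> j" "j \<le> Suc k"
  shows "energy j (\<lambda>l. P l i) \<le> A / 18 * e i ^ (2 * j + 1)"
  using energy_le[OF assms] e_pos[OF assms(1)] by (simp add: field_simps)

text \<open>The quadratic part of \<open>E_j\<close> is positive with coefficients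
  \<open>1/2\<close> and \<open>1/4\<close>. The rest \<open>r\<close> may consume half of the
  second one, hence the \<open>1/8\<close>, and otherwise has to be of the order that the energy
  bound itself provides.\<close>

lemma energy_imp_B2:
  assumes j: "1 \<le> j" "j \<le> Suc k"
    and G: "\<And>i. i \<in> I \<Longrightarrow> H (j - 1) i \<in> borel_measurable borel"
      "\<And>i. i \<in> I \<Longrightarrow> integrable lborel (\<lambda>x. (H (j - 1) i x)\<^sup>2)"
    and en: "\<And>i. i \<in> I \<Longrightarrow> energy j (\<lambda>l. P l i) =
      1/2 * (LBINT x. (cmod (P j i x))\<^sup>2) + 1/4 * (LBINT x. (H (j - 1) i x)\<^sup>2) + r i"
    and r: "\<And>i. i \<in> I \<Longrightarrow> \<bar>r i\<bar> \<le> g i + 1/8 * (LBINT x. (H (j - 1) i x)\<^sup>2)"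
    and g: "bigO (2 * Suc j) g"
  shows "B2 (Suc j) (P j) \<and> B2 (Suc j) (H (j - 1))"
proof -
  \<comment> \<open>The quotient \<open>e i ^ (2 * Suc j) / e i\<close> is the power
    \<open>2 * j + 1\<close> of the energy bound in the shape expected by \<open>bigO_const\<close>.
    The factor 8 below inverts the smallest coefficient, \<open>1/8\<close>.\<close>
  define t where "t i = A / 18 * (e i ^ (2 * Suc j) / e i) + g i" for i
  have b: "bigO (2 * Suc j) (\<lambda>i. 8 * t i)"
    unfolding t_def by (intro bigO_cmult bigO_add bigO_const g)
  have le: "1/2 * (LBINT x. (cmod (P j i x))\<^sup>2) + 1/8 * (LBINT x. (H (j - 1) i x)\<^sup>2)
      \<le> t i" if i: "i \<in> I" for i
  proof -
    have "e i ^ (2 * Suc j) / e i = e i ^ (2 * j + 1)" using e_pos[OF i] by simp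
    then show ?thesis unfolding t_def using energy_le'[OF i j] en[OF i] r[OF i] by (simp only:) 
  qed
  have nn: "0 \<le> (LBINT x. (cmod (P j i x))\<^sup>2)" "0 \<le> (LBINT x. (H (j - 1) i x)\<^sup>2)" for i by simp_all
  have "B2 (Suc j) (P j)"
  proof (rule B2I, erule measP[OF _ j(2)], erule sq[OF _ j], rule bigO_mono[OF b])
    fix i assume i: "i \<in> I"
    show "\<bar>LBINT x. (cmod (P j i x))\<^sup>2\<bar> \<le> 8 * t i"
      using le[OF i] nn[of i] by linarith
  qed
  moreover have "B2 (Suc j) (H (j - 1))"
  proof (rule B2I, erule G(1), rule_tac [2] bigO_mono[OF b])
    fix i assume i: "i \<in> I"
    show "integrable lborel (\<lambda>x. (norm (H (j - 1) i x))\<^sup>2)" using G(2)[OF i] by simp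
    show "\<bar>LBINT x. (norm (H (j - 1) i x))\<^sup>2\<bar> \<le> 8 * t i"
      unfolding real_norm_def power2_abs using le[OF i] nn[of i] by linarith
  qed
  ultimately show ?thesis by blast
qed

lemma B2_level1: "B2 2 (P 1)" "B2 2 (H 0)"
proof -
  have "B2 (Suc 1) (P 1) \<and> B2 (Suc 1) (H (1 - 1))"
    by (rule energy_imp_B2[of 1 "\<lambda>i. 0" "\<lambda>i. 0"];
      use k measH[of _ 0] sq0 bigO_cmult[OF bigO_const, of 4 0] in \<open>simp add: energy_def energy1_def\<close>)
  then show "B2 2 (P 1)" "B2 2 (H 0)" by (simp_all add: numeral_2_eq_2)
qed

text \<open>Explicit constants are kept because \<open>eta_le_half\<close> must be compared with
  \<open>e_small\<close>, and the absorption at level 2 needs bounds for each single index.\<close>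

lemma level1_integrals:
  assumes i: "i \<in> I"
  shows "(LBINT x. (cmod (P 1 i x))\<^sup>2) \<le> A / 9 * e i ^ 3" "(LBINT x. (H 0 i x)\<^sup>2) \<le> 2 * A / 9 * e i ^ 3"
proof -
  have "1/2 * (LBINT x. (cmod (P 1 i x))\<^sup>2) + 1/4 * (LBINT x. (H 0 i x)\<^sup>2) \<le> A / 18 * e i ^ 3"
    using energy_le'[OF i, of 1] by (simp add: energy_def energy1_def numeral_3_eq_3)
  moreover have "0 \<le> (LBINT x. (cmod (P 1 i x))\<^sup>2)" "0 \<le> (LBINT x. (H 0 i x)\<^sup>2)" by simp_all
  ultimately show "(LBINT x. (cmod (P 1 i x))\<^sup>2) \<le> A / 9 * e i ^ 3" "(LBINT x. (H 0 i x)\<^sup>2) \<le> 2 * A / 9 * e i ^ 3"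
    by linarith+
qed

text \<open>The energy controls \<open>\<eta>\<^sup>2 / (1 + \<eta>\<^sup>2)\<close> without any prior bound on \<open>\<eta>\<close>, since the derivative
  of this bounded function of \<open>\<eta>\<close> is at most \<open>5 \<bar>\<eta>\<bar> \<bar>\<Psi>'\<bar>\<close>.\<close>

lemma eta_le_half:
  assumes i: "i \<in> I"
  shows "\<bar>H 0 i x\<bar> \<le> 1/2"
proof -
  define \<theta> where "\<theta> x = (H 0 i x)\<^sup>2 / (1 + (H 0 i x)\<^sup>2)" for x
  define \<theta>' where "\<theta>' x = 2 * H 0 i x * H 1 i x / (1 + (H 0 i x)\<^sup>2)\<^sup>2" for x
  have p: "is_primitive (H 0 i) (H 1 i)" using primH[OF i, of 0] by simp
  have c1: "continuous_on UNIV (H 1 i)"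
    using is_primitive_continuous[OF primH[OF i, of 1]] k by simp
  have c0: "continuous_on UNIV (H 0 i)" by (rule is_primitive_continuous[OF p])
  have pos: "1 + (H 0 i x)\<^sup>2 > 0" for x by (intro add_pos_nonneg) auto
  have d: "(H 0 i has_real_derivative H 1 i x) (at x)" for x
    using is_primitive_has_vector_derivative[OF p c1]
    by (simp add: has_real_derivative_iff_has_vector_derivative)
  have "(\<theta> has_real_derivative \<theta>' x) (at x)" for x
  proof -
    have "(\<theta> has_real_derivative (2 * H 0 i x * H 1 i x * (1 + (H 0 i x)\<^sup>2) - (H 0 i x)\<^sup>2 * (2 * H 0 i x * H 1 i x)) /
       ((1 + (H 0 i x)\<^sup>2) * (1 + (H 0 i x)\<^sup>2))) (at x)"
      unfolding \<theta>_def[abs_def] using pos[of x]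
      by (auto intro!: derivative_eq_intros d)
    then show ?thesis
      by (rule DERIV_cong) (simp add: \<theta>'_def power2_eq_square algebra_simps)
  qed
  moreover have "continuous_on UNIV \<theta>'"
    unfolding \<theta>'_def[abs_def] using pos by (intro continuous_intros c0 c1) (auto simp: less_le)
  ultimately have pt: "is_primitive \<theta> \<theta>'"
    by (intro is_primitive_C1) (auto simp: has_real_derivative_iff_has_vector_derivative)
  have mt: "\<theta> \<in> borel_measurable borel" "\<theta>' \<in> borel_measurable borel"
    using is_primitive_borel[OF pt] locally_integrable_borel[OF is_primitive_locally_integrable[OF pt]] by auto
  have it: "integrable lborel \<theta>"
  proof (rule Bochner_Integration.integrable_bound[OF sq0[OF i]])
    have "\<theta> x \<le> (H 0 i x)\<^sup>2" "0 \<le> \<theta> x" for x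
      using pos[of x] by (auto simp: \<theta>_def divide_simps algebra_simps)
    then show "AE x in lborel. norm (\<theta> x) \<le> norm ((H 0 i x)\<^sup>2)" by (intro AE_I2) simp
  qed (use mt in simp)
  have le: "\<bar>\<theta>' x\<bar> \<le> 5/2 * ((H 0 i x)\<^sup>2 + (cmod (P 1 i x))\<^sup>2)" for x
  proof -
    define h where "h = H 0 i x"
    have m: "(cmod (P 0 i x))\<^sup>2 = 1 - h" by (simp add: h_def eta_deriv_def)
    \<comment> \<open>With \<open>h\<close> for \<open>eta\<close>, the square
      \<open>(h + 1/2)^2\<close> gives \<open>1 - h \<le> 5/4 + h^2\<close>, which lies below
      \<open>(5/4)^2 * (1 + h^2)^2\<close>. The linear growth in \<open>1 + h^2\<close> is cancelled
      by the denominator of \<open>\<theta>'\<close>.\<close>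
    have "cmod (P 0 i x) \<le> 5/4 * (1 + h\<^sup>2)"
    proof (rule power2_le_imp_le)
      have "1 - h \<le> 1 + (1/4 + h\<^sup>2)" using zero_le_power2[of "h + 1/2"] by (simp add: power2_eq_square algebra_simps)
      also have "\<dots> \<le> (5/4)\<^sup>2 * (1 + h\<^sup>2)\<^sup>2"
      proof -
        have "(5/4)\<^sup>2 * (1 + h\<^sup>2)\<^sup>2 = 25/16 + 25/8 * h\<^sup>2 + 25/16 * (h\<^sup>2)\<^sup>2"
          by (simp add: power2_eq_square algebra_simps)
        moreover have "0 \<le> h\<^sup>2" "0 \<le> (h\<^sup>2)\<^sup>2" by simp_all
        ultimately show ?thesis by linarith
      qed
      finally show "(cmod (P 0 i x))\<^sup>2 \<le> (5/4 * (1 + h\<^sup>2))\<^sup>2" by (simp only: m power_mult_distrib)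
    qed (use pos[of x] in \<open>simp add: h_def\<close>)
    then have "\<bar>P 0 i x \<bullet> P 1 i x\<bar> \<le> 5/4 * (1 + h\<^sup>2) * cmod (P 1 i x)"
      using order_trans[OF Cauchy_Schwarz_ineq2 mult_right_mono[OF _ norm_ge_zero]] by blast
    then have "\<bar>H 1 i x\<bar> \<le> 2 * (5/4 * (1 + h\<^sup>2) * cmod (P 1 i x))"
      by (simp add: eta_deriv_def abs_mult mult.commute)
    then have "\<bar>2 * h * H 1 i x\<bar> \<le> 2 * \<bar>h\<bar> * (2 * (5/4 * (1 + h\<^sup>2) * cmod (P 1 i x)))"
      unfolding abs_mult by (intro mult_mono) auto
    also have "\<dots> = (1 + h\<^sup>2) * (5/2 * (2 * \<bar>h\<bar> * cmod (P 1 i x)))" by simp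
    also have "\<dots> \<le> (1 + h\<^sup>2) * (5/2 * (h\<^sup>2 + (cmod (P 1 i x))\<^sup>2))"
      using sum_squares_bound[of "\<bar>h\<bar>" "cmod (P 1 i x)"] by (intro mult_left_mono) auto
    also have "\<dots> \<le> (1 + h\<^sup>2)\<^sup>2 * (5/2 * (h\<^sup>2 + (cmod (P 1 i x))\<^sup>2))"
      by (intro mult_right_mono self_le_power) auto
    finally have "\<bar>2 * h * H 1 i x\<bar> / (1 + h\<^sup>2)\<^sup>2 \<le> 5/2 * (h\<^sup>2 + (cmod (P 1 i x))\<^sup>2)"
      using pos[of x] by (simp add: h_def divide_le_eq mult.commute)
    then show ?thesis by (simp add: \<theta>'_def h_def abs_divide)
  qed
  note si = sq0[OF i] sq[OF i, of 1, simplified]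
  have i2: "integrable lborel (\<lambda>x. 5/2 * ((H 0 i x)\<^sup>2 + (cmod (P 1 i x))\<^sup>2))"
    using si by simp
  have it': "integrable lborel \<theta>'"
    by (rule Bochner_Integration.integrable_bound[OF i2], use mt in simp)
       (rule AE_I2, unfold real_norm_def, rule order_trans[OF le abs_ge_self])
  have "\<bar>\<theta> x\<bar> \<le> (LBINT x. \<bar>\<theta>' x\<bar>)"
    using norm_le_integral_derivative[OF pt it it'] by simp
  also have "\<dots> \<le> (LBINT x. 5/2 * ((H 0 i x)\<^sup>2 + (cmod (P 1 i x))\<^sup>2))"
    using it' i2 le by (intro integral_mono) auto
  also have "\<dots> = 5/2 * ((LBINT x. (H 0 i x)\<^sup>2) + (LBINT x. (cmod (P 1 i x))\<^sup>2))"
    using si by simp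
  also have "\<dots> \<le> 5/2 * (A / 3 * e i ^ 3)"
    using level1_integrals[OF i] by (intro mult_left_mono) auto
  also have "\<dots> \<le> 5/2 * (A / 3 * e i)"
    using A e_pos[OF i] power_decreasing[of 1 3 "e i"] e_le_1[OF i] by (intro mult_left_mono) auto
  \<comment> \<open>Here the constant 5 in \<open>e_small\<close> is spent, since
    \<open>5/2 * A/3 = 5 * A / 6\<close>. The bound \<open>1/6\<close> for \<open>\<theta>\<close>
    means \<open>5 * eta^2 \<le> 1\<close>, which is stronger than
    \<open>\<bar>eta\<bar> \<le> 1/2\<close>.\<close>
  also have "\<dots> \<le> 1/6" using e_small[OF i] e_pos[OF i] by (simp add: algebra_simps)
  finally have "6 * (H 0 i x)\<^sup>2 \<le> 1 + (H 0 i x)\<^sup>2"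
    using pos[of x] by (simp add: \<theta>_def abs_of_nonneg divide_le_eq)
  then have "\<bar>H 0 i x\<bar>\<^sup>2 \<le> (1/2)\<^sup>2" by (simp add: power2_eq_square)
  then show ?thesis by (rule power2_le_imp_le) simp
qed

lemma P0_bounds:
  assumes "i \<in> I"
  shows "1/2 \<le> (cmod (P 0 i x))\<^sup>2" "(cmod (P 0 i x))\<^sup>2 \<le> 3/2" "P 0 i x \<noteq> 0"
proof -
  have "(cmod (P 0 i x))\<^sup>2 = 1 - H 0 i x" by (simp add: eta_deriv_def)
  then show "1/2 \<le> (cmod (P 0 i x))\<^sup>2" "(cmod (P 0 i x))\<^sup>2 \<le> 3/2"
    using eta_le_half[OF assms, of x] by (auto simp: abs_le_iff)
  then show "P 0 i x \<noteq> 0" by auto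
qed

lemma Bs_P0: "Bs 0 (P 0)"
proof (rule Bs_bound[OF Bs_const[of "2::real"], where c = 1])
  show "cmod (P 0 i x) \<le> 1 * norm (2::real)" if "i \<in> I" for i x
    by (rule power2_le_imp_le) (use P0_bounds[OF that, of x] in \<open>auto simp: power2_eq_square\<close>)
qed (use measP in auto)

lemma Bs_inverse_P0: "Bs 0 (\<lambda>i x. inverse (P 0 i x))"
proof (rule Bs_bound[OF Bs_const[of "2::real"], where c = 1])
  fix i x assume "i \<in> I"
  have "1/2 \<le> cmod (P 0 i x)"
    by (rule power2_le_imp_le) (use P0_bounds[OF \<open>i \<in> I\<close>, of x] in \<open>auto simp: power2_eq_square\<close>)
  then show "cmod (inverse (P 0 i x)) \<le> 1 * norm (2::real)"
    using le_imp_inverse_le[of "1/2" "cmod (P 0 i x)"] by (simp add: norm_inverse)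
qed (use measP in auto)

lemma Bs0_H0: "Bs 0 (H 0)"
  by (rule Bs_bound[OF Bs_const[of "1::real"], where c = "1/2"]) (use measH[of _ 0] eta_le_half in auto)

text \<open>The order 2 is one less than the final one. It is needed beforehand to know that
  \<open>eta'\<close> is square integrable, so that Agmon's inequality for \<open>eta\<close> and
  the absorption are legitimate.\<close>

lemma B2_H1_weak: "B2 2 (H 1)"
proof (rule B2_bound[where c = 2])
  show "B2 2 (\<lambda>i x. P 0 i x \<bullet> P 1 i x)" by (rule B2_weaken[OF B2_inner[OF Bs_P0 B2_level1(1)]]) simp
  show "H 1 i \<in> borel_measurable borel" if "i \<in> I" for i using measH_Suc[OF that, of 0] by simp
qed (simp add: eta_deriv_def abs_mult)

text \<open>The cubic terms are absorbed with the help of Agmon's inequality for \<open>\<eta>\<close>, in which the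
  \<open>L\<^sup>2\<close> norm of \<open>\<eta>'\<close> appears with a small constant.\<close>

lemma B2_level2: "B2 3 (P 2)" "B2 3 (H 1)"
proof -
  define r where "r i = - 3/2 * (LBINT x. H 0 i x * (cmod (P 1 i x))\<^sup>2) - 1/4 * (LBINT x. (H 0 i x)^3)" for i
  \<comment> \<open>The sum of \<open>3/2 * (A/9)\<close> and \<open>1/4 * (2*A/9)\<close>, the two
    cubic terms of the energy with their level 1 bounds.\<close>
  define c where "c = 2 * A / 9"
  define g where "g i = (4 * A / 9 + c\<^sup>2 / 2) * (e i ^ 6 / e i)" for i
  have I1: "B1 4 (\<lambda>i x. (cmod (P 1 i x))\<^sup>2)" "B1 4 (\<lambda>i x. (H 0 i x)\<^sup>2)"
    using B2_level1 unfolding B2_iff_B1 by auto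
  have I2: "B1 4 (\<lambda>i x. H 0 i x * (cmod (P 1 i x))\<^sup>2)" "B1 4 (\<lambda>i x. H 0 i x * (H 0 i x)\<^sup>2)"
    using B1_smult[OF Bs0_H0 I1(1)] B1_smult[OF Bs0_H0 I1(2)] by auto
  have rb: "\<bar>r i\<bar> \<le> g i + 1/8 * (LBINT x. (H 1 i x)\<^sup>2)" if i: "i \<in> I" for i
  proof -
    define T where "T = 2 * (LBINT x. norm (H 0 i x) * norm (H 1 i x))"
    define Y where "Y = (LBINT x. (H 1 i x)\<^sup>2)"
    define S where "S = sqrt T"
    have ep: "e i > 0" by (rule e_pos[OF i])
    note int = B2_integrable[OF B2_level1(2) i] B2_integrable[OF B2_H1_weak i]
    have int01: "integrable lborel (\<lambda>x. norm (H 0 i x) * norm (H 1 i x))"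
      using int B2_measurable[OF B2_level1(2) i] B2_measurable[OF B2_H1_weak i]
      by (intro integrable_square_bound) auto
    have ag: "\<bar>H 0 i x\<bar>\<^sup>2 \<le> T" for x
      using agmon_inequality[OF primH[OF i, of 0], of x] int by (simp add: T_def)
    have T0: "T \<ge> 0" using ag[of 0] by (rule order_trans[rotated]) simp
    have S: "\<bar>H 0 i x\<bar> \<le> S" for x
      unfolding S_def using ag[of x] by (intro real_le_rsqrt) simp
    have S2: "S\<^sup>2 = T" "S \<ge> 0" using T0 by (auto simp: S_def)
    have "e i * T = (LBINT x. e i * (2 * (norm (H 0 i x) * norm (H 1 i x))))"
      by (simp add: T_def)
    \<comment> \<open>The product is split as \<open>2 e \<bar>eta\<bar>\<close> times
      \<open>\<bar>eta'\<bar> / 2\<close>: the resulting coefficient \<open>1/4\<close> of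
      \<open>Y\<close> is halved later to the \<open>1/8\<close> that \<open>energy_imp_B2\<close>
      tolerates, and \<open>e^2\<close> brings the first term to the fifth power of the
      scale.\<close>
    also have "\<dots> \<le> (LBINT x. 4 * (e i)\<^sup>2 * (H 0 i x)\<^sup>2 + 1/4 * (H 1 i x)\<^sup>2)"
    proof (rule integral_mono)
      show "integrable lborel (\<lambda>x. e i * (2 * (norm (H 0 i x) * norm (H 1 i x))))" using int01 by simp
      show "integrable lborel (\<lambda>x. 4 * (e i)\<^sup>2 * (H 0 i x)\<^sup>2 + 1/4 * (H 1 i x)\<^sup>2)" using int by simp
      show "e i * (2 * (norm (H 0 i x) * norm (H 1 i x))) \<le> 4 * (e i)\<^sup>2 * (H 0 i x)\<^sup>2 + 1/4 * (H 1 i x)\<^sup>2" for x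
        using sum_squares_bound[of "2 * e i * \<bar>H 0 i x\<bar>" "1/2 * \<bar>H 1 i x\<bar>"]
        by (simp add: power_mult_distrib mult_ac power_divide)
    qed
    also have "\<dots> = 4 * (e i)\<^sup>2 * (LBINT x. (H 0 i x)\<^sup>2) + 1/4 * Y"
      unfolding Y_def using int by simp
    also have "\<dots> \<le> 4 * (e i)\<^sup>2 * (2 * A / 9 * e i ^ 3) + 1/4 * Y"
      using level1_integrals(2)[OF i] by (intro add_mono mult_left_mono) auto
    also have "\<dots> = 8 * A / 9 * e i ^ 5 + 1/4 * Y" by (simp add: eval_nat_numeral)
    finally have eT: "e i * S\<^sup>2 \<le> 8 * A / 9 * e i ^ 5 + 1/4 * Y" by (simp add: S2)
    have bd: "\<bar>LBINT x. H 0 i x * F x\<bar> \<le> S * (LBINT x. F x)"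
      if F: "integrable lborel F" "\<And>x. 0 \<le> F x" and HF: "integrable lborel (\<lambda>x. H 0 i x * F x)" for F
    proof -
      have "\<bar>LBINT x. H 0 i x * F x\<bar> \<le> (LBINT x. \<bar>H 0 i x * F x\<bar>)" by (rule integral_abs_bound)
      also have "\<dots> \<le> (LBINT x. S * F x)"
      proof (rule integral_mono)
        show "integrable lborel (\<lambda>x. \<bar>H 0 i x * F x\<bar>)" by (rule integrable_abs[OF HF])
        show "\<bar>H 0 i x * F x\<bar> \<le> S * F x" for x
          using mult_right_mono[OF S[of x] F(2)[of x]] F(2)[of x] by (simp add: abs_mult)
      qed (use F(1) in simp)
      finally show ?thesis by simp
    qed
    have b1: "\<bar>LBINT x. H 0 i x * (cmod (P 1 i x))\<^sup>2\<bar> \<le> S * (A / 9 * e i ^ 3)"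
      using bd[OF B1_integrable[OF I1(1) i] _ B1_integrable[OF I2(1) i]]
        mult_left_mono[OF level1_integrals(1)[OF i] S2(2)] by simp
    have "\<bar>LBINT x. H 0 i x * (H 0 i x)\<^sup>2\<bar> \<le> S * (2 * A / 9 * e i ^ 3)"
      using bd[OF B1_integrable[OF I1(2) i] _ B1_integrable[OF I2(2) i]]
        mult_left_mono[OF level1_integrals(2)[OF i] S2(2)] by simp
    then have b2: "\<bar>LBINT x. (H 0 i x)^3\<bar> \<le> S * (2 * A / 9 * e i ^ 3)"
      by (simp add: power3_eq_cube power2_eq_square mult.assoc)
    have "\<bar>r i\<bar> \<le> 3/2 * (S * (A / 9 * e i ^ 3)) + 1/4 * (S * (2 * A / 9 * e i ^ 3))"
      using b1 b2 unfolding r_def by linarith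
    also have "\<dots> = S * c * e i ^ 3" by (simp add: c_def)
    also have "\<dots> \<le> (e i * S\<^sup>2 + c\<^sup>2 * e i ^ 5) / 2"
    proof -
      \<comment> \<open>The square is completed with the weight \<open>e i\<close>, so that
        \<open>S\<close> enters exactly through the quantity bounded in \<open>eT\<close>.\<close>
      have "0 \<le> e i / 2 * (S - c * (e i)\<^sup>2)\<^sup>2" using ep by simp
      also have "\<dots> = (e i * S\<^sup>2 + c\<^sup>2 * e i ^ 5) / 2 - S * c * e i ^ 3"
        by (simp add: power2_eq_square eval_nat_numeral algebra_simps)
      finally show ?thesis by simp
    qed
    also have "\<dots> \<le> (8 * A / 9 * e i ^ 5 + 1/4 * Y + c\<^sup>2 * e i ^ 5) / 2" using eT by simp
    also have "\<dots> = g i + 1/8 * Y"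
    proof -
      have "e i ^ 6 / e i = e i ^ 5" using ep by (simp add: eval_nat_numeral)
      then show ?thesis by (simp add: g_def algebra_simps)
    qed
    finally show ?thesis by (simp add: Y_def)
  qed
  have "B2 (Suc 2) (P 2) \<and> B2 (Suc 2) (H (2 - 1))"
  proof (rule energy_imp_B2[of 2 r g])
    show "bigO (2 * Suc 2) g" unfolding g_def using bigO_cmult[OF bigO_const, of 6] by simp
    show "H (2 - 1) i \<in> borel_measurable borel" "integrable lborel (\<lambda>x. (H (2 - 1) i x)\<^sup>2)" if "i \<in> I" for i
      using B2_measurable[OF B2_H1_weak that] B2_integrable[OF B2_H1_weak that] by simp_all
    show "\<bar>r i\<bar> \<le> g i + 1/8 * (LBINT x. (H (2 - 1) i x)\<^sup>2)" if "i \<in> I" for i using rb[OF that] by simp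
  qed (use k in \<open>auto simp: energy_def energy2_def r_def\<close>)
  then show "B2 3 (P 2)" "B2 3 (H 1)" by (simp_all add: numeral_3_eq_3 numeral_2_eq_2)
qed

lemma Bs_level2: "Bs 2 (P 1)" "Bs 2 (H 0)"
  using Bs_agmon[of 2 "P 1" "P 2"] Bs_agmon[of 2 "H 0" "H 1"] B2_level1 B2_level2 prim[of _ 1] primH[of _ 0] k
  by (auto simp: numeral_2_eq_2 numeral_3_eq_3)

lemma B2_H2_weak: assumes "2 \<le> k" shows "B2 3 (H 2)"
proof -
  have "B2 (min (2 + 2) (0 + 3)) (\<lambda>i x. P 1 i x \<bullet> P 1 i x + P 0 i x \<bullet> P 2 i x)"
    by (intro B2_add B2_inner Bs_level2 B2_level1 B2_level2 Bs_P0)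
  then have "B2 3 (\<lambda>i x. P 1 i x \<bullet> P 1 i x + P 0 i x \<bullet> P 2 i x)" by simp
  then show ?thesis
  proof (rule B2_bound[where c = 2])
    show "H 2 i \<in> borel_measurable borel" if "i \<in> I" for i using measH[OF that, of 2] assms by simp
    have "H 2 i x = - 2 * (P 1 i x \<bullet> P 1 i x + P 0 i x \<bullet> P 2 i x)" for i x
      by (simp add: eta_deriv_def power2_norm_eq_inner)
    then show "norm (H 2 i x) \<le> 2 * norm (P 1 i x \<bullet> P 1 i x + P 0 i x \<bullet> P 2 i x)" for i x
      by (simp only: real_norm_def abs_mult)
  qed
qed

lemmas norm_rules = B2_norm Bs_norm

text \<open>All terms without a sign have order 8 except the one with \<open>H 2\<close> and the
  square of \<open>P 1\<close>: so far \<open>H 2\<close> is known with order 3 only, which would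
  give 7. That term is absorbed, and \<open>X\<close> serves for its integrability alone.\<close>

lemma B2_level3: assumes k2: "2 \<le> k" shows "B2 4 (P 3)" "B2 4 (H 2)"
proof -
  have n1: "Bs 2 (\<lambda>i x. cmod (P 1 i x))" "B2 2 (\<lambda>i x. cmod (P 1 i x))" "B2 3 (\<lambda>i x. cmod (P 2 i x))"
    by (intro B2_norm Bs_norm Bs_level2 B2_level1 B2_level2)+
  have n4: "B1 (4 * 2) (\<lambda>i x. (cmod (P 1 i x)) ^ 4)" by (intro B1_power4 n1)
  have X: "B1 (2 + 4) (\<lambda>i x. H 2 i x * (cmod (P 1 i x))\<^sup>2)"
    using B1_mult[OF B2_H2_weak[OF k2] B2_power[OF n1(1,2), of "num.One" ]] 
      B1_weaken[OF B1_mult[OF B2_H2_weak[OF k2] B2_power[OF n1(1,2), of "num.Bit0 num.One"]], of "2 + 4"] by simp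
  have t1: "B1 (2 + (3 + 3)) (\<lambda>i x. H 0 i x * (cmod (P 2 i x))\<^sup>2)"
    by (intro B1_smult B1_power2 Bs_level2 n1)
  have t2: "B1 (2 + (3 + 3)) (\<lambda>i x. H 0 i x * (H 1 i x)\<^sup>2)"
    by (intro B1_smult B1_power2 Bs_level2 B2_level2)
  have t3: "B1 (2 * 2 + (2 + 2)) (\<lambda>i x. (H 0 i x)\<^sup>2 * (cmod (P 1 i x))\<^sup>2)"
    by (intro B1_smult B1_power2 Bs_power Bs_level2 n1)
  have t4: "B1 (4 * 2) (\<lambda>i x. (H 0 i x)^4)"
    by (intro B1_power4 Bs_level2 B2_level1)
  define s where "s i = 5/4 * (LBINT x. (cmod (P 1 i x))^4)
     - 5/2 * (LBINT x. H 0 i x * (cmod (P 2 i x))\<^sup>2)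
     - 5/4 * (LBINT x. H 0 i x * (H 1 i x)\<^sup>2)
     + 15/4 * (LBINT x. (H 0 i x)\<^sup>2 * (cmod (P 1 i x))\<^sup>2)
     + 5/16 * (LBINT x. (H 0 i x)^4)" for i
  have s: "bigO 8 s"
    unfolding s_def
    using n4 t1 t2 t3 t4
    by (intro bigO_add bigO_diff bigO_cmult B1_bigO) simp_all
  define r where "r i = s i + 5/2 * (LBINT x. H 2 i x * (cmod (P 1 i x))\<^sup>2)" for i
  define g where "g i = \<bar>s i\<bar> + 25/2 * (LBINT x. (cmod (P 1 i x)) ^ 4)" for i
  have "bigO 8 (\<lambda>i. \<bar>s i\<bar>)" using s by (simp add: bigO_def)
  then have g: "bigO 8 g"
    unfolding g_def using n4 by (intro bigO_add bigO_cmult B1_bigO) simp_all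
  have rb: "\<bar>r i\<bar> \<le> g i + 1/8 * (LBINT x. (H 2 i x)\<^sup>2)" if i: "i \<in> I" for i
  proof -
    note int = B1_integrable[OF X i] B1_integrable[OF n4 i] B2_integrable[OF B2_H2_weak[OF k2] i]
    \<comment> \<open>Young's inequality with factors \<open>1/2\<close> and \<open>5\<close>,
      chosen so that the square of \<open>H 2\<close> receives exactly the permitted
      \<open>1/8\<close>.\<close>
    have le: "5/2 * \<bar>H 2 i x * (cmod (P 1 i x))\<^sup>2\<bar> \<le> 1/8 * (H 2 i x)\<^sup>2 + 25/2 * (cmod (P 1 i x)) ^ 4" for x
    proof -
      have "cmod (P 1 i x) ^ 4 = ((cmod (P 1 i x))\<^sup>2)\<^sup>2" by simp
      then show ?thesis
        using sum_squares_bound[of "1/2 * \<bar>H 2 i x\<bar>" "5 * (cmod (P 1 i x))\<^sup>2"]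
        by (simp add: power_mult_distrib abs_mult power_divide)
    qed
    have "\<bar>5/2 * (LBINT x. H 2 i x * (cmod (P 1 i x))\<^sup>2)\<bar> \<le> (LBINT x. 5/2 * \<bar>H 2 i x * (cmod (P 1 i x))\<^sup>2\<bar>)"
      using integral_abs_bound[of lborel "\<lambda>x. H 2 i x * (cmod (P 1 i x))\<^sup>2"] by (simp add: abs_mult)
    also have "\<dots> \<le> (LBINT x. 1/8 * (H 2 i x)\<^sup>2 + 25/2 * (cmod (P 1 i x)) ^ 4)"
      using int by (intro integral_mono le) auto
    also have "\<dots> = 1/8 * (LBINT x. (H 2 i x)\<^sup>2) + 25/2 * (LBINT x. (cmod (P 1 i x)) ^ 4)"
      using int by simp
    finally show ?thesis unfolding r_def g_def by linarith
  qed
  have "B2 (Suc 3) (P 3) \<and> B2 (Suc 3) (H (3 - 1))"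
  proof (rule energy_imp_B2[of 3 r g])
    show "bigO (2 * Suc 3) g" using g by simp
    show "H (3 - 1) i \<in> borel_measurable borel" "integrable lborel (\<lambda>x. (H (3 - 1) i x)\<^sup>2)" if "i \<in> I" for i
      using B2_measurable[OF B2_H2_weak[OF k2] that] B2_integrable[OF B2_H2_weak[OF k2] that] by simp_all
    show "\<bar>r i\<bar> \<le> g i + 1/8 * (LBINT x. (H (3 - 1) i x)\<^sup>2)" if "i \<in> I" for i using rb[OF that] by simp
  qed (use k2 in \<open>auto simp: energy_def energy3_def r_def s_def\<close>)
  then show "B2 4 (P 3)" "B2 4 (H 2)" by (simp_all add: eval_nat_numeral)
qed

lemma Bs_level3: assumes k2: "2 \<le> k" shows "Bs 3 (P 2)" "Bs 3 (H 1)"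
  using Bs_agmon[of 3 "P 2" "P 3"] Bs_agmon[of 3 "H 1" "H 2"] B2_level2 B2_level3[OF k2] prim[of _ 2] primH[of _ 1] k2
  by (auto simp: eval_nat_numeral)

lemma B2_H3_weak: assumes "3 \<le> k" shows "B2 4 (H 3)"
proof -
  have k2: "2 \<le> k" using assms by simp
  have "B2 (min (0 + (2 + 3)) (0 + 4)) (\<lambda>i x. 3 * (P 1 i x \<bullet> P 2 i x) + P 0 i x \<bullet> P 3 i x)"
    by (intro B2_add B2_mult B2_inner Bs_const Bs_level2 B2_level2 B2_level3 Bs_P0 k2)
  then have "B2 4 (\<lambda>i x. 3 * (P 1 i x \<bullet> P 2 i x) + P 0 i x \<bullet> P 3 i x)" by simp
  then show ?thesis
  proof (rule B2_bound[where c = 2])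
    show "H 3 i \<in> borel_measurable borel" if "i \<in> I" for i using measH_Suc[OF that, of 2] assms
      by (simp add: eval_nat_numeral)
    have "H 3 i x = - 2 * (3 * (P 1 i x \<bullet> P 2 i x) + P 0 i x \<bullet> P 3 i x)" for i x
      by (simp add: eta_deriv_def)
    then show "norm (H 3 i x) \<le> 2 * norm (3 * (P 1 i x \<bullet> P 2 i x) + P 0 i x \<bullet> P 3 i x)" for i x
      by (simp only: real_norm_def abs_mult)
  qed
qed

lemma B2_level4: assumes k3: "3 \<le> k" shows "B2 5 (P 4)" "B2 5 (H 3)"
proof -
  have k2: "2 \<le> k" using k3 by simp
  note L = Bs_level2 Bs_level3[OF k2] B2_level1 B2_level2 B2_level3[OF k2]
  have n: "Bs 2 (\<lambda>i x. cmod (P 1 i x))" "Bs 3 (\<lambda>i x. cmod (P 2 i x))"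
    "B2 2 (\<lambda>i x. cmod (P 1 i x))" "B2 3 (\<lambda>i x. cmod (P 2 i x))" "B2 4 (\<lambda>i x. cmod (P 3 i x))"
    by (intro norm_rules L)+
  define r where "r i =
     - 7/4 * (LBINT x. H 0 i x * (H 2 i x)\<^sup>2)
     - 7/2 * (LBINT x. H 0 i x * (cmod (P 3 i x))\<^sup>2)
     + 35/8 * (LBINT x. (H 0 i x)\<^sup>2 * (H 1 i x)\<^sup>2)
     + 35/4 * (LBINT x. (H 0 i x)\<^sup>2 * (cmod (P 2 i x))\<^sup>2)
     - 35/4 * (LBINT x. (H 1 i x)\<^sup>2 * (cmod (P 1 i x))\<^sup>2)
     - 7/2 * (LBINT x. (cmod (P 1 i x))\<^sup>2 * (cmod (P 2 i x))\<^sup>2)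
     - 7 * (LBINT x. H 2 i x * (P 1 i x \<bullet> P 3 i x))
     - 7 * (LBINT x. (cmod (P 1 i x))\<^sup>2 * (P 1 i x \<bullet> P 3 i x))
     - 35/2 * (LBINT x. H 0 i x * H 2 i x * (cmod (P 1 i x))\<^sup>2)
     - 35/4 * (LBINT x. (H 0 i x)^3 * (cmod (P 1 i x))\<^sup>2)
     - 35/4 * (LBINT x. H 0 i x * (cmod (P 1 i x))^4)
     - 7/16 * (LBINT x. (H 0 i x)^5)" for i
  have "B1 (2 + (4 + 4)) (\<lambda>i x. H 0 i x * (H 2 i x)\<^sup>2)"
    "B1 (2 + (4 + 4)) (\<lambda>i x. H 0 i x * (cmod (P 3 i x))\<^sup>2)"
    "B1 (2 * 2 + (3 + 3)) (\<lambda>i x. (H 0 i x)\<^sup>2 * (H 1 i x)\<^sup>2)"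
    "B1 (2 * 2 + (3 + 3)) (\<lambda>i x. (H 0 i x)\<^sup>2 * (cmod (P 2 i x))\<^sup>2)"
    "B1 (2 * 3 + (2 + 2)) (\<lambda>i x. (H 1 i x)\<^sup>2 * (cmod (P 1 i x))\<^sup>2)"
    "B1 (2 * 2 + (3 + 3)) (\<lambda>i x. (cmod (P 1 i x))\<^sup>2 * (cmod (P 2 i x))\<^sup>2)"
    "B1 (4 + (2 + 4)) (\<lambda>i x. H 2 i x * (P 1 i x \<bullet> P 3 i x))"
    "B1 (2 * 2 + (2 + 4)) (\<lambda>i x. (cmod (P 1 i x))\<^sup>2 * (P 1 i x \<bullet> P 3 i x))"
    "B1 ((2 + 4) + 2 * 2) (\<lambda>i x. H 0 i x * H 2 i x * (cmod (P 1 i x))\<^sup>2)"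
    "B1 (3 * 2 + (2 + 2)) (\<lambda>i x. (H 0 i x)^3 * (cmod (P 1 i x))\<^sup>2)"
    "B1 (2 + 4 * 2) (\<lambda>i x. H 0 i x * (cmod (P 1 i x))^4)"
    "B1 (5 * 2) (\<lambda>i x. (H 0 i x)^5)"
    by ((rule B1_smult B1_mult B1_inner B1_power2 B1_power4 B1_power5 Bs_power B2_mult B2_inner B2_power L n)+; fail)+
  then have "bigO 10 r" unfolding r_def
    by (intro bigO_add bigO_diff bigO_cmult B1_bigO) simp_all
  then have g: "bigO 10 (\<lambda>i. \<bar>r i\<bar>)" by (simp add: bigO_def)
  have "B2 (Suc 4) (P 4) \<and> B2 (Suc 4) (H (4 - 1))"
  proof (rule energy_imp_B2[of 4 r "\<lambda>i. \<bar>r i\<bar>"])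
    show "bigO (2 * Suc 4) (\<lambda>i. \<bar>r i\<bar>)" using g by simp
    show "H (4 - 1) i \<in> borel_measurable borel" "integrable lborel (\<lambda>x. (H (4 - 1) i x)\<^sup>2)" if "i \<in> I" for i
      using B2_measurable[OF B2_H3_weak[OF k3] that] B2_integrable[OF B2_H3_weak[OF k3] that] by simp_all
  qed (use k3 in \<open>auto simp: energy_def energy4_def r_def\<close>)
  then show "B2 5 (P 4)" "B2 5 (H 3)" by simp_all
qed

lemma Bs_level4: assumes k3: "3 \<le> k" shows "Bs 4 (P 3)" "Bs 4 (H 2)"
  using Bs_agmon[of 4 "P 3" "P 4"] Bs_agmon[of 4 "H 2" "H 3"] B2_level3 B2_level4[OF k3] prim[of _ 3] primH[of _ 2] k3
  by (auto simp: eval_nat_numeral)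

end

section \<open>Hydrodynamic variables\<close>

text \<open>The derivatives of \<open>q = \<Psi>' / \<Psi>\<close>.\<close>

definition log_deriv :: "nat \<Rightarrow> (nat \<Rightarrow> real \<Rightarrow> complex) \<Rightarrow> real \<Rightarrow> complex" where
  "log_deriv j p x =
     (if j = 0 then p 1 x * inverse (p 0 x)
      else if j = 1 then p 2 x * inverse (p 0 x) - (p 1 x * inverse (p 0 x))\<^sup>2
      else p 3 x * inverse (p 0 x) - 3 * (p 1 x * inverse (p 0 x)) * (p 2 x * inverse (p 0 x))
        + 2 * (p 1 x * inverse (p 0 x))^3)"

lemma inverse_primitive:
  fixes u :: "real \<Rightarrow> complex"
  assumes "is_primitive u v" "continuous_on UNIV v" "\<And>x. u x \<noteq> 0"
  shows "is_primitive (\<lambda>x. inverse (u x)) (\<lambda>x. - (v x * inverse (u x) * inverse (u x)))"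
proof (rule is_primitive_C1)
  show "((\<lambda>x. inverse (u x)) has_vector_derivative - (v x * inverse (u x) * inverse (u x))) (at x)" for x
    using field_vector_diff_chain_at[OF is_primitive_has_vector_derivative[OF assms(1,2)] DERIV_inverse[OF assms(3)], of x]
    by (simp add: o_def mult.assoc)
  show "continuous_on UNIV (\<lambda>x. - (v x * inverse (u x) * inverse (u x)))"
    using assms by (intro continuous_intros is_primitive_continuous[OF assms(1)]) auto
qed

text \<open>The quotients \<open>r m = p m / p 0\<close> satisfy
  \<open>r_m' = r_(m+1) - r_m r_1\<close>, and the derivatives of \<open>q = r_1\<close> are
  polynomials in them.\<close>

lemma log_deriv_primitive:
  assumes j: "j \<le> 1" and p: "\<And>l. l \<le> Suc j \<Longrightarrow> is_primitive (p l) (p (Suc l))" and nz: "\<And>x. p 0 x \<noteq> 0"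
  shows "is_primitive (log_deriv j p) (log_deriv (Suc j) p)"
proof -
  have p0: "is_primitive (p 0) (p 1)" and p1: "is_primitive (p 1) (p 2)"
    using p[of 0] p[of 1] by (simp_all add: numeral_2_eq_2)
  define r where "r m x = p m x * inverse (p 0 x)" for m x
  have inv: "is_primitive (\<lambda>x. inverse (p 0 x)) (\<lambda>x. - (p 1 x * inverse (p 0 x) * inverse (p 0 x)))"
    by (rule inverse_primitive[OF p0 is_primitive_continuous[OF p1] nz])
  have r: "is_primitive (r m) (\<lambda>x. r (Suc m) x - r m x * r 1 x)" if "m \<le> Suc j" for m
    using is_primitive_mult[OF p[OF that] inv] by (simp add: r_def[abs_def] algebra_simps)
  have r1: "is_primitive (r 1) (\<lambda>x. r 2 x - r 1 x * r 1 x)"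
    using r[of 1] by (simp add: numeral_2_eq_2)
  consider "j = 0" | "j = 1" using j by linarith
  then show ?thesis
  proof cases
    case 1
    then show ?thesis using r1 by (simp add: log_deriv_def[abs_def] r_def[abs_def] power2_eq_square)
  next
    case 2
    have r2: "is_primitive (r 2) (\<lambda>x. r 3 x - r 2 x * r 1 x)"
      using r[of 2] 2 by (simp add: numeral_2_eq_2 numeral_3_eq_3)
    have "is_primitive (\<lambda>x. r 2 x - r 1 x * r 1 x) (\<lambda>x. (r 3 x - r 2 x * r 1 x)
       - ((r 2 x - r 1 x * r 1 x) * r 1 x + r 1 x * (r 2 x - r 1 x * r 1 x)))"
      by (intro is_primitive_diff is_primitive_mult r1 r2)
    moreover have "(r 3 x - r 2 x * r 1 x) - ((r 2 x - r 1 x * r 1 x) * r 1 x + r 1 x * (r 2 x - r 1 x * r 1 x))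
       = r 3 x - 3 * r 1 x * r 2 x + 2 * (r 1 x)^3" for x
      by (simp add: algebra_simps power3_eq_cube)
    ultimately have "is_primitive (\<lambda>x. r 2 x - r 1 x * r 1 x) (\<lambda>x. r 3 x - 3 * r 1 x * r 2 x + 2 * (r 1 x)^3)"
      by (simp only:)
    then show ?thesis using 2
      by (simp add: log_deriv_def[abs_def] r_def[abs_def] power2_eq_square)
  qed
qed

lemma inner_mult_right_complex: "(z * a) \<bullet> (w * a) = (cmod a)\<^sup>2 * (z \<bullet> w)" for a z w :: complex
  unfolding cmod_power2 inner_complex_def by (simp add: algebra_simps power2_eq_square)

context gp_family
begin

definition W :: "nat \<Rightarrow> 'i \<Rightarrow> real \<Rightarrow> real" where "W j i x = Im (log_deriv j (\<lambda>l. P l i) x)"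
definition G :: "nat \<Rightarrow> 'i \<Rightarrow> real \<Rightarrow> real" where "G j i x = Re (log_deriv j (\<lambda>l. P l i) x)"
definition R :: "'i \<Rightarrow> real \<Rightarrow> real" where "R i x = (cmod (P 0 i x))\<^sup>2"

lemma primWG:
  assumes "i \<in> I" "j \<le> 1" "Suc j \<le> k"
  shows "is_primitive (W j i) (W (Suc j) i)" "is_primitive (G j i) (G (Suc j) i)"
proof -
  have "is_primitive (log_deriv j (\<lambda>l. P l i)) (log_deriv (Suc j) (\<lambda>l. P l i))"
    using assms by (intro log_deriv_primitive prim P0_bounds(3)) auto
  then show "is_primitive (W j i) (W (Suc j) i)" "is_primitive (G j i) (G (Suc j) i)"
    unfolding W_def[abs_def] G_def[abs_def] by (auto intro: is_primitive_Im is_primitive_Re)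
qed

text \<open>From \<open>P 1 = q P 0\<close> follow \<open>P 2 = (q' + q^2) P 0\<close> and
  \<open>P 3 = (q'' + 3 q q' + q^3) P 0\<close>. In the last formula the terms of higher order are
  bracketed, because \<open>density_identity3\<close> treats them apart.\<close>

lemma P_eq:
  assumes "i \<in> I"
  shows "P 1 i x = Complex (G 0 i x) (W 0 i x) * P 0 i x"
    "P 2 i x = Complex (G 1 i x + (G 0 i x)\<^sup>2 - (W 0 i x)\<^sup>2) (W 1 i x + 2 * G 0 i x * W 0 i x) * P 0 i x"
    "P 3 i x = Complex (G 2 i x - 3 * W 0 i x * W 1 i x + (3 * G 0 i x * G 1 i x + (G 0 i x)^3 - 3 * G 0 i x * (W 0 i x)\<^sup>2))
      (W 2 i x + (3 * (G 0 i x * W 1 i x + W 0 i x * G 1 i x) + 3 * (G 0 i x)\<^sup>2 * W 0 i x - (W 0 i x)^3)) * P 0 i x"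
proof -
  define Q where "Q j = log_deriv j (\<lambda>l. P l i) x" for j
  have nz: "P 0 i x \<noteq> 0" by (rule P0_bounds(3)[OF assms])
  have Q: "Q j = Complex (G j i x) (W j i x)" for j by (simp add: Q_def G_def W_def)
  have "P 1 i x = Q 0 * P 0 i x" using nz by (simp add: Q_def log_deriv_def)
  then show "P 1 i x = Complex (G 0 i x) (W 0 i x) * P 0 i x" by (simp add: Q)
  have "P 2 i x = (Q 1 + (Q 0)\<^sup>2) * P 0 i x" using nz by (simp add: Q_def log_deriv_def)
  also have "Q 1 + (Q 0)\<^sup>2 = Complex (G 1 i x + (G 0 i x)\<^sup>2 - (W 0 i x)\<^sup>2) (W 1 i x + 2 * G 0 i x * W 0 i x)"
    by (simp add: Q complex_eq_iff power2_eq_square)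
  finally show "P 2 i x = Complex (G 1 i x + (G 0 i x)\<^sup>2 - (W 0 i x)\<^sup>2) (W 1 i x + 2 * G 0 i x * W 0 i x) * P 0 i x" .
  have "Q 2 + 3 * Q 0 * Q 1 + (Q 0)^3 = P 3 i x * inverse (P 0 i x)"
    by (simp add: Q_def log_deriv_def algebra_simps power2_eq_square power3_eq_cube)
  then have "P 3 i x = (Q 2 + 3 * Q 0 * Q 1 + (Q 0)^3) * P 0 i x" using nz by simp
  also have "Q 2 + 3 * Q 0 * Q 1 + (Q 0)^3 = Complex (G 2 i x - 3 * W 0 i x * W 1 i x + (3 * G 0 i x * G 1 i x + (G 0 i x)^3 - 3 * G 0 i x * (W 0 i x)\<^sup>2))
      (W 2 i x + (3 * (G 0 i x * W 1 i x + W 0 i x * G 1 i x) + 3 * (G 0 i x)\<^sup>2 * W 0 i x - (W 0 i x)^3))"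
    by (simp add: Q complex_eq_iff power2_eq_square power3_eq_cube algebra_simps)
  finally show "P 3 i x = Complex (G 2 i x - 3 * W 0 i x * W 1 i x + (3 * G 0 i x * G 1 i x + (G 0 i x)^3 - 3 * G 0 i x * (W 0 i x)\<^sup>2))
      (W 2 i x + (3 * (G 0 i x * W 1 i x + W 0 i x * G 1 i x) + 3 * (G 0 i x)\<^sup>2 * W 0 i x - (W 0 i x)^3)) * P 0 i x" .
qed

lemma R_eq: "R i x = 1 - H 0 i x"
  by (simp add: R_def eta_deriv_def)

lemma norm_P_sq:
  assumes "P j i x = Complex a b * P 0 i x"
  shows "(cmod (P j i x))\<^sup>2 = R i x * (a\<^sup>2 + b\<^sup>2)"
  unfolding assms norm_mult power_mult_distrib R_def by (simp add: complex_norm mult.commute)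

lemma inner_P:
  assumes "P j i x = Complex a b * P 0 i x" "P l i x = Complex c d * P 0 i x"
  shows "(\<i> * P j i x) \<bullet> P l i x = R i x * (a * d - b * c)" "P j i x \<bullet> P l i x = R i x * (a * c + b * d)"
  unfolding assms mult.assoc[symmetric] inner_mult_right_complex R_def
  by (simp_all add: inner_complex_def)

text \<open>In this form \<open>P 0\<close> can be an argument of \<open>inner_P\<close>; the
  factors 0 and 1 in the density identities stem from it.\<close>

lemma P0_eq: "P 0 i x = Complex 1 0 * P 0 i x"
  by (simp add: complex_eq_iff)

lemma H_eq:
  assumes "i \<in> I"
  shows "H 1 i x = - 2 * (R i x * G 0 i x)"
    "H 2 i x = - 2 * (R i x * (G 1 i x + 2 * (G 0 i x)\<^sup>2))"
    "H 3 i x = - 2 * (R i x * (G 2 i x + 6 * G 0 i x * G 1 i x + 4 * (G 0 i x)^3))"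
proof -
  note E = P_eq[OF assms, of x]
  show "H 1 i x = - 2 * (R i x * G 0 i x)"
    using inner_P(2)[OF P0_eq E(1)] by (simp add: eta_deriv_def)
  show "H 2 i x = - 2 * (R i x * (G 1 i x + 2 * (G 0 i x)\<^sup>2))"
    using inner_P(2)[OF P0_eq E(2)] norm_P_sq[OF E(1)] by (simp add: eta_deriv_def algebra_simps)
  have "H 3 i x = - 2 * (3 * (P 1 i x \<bullet> P 2 i x) + P 0 i x \<bullet> P 3 i x)" by (simp add: eta_deriv_def)
  also have "\<dots> = - 2 * (R i x * (G 2 i x + 6 * G 0 i x * G 1 i x + 4 * (G 0 i x)^3))"
    unfolding inner_P(2)[OF P0_eq E(3)] inner_P(2)[OF E(1) E(2)]
    by (simp add: algebra_simps power2_eq_square power3_eq_cube)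
  finally show "H 3 i x = - 2 * (R i x * (G 2 i x + 6 * G 0 i x * G 1 i x + 4 * (G 0 i x)^3))" .
qed

lemma R_nonzero: "i \<in> I \<Longrightarrow> R i x \<noteq> 0"
  using P0_bounds(3) by (simp add: R_def)

lemma Bs_R: "Bs 0 R"
  using Bs_diff[OF Bs_const[of "1::real"] Bs0_H0] by (simp add: R_eq[abs_def])

lemma Bs_inverse_R: "Bs 0 (\<lambda>i x. inverse (R i x))"
  using Bs_mult[OF Bs_norm[OF Bs_inverse_P0] Bs_norm[OF Bs_inverse_P0]]
  by (simp add: R_def norm_inverse power2_eq_square)

text \<open>Solving \<open>H_eq\<close> for \<open>G\<close> transfers the orders of the derivatives
  of \<open>eta\<close> to \<open>g\<close>. This gains one order over what the quotient
  \<open>P 1 / P 0\<close> shows directly.\<close>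

lemma G_eq:
  assumes "i \<in> I"
  shows "G 0 i x = - 1/2 * (inverse (R i x) * H 1 i x)"
    "G 1 i x = - 1/2 * (inverse (R i x) * H 2 i x) - 2 * (G 0 i x)\<^sup>2"
    "G 2 i x = - 1/2 * (inverse (R i x) * H 3 i x) - 6 * G 0 i x * G 1 i x - 4 * (G 0 i x)^3"
  unfolding H_eq[OF assms] using R_nonzero[OF assms, of x] by (simp_all add: mult.assoc[symmetric])

text \<open>Used by repeated resolution: the orders stay open until the bounds on the atomic factors
  fix them, and a final comparison of numerals passes to the desired order.\<close>

lemmas B_rules = B1_cmult B1_smult B1_mult B1_inner B1_power2 B1_add B1_diff B1_uminus
  B2_mult B2_inner B2_power B2_add B2_diff B2_uminus
  Bs_mult Bs_inner Bs_power Bs_add Bs_diff Bs_uminus Bs_const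

section \<open>Orders of the real and imaginary parts of the logarithmic derivative\<close>

text \<open>These bounds for \<open>q\<close> and its derivatives have the order of the imaginary
  part \<open>w\<close> and are used only for it; the real part gets its better order from
  \<open>G_eq\<close>.\<close>

lemma Q0_bounds: "Bs 2 (\<lambda>i x. log_deriv 0 (\<lambda>l. P l i) x)" "B2 2 (\<lambda>i x. log_deriv 0 (\<lambda>l. P l i) x)"
proof -
  have "Bs 2 (\<lambda>i x. P 1 i x * inverse (P 0 i x))" "B2 2 (\<lambda>i x. P 1 i x * inverse (P 0 i x))"
    using Bs_mult[OF Bs_level2(1) Bs_inverse_P0] B2_mult'[OF B2_level1(1) Bs_inverse_P0] by simp_all
  then show "Bs 2 (\<lambda>i x. log_deriv 0 (\<lambda>l. P l i) x)" "B2 2 (\<lambda>i x. log_deriv 0 (\<lambda>l. P l i) x)"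
    by (simp_all add: log_deriv_def)
qed

lemma Q1_bounds: assumes "2 \<le> k"
  shows "Bs 3 (\<lambda>i x. log_deriv 1 (\<lambda>l. P l i) x)" "B2 3 (\<lambda>i x. log_deriv 1 (\<lambda>l. P l i) x)"
proof -
  have "Bs (min (3 + 0) (2 + 2)) (\<lambda>i x. P 2 i x * inverse (P 0 i x) - log_deriv 0 (\<lambda>l. P l i) x * log_deriv 0 (\<lambda>l. P l i) x)"
    by (intro Bs_diff Bs_mult Bs_level3 Bs_inverse_P0 Q0_bounds assms)
  moreover have "B2 (min (3 + 0) (2 + 2)) (\<lambda>i x. P 2 i x * inverse (P 0 i x) - log_deriv 0 (\<lambda>l. P l i) x * log_deriv 0 (\<lambda>l. P l i) x)"
    by (intro B2_diff B2_mult B2_mult'[OF _ Bs_inverse_P0] B2_level2 Q0_bounds)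
  ultimately show "Bs 3 (\<lambda>i x. log_deriv 1 (\<lambda>l. P l i) x)" "B2 3 (\<lambda>i x. log_deriv 1 (\<lambda>l. P l i) x)"
    by (simp_all add: log_deriv_def power2_eq_square)
qed

lemma Q2_bounds: assumes "3 \<le> k"
  shows "Bs 4 (\<lambda>i x. log_deriv 2 (\<lambda>l. P l i) x)" "B2 4 (\<lambda>i x. log_deriv 2 (\<lambda>l. P l i) x)"
proof -
  have k2: "2 \<le> k" using assms by simp
  let ?q = "\<lambda>i x. log_deriv 0 (\<lambda>l. P l i) x"
  have eq: "log_deriv 2 (\<lambda>l. P l i) x = P 3 i x * inverse (P 0 i x) - 3 * (?q i x * log_deriv 1 (\<lambda>l. P l i) x) - ?q i x * (?q i x * ?q i x)" for i x
    by (simp add: log_deriv_def algebra_simps power2_eq_square power3_eq_cube)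
  have "Bs (min (min (4 + 0) (0 + (2 + 3))) (2 + (2 + 2))) (\<lambda>i x. log_deriv 2 (\<lambda>l. P l i) x)"
    unfolding eq by (intro Bs_diff Bs_mult Bs_const Bs_level4 Bs_inverse_P0 Q0_bounds Q1_bounds assms k2)
  moreover have "B2 (min (min (4 + 0) (0 + (2 + 3))) (2 + (2 + 2))) (\<lambda>i x. log_deriv 2 (\<lambda>l. P l i) x)"
    unfolding eq by (intro B2_diff B2_mult B2_mult'[OF _ Bs_inverse_P0] Bs_const B2_level3 Q0_bounds Q1_bounds k2)
  ultimately show "Bs 4 (\<lambda>i x. log_deriv 2 (\<lambda>l. P l i) x)" "B2 4 (\<lambda>i x. log_deriv 2 (\<lambda>l. P l i) x)"
    by simp_all
qed

lemma B_W:
  assumes "Bs m (\<lambda>i x. log_deriv j (\<lambda>l. P l i) x)" "B2 m (\<lambda>i x. log_deriv j (\<lambda>l. P l i) x)"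
  shows "Bs m (W j)" "B2 m (W j)"
proof -
  have m: "W j i \<in> borel_measurable borel" if "i \<in> I" for i
    using Bs_measurable[OF assms(1) that] unfolding W_def[abs_def] by simp
  show "Bs m (W j)" by (rule Bs_bound[OF assms(1) m, where c = 1]) (auto simp: W_def abs_Im_le_cmod)
  show "B2 m (W j)" by (rule B2_bound[OF assms(2) m, where c = 1]) (auto simp: W_def abs_Im_le_cmod)
qed

lemmas W0_bounds = B_W[OF Q0_bounds]
lemma W1_bounds: assumes "2 \<le> k" shows "Bs 3 (W 1)" "B2 3 (W 1)"
  using B_W[OF Q1_bounds[OF assms]] by auto
lemma W2_bounds: assumes "3 \<le> k" shows "Bs 4 (W 2)" "B2 4 (W 2)"
  using B_W[OF Q2_bounds[OF assms]] by auto

lemma B2_G0: "B2 3 (G 0)"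
proof -
  have "B2 (0 + (0 + 3)) (\<lambda>i x. - 1/2 * (inverse (R i x) * H 1 i x))"
    by (intro B2_mult Bs_const Bs_inverse_R B2_level2)
  then show ?thesis by (rule B2_cong[OF B2_weaken]) (simp_all add: G_eq)
qed

lemma Bs_G0: assumes "2 \<le> k" shows "Bs 3 (G 0)"
proof -
  have "Bs (0 + (0 + 3)) (\<lambda>i x. - 1/2 * (inverse (R i x) * H 1 i x))"
    by (intro Bs_mult Bs_const Bs_inverse_R Bs_level3 assms)
  then show ?thesis by (rule Bs_cong[OF Bs_weaken]) (simp_all add: G_eq)
qed

lemma B2_G1: assumes "2 \<le> k" shows "B2 4 (G 1)"
proof -
  have "B2 (min (0 + (0 + 4)) (0 + 2 * 3)) (\<lambda>i x. - 1/2 * (inverse (R i x) * H 2 i x) - 2 * (G 0 i x)\<^sup>2)"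
    by (intro B2_diff B2_mult B2_power Bs_const Bs_inverse_R B2_level3 Bs_G0 B2_G0 assms)
  then show ?thesis by (rule B2_cong[OF B2_weaken]) (simp, simp only: G_eq(2))
qed

lemma Bs_G1: assumes "3 \<le> k" shows "Bs 4 (G 1)"
proof -
  have "Bs (min (0 + (0 + 4)) (0 + 2 * 3)) (\<lambda>i x. - 1/2 * (inverse (R i x) * H 2 i x) - 2 * (G 0 i x)\<^sup>2)"
    using assms by (intro Bs_diff Bs_mult Bs_power Bs_const Bs_inverse_R Bs_level4 Bs_G0) auto
  then show ?thesis by (rule Bs_cong[OF Bs_weaken]) (simp, simp only: G_eq(2))
qed

lemma B2_G2: assumes "3 \<le> k" shows "B2 5 (G 2)"
proof -
  have k2: "2 \<le> k" using assms by simp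
  have "B2 (min (min (0 + (0 + 5)) ((0 + 3) + 4)) (0 + 3 * 3))
    (\<lambda>i x. - 1/2 * (inverse (R i x) * H 3 i x) - 6 * G 0 i x * G 1 i x - 4 * (G 0 i x)^3)"
    by (intro B2_diff B2_mult Bs_mult B2_power Bs_const Bs_inverse_R B2_level4 Bs_G0 B2_G0 B2_G1 assms k2)
  then show ?thesis by (rule B2_cong[OF B2_weaken]) (simp, simp only: G_eq(3))
qed

section \<open>Comparison of the invariants, order by order\<close>

lemma bigO_integral:
  assumes "B1 m F" "\<And>i. i \<in> I \<Longrightarrow> f i = (LBINT x. F i x)"
  shows "bigO m f"
  by (rule bigO_cong[OF B1_bigO[OF assms(1)]]) (simp add: assms(2))

text \<open>The comparison is pointwise, without integration by parts: since
  \<open>\<sigma>\<^sup>2 = 2\<close>, the square in the limit produces \<open>w^2 / 2\<close>,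
  which matches \<open>R w^2 / 2\<close> up to \<open>eta w^2 / 2\<close>. The other error
  \<open>R g^2 / 2\<close> has order 6 because \<open>g\<close> has order 3.\<close>

lemma kdv_approximation1:
  assumes s: "\<sigma>\<^sup>2 = 2"
  shows "bigO 6 (\<lambda>i. energy 1 (\<lambda>l. P l i) + \<sigma> * (1/2 * (LBINT x. H 0 i x * W 0 i x))
     - 1/4 * (LBINT x. (H 0 i x + \<sigma> * W 0 i x)\<^sup>2))" (is "bigO _ ?f")
proof (rule bigO_integral)
  note at = Bs_level2 B2_level1 W0_bounds B2_G0 Bs_R
  show "B1 6 (\<lambda>i x. 1/2 * (R i x * (G 0 i x)\<^sup>2) - 1/2 * (H 0 i x * (W 0 i x)\<^sup>2))"
    by (rule B1_weaken, (rule B_rules at)+, simp)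
  fix i assume i: "i \<in> I"
  have int: "integrable lborel (\<lambda>x. (cmod (P 1 i x))\<^sup>2)" "integrable lborel (\<lambda>x. (H 0 i x)\<^sup>2)"
    "integrable lborel (\<lambda>x. H 0 i x * W 0 i x)" "integrable lborel (\<lambda>x. (H 0 i x + \<sigma> * W 0 i x)\<^sup>2)"
    by (rule B1_integrable[OF _ i], (rule B_rules B2_norm at)+)+
  have "1/2 * (R i x * (G 0 i x)\<^sup>2) - 1/2 * (H 0 i x * (W 0 i x)\<^sup>2) =
     1/2 * (cmod (P 1 i x))\<^sup>2 + 1/4 * (H 0 i x)\<^sup>2 + \<sigma> * (1/2 * (H 0 i x * W 0 i x)) - 1/4 * (H 0 i x + \<sigma> * W 0 i x)\<^sup>2" for x
  proof -
    have "(H 0 i x + \<sigma> * W 0 i x)\<^sup>2 = (H 0 i x)\<^sup>2 + 2 * \<sigma> * (H 0 i x * W 0 i x) + 2 * (W 0 i x)\<^sup>2"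
      using s by (simp add: power2_sum power_mult_distrib)
    then show ?thesis
      unfolding norm_P_sq[OF P_eq(1)[OF i]] by (simp add: R_eq algebra_simps)
  qed
  then show "?f i =
     (LBINT x. 1/2 * (R i x * (G 0 i x)\<^sup>2) - 1/2 * (H 0 i x * (W 0 i x)\<^sup>2))"
    using int by (simp add: energy_def energy1_def)
qed

end

text \<open>The left side is the density of \<open>E_2 + \<sigma> p_2\<close> minus the KdV density,
  corrected by the exact derivative \<open>\<sigma>/2 (g0 w0)'\<close>. This correction turns
  \<open>g1 w0 - w1 g0\<close> into \<open>- 2 g0 w1\<close>, which is \<open>h1 w1\<close> to
  leading order. With weights 2 for \<open>h0\<close> and \<open>w0\<close>, 3 for
  \<open>h1\<close>, \<open>w1\<close> and \<open>g0\<close>, and 4 for \<open>g1\<close>, every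
  term on the right weighs at least 8.\<close>

lemma density_identity2:
  fixes \<sigma> :: real
  assumes s: "\<sigma>\<^sup>2 = 2" and r: "r = 1 - h0" and h1: "h1 = - 2 * (r * g0)"
  shows "1/2 * (r * ((g1 + g0\<^sup>2 - w0\<^sup>2)\<^sup>2 + (w1 + 2 * g0 * w0)\<^sup>2)) - 3/2 * (h0 * (r * (g0\<^sup>2 + w0\<^sup>2)))
      + 1/4 * h1\<^sup>2 - 1/4 * h0^3
      + \<sigma> * (1/2 * (r * ((g1 + g0\<^sup>2 - w0\<^sup>2) * w0 - (w1 + 2 * g0 * w0) * g0)) - 3/4 * (h0 * (r * (g0 * 0 - w0 * 1)))
         - 3/2 * (1/2 * (h0 * w0)) - 1/2 * (g1 * w0 + g0 * w1))
      - (1/4 * (h1 + \<sigma> * w1)\<^sup>2 - 1/4 * (h0 + \<sigma> * w0)^3)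
    = 1/2 * (r * (g1 + g0\<^sup>2 - w0\<^sup>2)\<^sup>2) + 1/2 * (r * (2 * w1 + 2 * g0 * w0) * (2 * g0 * w0)) - 1/2 * (h0 * w1\<^sup>2)
      - 3/2 * (h0 * (r * g0\<^sup>2 - h0 * w0\<^sup>2))
      + \<sigma> * (1/2 * (- (h0 * (w0 * g1 - w1 * g0 - w0^3)) - r * g0\<^sup>2 * w0) - h0 * g0 * w1)"
proof -
  have s3: "\<sigma>^3 = 2 * \<sigma>" using s by (simp add: power3_eq_cube power2_eq_square)
  have v1: "(h1 + \<sigma> * w1)\<^sup>2 = h1\<^sup>2 + 2 * \<sigma> * h1 * w1 + 2 * w1\<^sup>2"
    by (simp add: power2_sum power_mult_distrib s)
  have "(h0 + \<sigma> * w0)^3 = h0^3 + 3 * \<sigma> * h0\<^sup>2 * w0 + 3 * (\<sigma>\<^sup>2) * h0 * w0\<^sup>2 + \<sigma>^3 * w0^3"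
    by (simp add: algebra_simps power2_eq_square power3_eq_cube)
  then have v0: "(h0 + \<sigma> * w0)^3 = h0^3 + 3 * \<sigma> * h0\<^sup>2 * w0 + 6 * h0 * w0\<^sup>2 + 2 * \<sigma> * w0^3"
    by (simp add: s s3)
  show ?thesis
    unfolding v1 v0 unfolding h1 unfolding r
    by (simp add: algebra_simps power2_eq_square power3_eq_cube)
qed

text \<open>Four exact derivatives are subtracted: multiples of \<open>(h1 w0^2)'\<close>,
  \<open>(g1 w1)'\<close>, \<open>(w1 w0^2)'\<close> and \<open>(h0 h1 w0)'\<close>. The first
  produces the mixed term \<open>h1 w0 w1\<close> of the KdV density. The abbreviations isolate what
  is of higher weight: \<open>d\<close> is the excess of the squared norm of the first derivative
  over \<open>w0^2\<close>, and \<open>e0\<close>, \<open>e1\<close> measure the failure of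
  \<open>g = - eta' / 2\<close> and of its derivative.\<close>

lemma density_identity3:
  fixes \<sigma> r h0 h1 h2 g0 g1 g2 w0 w1 w2 :: real
  assumes s: "\<sigma>\<^sup>2 = 2" and r: "r = 1 - h0"
  defines "y \<equiv> 3 * (g0 * w1 + w0 * g1) + 3 * g0\<^sup>2 * w0 - w0^3"
    and "x \<equiv> g2 - 3 * w0 * w1 + (3 * g0 * g1 + g0^3 - 3 * g0 * w0\<^sup>2)"
    and "x1 \<equiv> g1 + g0\<^sup>2 - w0\<^sup>2" and "y1 \<equiv> 2 * g0 * w0"
    and "d \<equiv> r * g0\<^sup>2 - h0 * w0\<^sup>2" and "e0 \<equiv> g0 + 1/2 * h1" and "e1 \<equiv> g1 + 1/2 * h2"
  shows "1/2 * (r * (x\<^sup>2 + (w2 + y)\<^sup>2)) + 1/4 * h2\<^sup>2 + 5/4 * (r * (g0\<^sup>2 + w0\<^sup>2))\<^sup>2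
      + 5/2 * (h2 * (r * (g0\<^sup>2 + w0\<^sup>2))) - 5/2 * (h0 * (r * (x1\<^sup>2 + (w1 + y1)\<^sup>2)))
      - 5/4 * (h0 * h1\<^sup>2) + 15/4 * (h0\<^sup>2 * (r * (g0\<^sup>2 + w0\<^sup>2))) + 5/16 * h0^4
      - 5/2 * (h2 * w0\<^sup>2 + h1 * (2 * w0 * w1))
      + \<sigma> * (1/2 * (r * (x * (w1 + y1) - (w2 + y) * x1)) - 5/2 * (h0 * (r * (x1 * w0 - (w1 + y1) * g0)))
        + 5/4 * ((h0\<^sup>2 + h0) * (r * (g0 * 0 - w0 * 1))) + 5/2 * (1/2 * (h0 * w0))
        - 1/2 * (g2 * w1 + g1 * w2) - 1/2 * (w2 * w0\<^sup>2 + w1 * (2 * w0 * w1))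
        - 5/4 * ((h1 * h1 + h0 * h2) * w0 + (h0 * h1) * w1))
      - (1/4 * (h2 + \<sigma> * w2)\<^sup>2 - 5/4 * ((h0 + \<sigma> * w0) * (h1 + \<sigma> * w1)\<^sup>2) + 5/16 * (h0 + \<sigma> * w0)^4)
    = 1/2 * (r * x\<^sup>2) + 1/2 * (r * (2 * w2 + y) * y) - 1/2 * (h0 * w2\<^sup>2)
      + 5/4 * ((2 * w0\<^sup>2 + d) * d) + 5/2 * (h2 * d)
      - 5/2 * (h0 * (r * x1\<^sup>2 + r * (2 * w1 + y1) * y1 - h0 * w1\<^sup>2))
      + 15/4 * (h0\<^sup>2 * d)
      + \<sigma> * (1/2 * ((3 * g0 * g1 + g0^3 - 3 * g0 * w0\<^sup>2) * w1 + x * y1 - w2 * g0\<^sup>2 - y * x1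
            - h0 * (x * (w1 + y1) - (w2 + y) * x1))
         - e1 * w2
         - 5/2 * (h0 * (- (h0 * (g1 * w0 - w1 * g0 - w0^3)) - r * g0\<^sup>2 * w0))
         - 5/2 * (h0 * (e1 * w0 - w1 * e0)))"
proof -
  have v2: "(h2 + \<sigma> * w2)\<^sup>2 = h2\<^sup>2 + 2 * \<sigma> * h2 * w2 + 2 * w2\<^sup>2"
    and v1: "(h1 + \<sigma> * w1)\<^sup>2 = h1\<^sup>2 + 2 * \<sigma> * h1 * w1 + 2 * w1\<^sup>2"
    and v0: "(h0 + \<sigma> * w0)\<^sup>2 = h0\<^sup>2 + 2 * \<sigma> * h0 * w0 + 2 * w0\<^sup>2"
    by (simp_all add: power2_sum power_mult_distrib s)
  have ss: "\<sigma> * (\<sigma> * z) = 2 * z" for z using s by (simp add: power2_eq_square flip: mult.assoc)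
  have v01: "(h0 + \<sigma> * w0) * (h1\<^sup>2 + 2 * \<sigma> * h1 * w1 + 2 * w1\<^sup>2) =
      h0 * h1\<^sup>2 + 2 * \<sigma> * h0 * h1 * w1 + 2 * h0 * w1\<^sup>2 + \<sigma> * w0 * h1\<^sup>2 + 4 * w0 * h1 * w1 + 2 * \<sigma> * w0 * w1\<^sup>2"
    by (simp add: algebra_simps ss)
  have "(h0 + \<sigma> * w0)^4 = ((h0 + \<sigma> * w0)\<^sup>2)\<^sup>2" by simp
  then have v4: "(h0 + \<sigma> * w0)^4 = h0^4 + 4 * \<sigma> * h0^3 * w0 + 12 * h0\<^sup>2 * w0\<^sup>2 + 8 * \<sigma> * h0 * w0^3 + 4 * w0^4"
    unfolding v0 by (simp add: algebra_simps ss eval_nat_numeral)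
  have 1: "1/2 * (r * (x\<^sup>2 + (w2 + y)\<^sup>2)) - 1/2 * w2\<^sup>2 = 1/2 * (r * x\<^sup>2) + 1/2 * (r * (2 * w2 + y) * y) - 1/2 * (h0 * w2\<^sup>2)"
    unfolding r by (simp add: algebra_simps power2_eq_square)
  have 2: "r * (g0\<^sup>2 + w0\<^sup>2) = w0\<^sup>2 + d" unfolding d_def r by (simp add: algebra_simps)
  have 3: "h0 * (r * (x1\<^sup>2 + (w1 + y1)\<^sup>2)) - h0 * w1\<^sup>2 = h0 * (r * x1\<^sup>2 + r * (2 * w1 + y1) * y1 - h0 * w1\<^sup>2)"
    unfolding r by (simp add: algebra_simps power2_eq_square)
  have 4: "1/2 * (r * (x * (w1 + y1) - (w2 + y) * x1)) - 1/2 * (g2 * w1 + g1 * w2) - 1/2 * (w2 * w0\<^sup>2 + w1 * (2 * w0 * w1))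
     = 1/2 * h2 * w2 - 5/2 * (w0 * w1\<^sup>2) + 1/2 * ((3 * g0 * g1 + g0^3 - 3 * g0 * w0\<^sup>2) * w1 + x * y1 - w2 * g0\<^sup>2 - y * x1
            - h0 * (x * (w1 + y1) - (w2 + y) * x1)) - e1 * w2"
  proof -
    have "r * (x * (w1 + y1) - (w2 + y) * x1) = (x * (w1 + y1) - (w2 + y) * x1) - h0 * (x * (w1 + y1) - (w2 + y) * x1)"
      unfolding r by (simp add: left_diff_distrib)
    moreover have "x * (w1 + y1) - (w2 + y) * x1 = (g2 - 3 * w0 * w1) * w1 - w2 * (g1 - w0\<^sup>2)
       + ((3 * g0 * g1 + g0^3 - 3 * g0 * w0\<^sup>2) * w1 + x * y1 - w2 * g0\<^sup>2 - y * x1)"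
      unfolding x1_def x_def by (simp add: algebra_simps)
    ultimately show ?thesis unfolding e1_def by (simp add: algebra_simps power2_eq_square)
  qed
  have 5: "5/2 * (h0 * (r * (x1 * w0 - (w1 + y1) * g0))) + 5/4 * ((h1 * h1 + h0 * h2) * w0 + (h0 * h1) * w1)
     = 5/4 * (w0 * h1\<^sup>2) + 5/2 * (h0 * h1 * w1) - 5/2 * (h0 * w0^3)
       + 5/2 * (h0 * (- (h0 * (g1 * w0 - w1 * g0 - w0^3)) - r * g0\<^sup>2 * w0)) + 5/2 * (h0 * (e1 * w0 - w1 * e0))"
    unfolding x1_def y1_def e0_def e1_def r by (simp add: algebra_simps power2_eq_square power3_eq_cube)
  \<comment> \<open>The multiple of \<open>p_1\<close> in \<open>p_3\<close> cancels the term
    \<open>h0 w0\<close>, which would be of far too low weight; what survives is the cubic term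
    \<open>h0^3 w0\<close> of the KdV density.\<close>
  have 6: "5/4 * ((h0\<^sup>2 + h0) * (r * (g0 * 0 - w0 * 1))) + 5/2 * (1/2 * (h0 * w0)) = 5/4 * (h0^3 * w0)"
    unfolding r by (simp add: algebra_simps power2_eq_square power3_eq_cube)
  have 7: "(w0\<^sup>2 + d)\<^sup>2 = w0^4 + (2 * w0\<^sup>2 + d) * d"
    by (simp add: algebra_simps power2_eq_square eval_nat_numeral)
  have a: "1/2 * (r * (x\<^sup>2 + (w2 + y)\<^sup>2)) = 1/2 * w2\<^sup>2 + (1/2 * (r * x\<^sup>2) + 1/2 * (r * (2 * w2 + y) * y) - 1/2 * (h0 * w2\<^sup>2))"
    using 1 by simp
  have b: "h0 * (r * (x1\<^sup>2 + (w1 + y1)\<^sup>2)) = h0 * w1\<^sup>2 + h0 * (r * x1\<^sup>2 + r * (2 * w1 + y1) * y1 - h0 * w1\<^sup>2)"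
    using 3 by simp
  \<comment> \<open>The errors \<open>S\<close> and \<open>U\<close> of the momentum part stay
    opaque, so that the final comparison is linear in them.\<close>
  define S where "S = 1/2 * ((3 * g0 * g1 + g0^3 - 3 * g0 * w0\<^sup>2) * w1 + x * y1 - w2 * g0\<^sup>2 - y * x1
            - h0 * (x * (w1 + y1) - (w2 + y) * x1)) - e1 * w2"
  define U where "U = 5/2 * (h0 * (- (h0 * (g1 * w0 - w1 * g0 - w0^3)) - r * g0\<^sup>2 * w0)) + 5/2 * (h0 * (e1 * w0 - w1 * e0))"
  have "1/2 * (r * (x * (w1 + y1) - (w2 + y) * x1)) - 5/2 * (h0 * (r * (x1 * w0 - (w1 + y1) * g0)))
        + 5/4 * ((h0\<^sup>2 + h0) * (r * (g0 * 0 - w0 * 1))) + 5/2 * (1/2 * (h0 * w0))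
        - 1/2 * (g2 * w1 + g1 * w2) - 1/2 * (w2 * w0\<^sup>2 + w1 * (2 * w0 * w1))
        - 5/4 * ((h1 * h1 + h0 * h2) * w0 + (h0 * h1) * w1)
     = 1/2 * h2 * w2 - 5/2 * (w0 * w1\<^sup>2) - 5/4 * (w0 * h1\<^sup>2) - 5/2 * (h0 * h1 * w1) + 5/2 * (h0 * w0^3) + 5/4 * (h0^3 * w0) + (S - U)"
    (is "?l = ?m + (S - U)")
    using 4 5 6 unfolding S_def U_def by linarith
  moreover have "1/2 * ((3 * g0 * g1 + g0^3 - 3 * g0 * w0\<^sup>2) * w1 + x * y1 - w2 * g0\<^sup>2 - y * x1
            - h0 * (x * (w1 + y1) - (w2 + y) * x1))
         - e1 * w2
         - 5/2 * (h0 * (- (h0 * (g1 * w0 - w1 * g0 - w0^3)) - r * g0\<^sup>2 * w0))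
         - 5/2 * (h0 * (e1 * w0 - w1 * e0)) = S - U"
    unfolding S_def U_def by linarith
  ultimately show ?thesis
    unfolding a b 2 7 v1 v2 v01 v4
    by (simp only:) (simp add: algebra_simps power2_eq_square)
qed

text \<open>Linearity of the integral, stated for arbitrary functions so that the concrete
  integrands are not rewritten while it is applied.\<close>

lemma integral_combination3:
  fixes a1 a2 a3 a4 a5 a6 a7 a8 c b1 b2 b3 b4 j1 j2 j4 v1 v2 v3 :: "real \<Rightarrow> real"
  assumes "integrable lborel a1" "integrable lborel a2" "integrable lborel a3" "integrable lborel a4" "integrable lborel a5" "integrable lborel a6" "integrable lborel a7" "integrable lborel a8" "integrable lborel c" "integrable lborel b1" "integrable lborel b2" "integrable lborel b3" "integrable lborel b4" "integrable lborel j1" "integrable lborel j2" "integrable lborel j4" "integrable lborel v1" "integrable lborel v2" "integrable lborel v3"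
  shows "(LBINT x. 1/2 * a1 x + 1/4 * a2 x + 5/4 * a3 x + 5/2 * a4 x - 5/2 * a5 x - 5/4 * a6 x + 15/4 * a7 x + 5/16 * a8 x - 5/2 * c x
      + \<sigma> * (1/2 * b1 x - 5/2 * b2 x + 5/4 * b3 x + 5/2 * (1/2 * b4 x) - 1/2 * j1 x - 1/2 * j2 x - 5/4 * j4 x)
      - (1/4 * v1 x - 5/4 * v2 x + 5/16 * v3 x)) =
      1/2 * (LBINT x. a1 x) + 1/4 * (LBINT x. a2 x) + 5/4 * (LBINT x. a3 x) + 5/2 * (LBINT x. a4 x) - 5/2 * (LBINT x. a5 x) - 5/4 * (LBINT x. a6 x) + 15/4 * (LBINT x. a7 x) + 5/16 * (LBINT x. a8 x) - 5/2 * (LBINT x. c x)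
      + \<sigma> * (1/2 * (LBINT x. b1 x) - 5/2 * (LBINT x. b2 x) + 5/4 * (LBINT x. b3 x) + 5/2 * (1/2 * (LBINT x. b4 x)) - 1/2 * (LBINT x. j1 x) - 1/2 * (LBINT x. j2 x) - 5/4 * (LBINT x. j4 x))
      - (1/4 * (LBINT x. v1 x) - 5/4 * (LBINT x. v2 x) + 5/16 * (LBINT x. v3 x))"
  using assms by simp

context gp_family
begin

lemma integral_by_parts:
  assumes p: "is_primitive (F i) (F' i)" and "B1 m F" "B1 n F'" "i \<in> I"
  shows "(LBINT x. F' i x) = 0"
  by (rule integral_derivative_eq_0[OF p]) (use assms B1_integrable in auto)

lemmas B_rules' = B_rules B1_power3 B1_power4

text \<open>The general rules for inner products ask for a square integrable second factor, but
  \<open>P 0\<close> is merely bounded. The product is therefore computed as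
  \<open>- R w\<close>.\<close>

lemma B2_iP1_P0: "B2 2 (\<lambda>i x. (\<i> * P 1 i x) \<bullet> P 0 i x)"
proof (rule B2_cong)
  show "B2 2 (\<lambda>i x. R i x * (- W 0 i x))"
    by (rule B2_weaken, (rule B_rules Bs_R W0_bounds)+, simp)
  show "R i x * (- W 0 i x) = (\<i> * P 1 i x) \<bullet> P 0 i x" if "i \<in> I" for i x
    unfolding inner_P(1)[OF P_eq(1)[OF that] P0_eq] by simp
qed

lemma kdv_approximation2:
  assumes s: "\<sigma>\<^sup>2 = 2" and k2: "2 \<le> k"
  shows "bigO 8 (\<lambda>i. energy 2 (\<lambda>l. P l i)
     + \<sigma> * (1/2 * (LBINT x. (\<i> * P 2 i x) \<bullet> P 1 i x) - 3/4 * (LBINT x. H 0 i x * ((\<i> * P 1 i x) \<bullet> P 0 i x))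
        - 3/2 * (1/2 * (LBINT x. H 0 i x * W 0 i x)))
     - (1/4 * (LBINT x. (H 1 i x + \<sigma> * W 1 i x)\<^sup>2) - 1/4 * (LBINT x. (H 0 i x + \<sigma> * W 0 i x)^3)))" (is "bigO _ ?l")
proof (rule bigO_integral)
  note at = Bs_level2 Bs_level3[OF k2] B2_level1 B2_level2 B2_level3[OF k2] W0_bounds W1_bounds[OF k2]
    B2_G0 Bs_G0[OF k2] B2_G1[OF k2] Bs_R B2_iP1_P0
  let ?err = "\<lambda>i x. 1/2 * (R i x * (G 1 i x + (G 0 i x)\<^sup>2 - (W 0 i x)\<^sup>2)\<^sup>2)
      + 1/2 * (R i x * (2 * W 1 i x + 2 * G 0 i x * W 0 i x) * (2 * G 0 i x * W 0 i x)) - 1/2 * (H 0 i x * (W 1 i x)\<^sup>2)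
      - 3/2 * (H 0 i x * (R i x * (G 0 i x)\<^sup>2 - H 0 i x * (W 0 i x)\<^sup>2))
      + \<sigma> * (1/2 * (- (H 0 i x * (W 0 i x * G 1 i x - W 1 i x * G 0 i x - (W 0 i x)^3)) - R i x * (G 0 i x)\<^sup>2 * W 0 i x)
         - H 0 i x * G 0 i x * W 1 i x)"
  show "B1 8 ?err"
    by (rule B1_weaken, (rule B_rules at)+, simp)
  fix i assume i: "i \<in> I"
  have int: "integrable lborel (\<lambda>x. (cmod (P 2 i x))\<^sup>2)" "integrable lborel (\<lambda>x. H 0 i x * (cmod (P 1 i x))\<^sup>2)"
    "integrable lborel (\<lambda>x. (H 1 i x)\<^sup>2)" "integrable lborel (\<lambda>x. (H 0 i x)^3)"
    "integrable lborel (\<lambda>x. (\<i> * P 2 i x) \<bullet> P 1 i x)" "integrable lborel (\<lambda>x. H 0 i x * ((\<i> * P 1 i x) \<bullet> P 0 i x))"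
    "integrable lborel (\<lambda>x. H 0 i x * W 0 i x)"
    "integrable lborel (\<lambda>x. (H 1 i x + \<sigma> * W 1 i x)\<^sup>2)" "integrable lborel (\<lambda>x. (H 0 i x + \<sigma> * W 0 i x)^3)"
    "integrable lborel (\<lambda>x. G 1 i x * W 0 i x + G 0 i x * W 1 i x)"
    by (rule B1_integrable[OF _ i], (rule B_rules' B2_norm Bs_norm at)+; fail)+
  have parts: "(LBINT x. G 1 i x * W 0 i x + G 0 i x * W 1 i x) = 0"
  \<comment> \<open>The order 0 is enough here, because only integrability of the product and of its
    derivative matters.\<close>
  proof (rule integral_by_parts[of "\<lambda>i x. G 0 i x * W 0 i x" _ _ 0 0, OF _ _ _ i])
    show "is_primitive (\<lambda>x. G 0 i x * W 0 i x) (\<lambda>x. G 1 i x * W 0 i x + G 0 i x * W 1 i x)"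
      using is_primitive_mult[OF primWG(2)[OF i, of 0] primWG(1)[OF i, of 0]] k2 by simp
  qed (rule B1_weaken, (rule B_rules' at)+, simp; fail)+
  show "?l i = (LBINT x. ?err i x)"
  proof -
    let ?f = "\<lambda>x. 1/2 * (cmod (P 2 i x))\<^sup>2 - 3/2 * (H 0 i x * (cmod (P 1 i x))\<^sup>2)
      + 1/4 * (H 1 i x)\<^sup>2 - 1/4 * (H 0 i x)^3
      + \<sigma> * (1/2 * ((\<i> * P 2 i x) \<bullet> P 1 i x) - 3/4 * (H 0 i x * ((\<i> * P 1 i x) \<bullet> P 0 i x))
         - 3/2 * (1/2 * (H 0 i x * W 0 i x)) - 1/2 * (G 1 i x * W 0 i x + G 0 i x * W 1 i x))
      - (1/4 * (H 1 i x + \<sigma> * W 1 i x)\<^sup>2 - 1/4 * (H 0 i x + \<sigma> * W 0 i x)^3)"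
    have id: "?f x = ?err i x" for x
      unfolding norm_P_sq[OF P_eq(1)[OF i]] norm_P_sq[OF P_eq(2)[OF i]] inner_P(1)[OF P_eq(1)[OF i] P0_eq]
          inner_P(1)[OF P_eq(2)[OF i] P_eq(1)[OF i]]
      by (rule density_identity2[OF s R_eq H_eq(1)[OF i]])
    \<comment> \<open>A vanishing integral is subtracted in order to reach the density on the left
      of \<open>density_identity2\<close>.\<close>
    have "?l i = ?l i - \<sigma> * (1/2 * (LBINT x. G 1 i x * W 0 i x + G 0 i x * W 1 i x))" using parts by simp
    also have "\<dots> = (LBINT x. ?f x)"
      using int by (simp add: energy_def energy2_def) (simp add: algebra_simps)
    also have "\<dots> = (LBINT x. ?err i x)" by (simp only: id)
    finally show ?thesis .
  qed
qed

lemma kdv_approximation3: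
  assumes s: "\<sigma>\<^sup>2 = 2" and k3: "3 \<le> k"
  shows "bigO 10 (\<lambda>i. energy 3 (\<lambda>l. P l i)
     + \<sigma> * (1/2 * (LBINT x. (\<i> * P 3 i x) \<bullet> P 2 i x) - 5/2 * (LBINT x. H 0 i x * ((\<i> * P 2 i x) \<bullet> P 1 i x))
        + 5/4 * (LBINT x. ((H 0 i x)\<^sup>2 + H 0 i x) * ((\<i> * P 1 i x) \<bullet> P 0 i x))
        + 5/2 * (1/2 * (LBINT x. H 0 i x * W 0 i x)))
     - (1/4 * (LBINT x. (H 2 i x + \<sigma> * W 2 i x)\<^sup>2)
        - 5/4 * (LBINT x. (H 0 i x + \<sigma> * W 0 i x) * (H 1 i x + \<sigma> * W 1 i x)\<^sup>2)
        + 5/16 * (LBINT x. (H 0 i x + \<sigma> * W 0 i x)^4)))" (is "bigO _ ?l")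
proof (rule bigO_integral)
  have k2: "2 \<le> k" using k3 by simp
  note at0 = Bs_level2 Bs_level3[OF k2] Bs_level4[OF k3] B2_level1 B2_level2 B2_level3[OF k2] B2_level4[OF k3]
    W0_bounds W1_bounds[OF k2] W2_bounds[OF k3]
    B2_G0 Bs_G0[OF k2] B2_G1[OF k2] Bs_G1[OF k3] B2_G2[OF k3] Bs_R B2_iP1_P0
  \<comment> \<open>The sums \<open>g + eta'/2\<close> and \<open>g' + eta''/2\<close> gain two
    orders over their summands, because \<open>eta' = - 2 (1 - eta) g\<close> makes the leading
    parts cancel. Without this gain the terms with \<open>?e0\<close> and \<open>?e1\<close> would
    be as large as the main ones.\<close>
  have E0: "H 0 i x * G 0 i x = G 0 i x + 1/2 * H 1 i x" if "i \<in> I" for i x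
    unfolding H_eq(1)[OF that] by (simp add: R_eq algebra_simps)
  have E1: "H 0 i x * G 1 i x - 2 * R i x * (G 0 i x)\<^sup>2 = G 1 i x + 1/2 * H 2 i x" if "i \<in> I" for i x
    unfolding H_eq(2)[OF that] by (simp add: R_eq algebra_simps)
  have BE0: "B2 5 (\<lambda>i x. G 0 i x + 1/2 * H 1 i x)"
    by (rule B2_cong[OF _ E0], rule B2_weaken, (rule B_rules at0)+, simp, assumption)
  have BE1: "B2 6 (\<lambda>i x. G 1 i x + 1/2 * H 2 i x)"
    by (rule B2_cong[OF _ E1], rule B2_weaken, (rule B_rules at0)+, simp, assumption)
  have BsE1: "Bs 6 (\<lambda>i x. G 1 i x + 1/2 * H 2 i x)"
    by (rule Bs_cong[OF _ E1], rule Bs_weaken, (rule B_rules at0)+, simp, assumption)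
  note at = BE0 BE1 BsE1 at0
  let ?y = "\<lambda>i x. 3 * (G 0 i x * W 1 i x + W 0 i x * G 1 i x) + 3 * (G 0 i x)\<^sup>2 * W 0 i x - (W 0 i x)^3"
  let ?x' = "\<lambda>i x. 3 * G 0 i x * G 1 i x + (G 0 i x)^3 - 3 * G 0 i x * (W 0 i x)\<^sup>2"
  let ?x = "\<lambda>i x. G 2 i x - 3 * W 0 i x * W 1 i x + ?x' i x"
  let ?x1 = "\<lambda>i x. G 1 i x + (G 0 i x)\<^sup>2 - (W 0 i x)\<^sup>2"
  let ?y1 = "\<lambda>i x. 2 * G 0 i x * W 0 i x"
  let ?d = "\<lambda>i x. R i x * (G 0 i x)\<^sup>2 - H 0 i x * (W 0 i x)\<^sup>2"
  let ?e0 = "\<lambda>i x. G 0 i x + 1/2 * H 1 i x"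
  let ?e1 = "\<lambda>i x. G 1 i x + 1/2 * H 2 i x"
  have y: "B2 6 ?y" by (rule B2_weaken, (rule B_rules at)+, simp)
  have x': "B2 7 ?x'" by (rule B2_weaken, (rule B_rules at)+, simp)
  have x: "B2 5 ?x" by (rule B2_weaken, rule B2_add[OF _ x'], (rule B_rules at)+, simp)
  have x1: "B2 4 ?x1" by (rule B2_weaken, (rule B_rules at)+, simp)
  have y1: "B2 5 ?y1" by (rule B2_weaken, (rule B_rules at)+, simp)
  have d: "B2 6 ?d" by (rule B2_weaken, (rule B_rules at)+, simp)
  let ?err = "\<lambda>i x. 1/2 * (R i x * (?x i x)\<^sup>2) + 1/2 * (R i x * (2 * W 2 i x + ?y i x) * ?y i x) - 1/2 * (H 0 i x * (W 2 i x)\<^sup>2)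
      + 5/4 * ((2 * (W 0 i x)\<^sup>2 + ?d i x) * ?d i x) + 5/2 * (H 2 i x * ?d i x)
      - 5/2 * (H 0 i x * (R i x * (?x1 i x)\<^sup>2 + R i x * (2 * W 1 i x + ?y1 i x) * ?y1 i x - H 0 i x * (W 1 i x)\<^sup>2))
      + 15/4 * ((H 0 i x)\<^sup>2 * ?d i x)
      + \<sigma> * (1/2 * (?x' i x * W 1 i x + ?x i x * ?y1 i x - W 2 i x * (G 0 i x)\<^sup>2 - ?y i x * ?x1 i x
            - H 0 i x * (?x i x * (W 1 i x + ?y1 i x) - (W 2 i x + ?y i x) * ?x1 i x))
         - ?e1 i x * W 2 i x
         - 5/2 * (H 0 i x * (- (H 0 i x * (G 1 i x * W 0 i x - W 1 i x * G 0 i x - (W 0 i x)^3)) - R i x * (G 0 i x)\<^sup>2 * W 0 i x))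
         - 5/2 * (H 0 i x * (?e1 i x * W 0 i x - W 1 i x * ?e0 i x)))"
  \<comment> \<open>Each of the fifteen terms reaches order 10 exactly, for example
    \<open>5 + 5\<close> for the square of \<open>?x\<close>, \<open>4 + 6\<close> for
    \<open>W 2\<close> with \<open>?y\<close>, and \<open>6 + 4\<close> for \<open>?e1\<close> with
    \<open>W 2\<close>.\<close>
  have t1: "B1 10 (\<lambda>i x. R i x * (?x i x)\<^sup>2)"
    by (rule B1_weaken, rule B1_smult[OF Bs_R B1_power2[OF x]], simp)
  have t2: "B1 10 (\<lambda>i x. R i x * (2 * W 2 i x + ?y i x) * ?y i x)"
    by (rule B1_weaken, rule B1_mult[OF B2_mult[OF Bs_R B2_add[OF _ y]] y], (rule B_rules at)+, simp)
  have t3: "B1 10 (\<lambda>i x. H 0 i x * (W 2 i x)\<^sup>2)"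
    by (rule B1_weaken, (rule B_rules at)+, simp)
  have t4: "B1 10 (\<lambda>i x. (2 * (W 0 i x)\<^sup>2 + ?d i x) * ?d i x)"
    by (rule B1_weaken, rule B1_mult[OF B2_add[OF _ d] d], (rule B_rules at)+, simp)
  have t5: "B1 10 (\<lambda>i x. H 2 i x * ?d i x)"
    by (rule B1_weaken, rule B1_mult[OF _ d], (rule B_rules at)+, simp)
  have t6: "B1 10 (\<lambda>i x. H 0 i x * (R i x * (?x1 i x)\<^sup>2 + R i x * (2 * W 1 i x + ?y1 i x) * ?y1 i x - H 0 i x * (W 1 i x)\<^sup>2))"
    by (rule B1_weaken, rule B1_smult[OF Bs_level2(2) B1_diff[OF B1_add[OF B1_smult[OF Bs_R B1_power2[OF x1]]
          B1_mult[OF B2_mult[OF Bs_R B2_add[OF _ y1]] y1]]]], (rule B_rules at)+, simp)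
  have t7: "B1 10 (\<lambda>i x. (H 0 i x)\<^sup>2 * ?d i x)"
    by (rule B1_weaken, rule B1_mult[OF _ d], (rule B_rules at)+, simp)
  have t8: "B1 10 (\<lambda>i x. ?x' i x * W 1 i x)"
    by (rule B1_weaken, rule B1_mult[OF x'], (rule B_rules at)+, simp)
  have t9: "B1 10 (\<lambda>i x. ?x i x * ?y1 i x)"
    by (rule B1_weaken, rule B1_mult[OF x y1], simp)
  have t10: "B1 10 (\<lambda>i x. W 2 i x * (G 0 i x)\<^sup>2)"
    by (rule B1_weaken, (rule B_rules at)+, simp)
  have t11: "B1 10 (\<lambda>i x. ?y i x * ?x1 i x)"
    by (rule B1_weaken, rule B1_mult[OF y x1], simp)
  have t12: "B1 10 (\<lambda>i x. H 0 i x * (?x i x * (W 1 i x + ?y1 i x) - (W 2 i x + ?y i x) * ?x1 i x))"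
    by (rule B1_weaken, rule B1_smult[OF Bs_level2(2) B1_diff[OF B1_mult[OF x B2_add[OF _ y1]] B1_mult[OF B2_add[OF _ y] x1]]],
        (rule at)+, simp)
  have t13: "B1 10 (\<lambda>i x. ?e1 i x * W 2 i x)"
    by (rule B1_weaken, rule B1_mult[OF BE1], (rule at)+, simp)
  have t14: "B1 10 (\<lambda>i x. H 0 i x * (- (H 0 i x * (G 1 i x * W 0 i x - W 1 i x * G 0 i x - (W 0 i x)^3)) - R i x * (G 0 i x)\<^sup>2 * W 0 i x))"
    by (rule B1_weaken, (rule B_rules at)+, simp)
  have t15: "B1 10 (\<lambda>i x. H 0 i x * (?e1 i x * W 0 i x - W 1 i x * ?e0 i x))"
    by (rule B1_weaken, rule B1_mult[OF _ B2_diff[OF B2_mult[OF BsE1] B2_mult[OF _ BE0]]], (rule at)+, simp)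
  show "B1 10 ?err"
    by (rule B1_weaken, rule B1_add B1_diff B1_cmult, 
       (rule t1 t2 t3 t4 t5 t6 t7 t8 t9 t10 t11 t12 t13 t14 t15 B1_cmult B1_diff B1_add)+, simp)
  fix i assume i: "i \<in> I"
  have int: "integrable lborel (\<lambda>x. (cmod (P 3 i x))\<^sup>2)" "integrable lborel (\<lambda>x. (H 2 i x)\<^sup>2)"
    "integrable lborel (\<lambda>x. (cmod (P 1 i x))^4)" "integrable lborel (\<lambda>x. H 2 i x * (cmod (P 1 i x))\<^sup>2)"
    "integrable lborel (\<lambda>x. H 0 i x * (cmod (P 2 i x))\<^sup>2)"
    "integrable lborel (\<lambda>x. H 0 i x * (H 1 i x)\<^sup>2)" "integrable lborel (\<lambda>x. (H 0 i x)\<^sup>2 * (cmod (P 1 i x))\<^sup>2)"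
    "integrable lborel (\<lambda>x. (H 0 i x)^4)"
    "integrable lborel (\<lambda>x. (\<i> * P 3 i x) \<bullet> P 2 i x)" "integrable lborel (\<lambda>x. H 0 i x * ((\<i> * P 2 i x) \<bullet> P 1 i x))"
    "integrable lborel (\<lambda>x. ((H 0 i x)\<^sup>2 + H 0 i x) * ((\<i> * P 1 i x) \<bullet> P 0 i x))"
    "integrable lborel (\<lambda>x. H 0 i x * W 0 i x)"
    "integrable lborel (\<lambda>x. (H 2 i x + \<sigma> * W 2 i x)\<^sup>2)"
    "integrable lborel (\<lambda>x. (H 0 i x + \<sigma> * W 0 i x) * (H 1 i x + \<sigma> * W 1 i x)\<^sup>2)"
    "integrable lborel (\<lambda>x. (H 0 i x + \<sigma> * W 0 i x)^4)"
    by (rule B1_integrable[OF _ i], (rule B_rules' B2_norm Bs_norm at)+; fail)+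
  have j1: "integrable lborel (\<lambda>x. G 2 i x * W 1 i x + G 1 i x * W 2 i x)"
    and j2: "integrable lborel (\<lambda>x. W 2 i x * (W 0 i x)\<^sup>2 + W 1 i x * (2 * W 0 i x * W 1 i x))"
    and j3: "integrable lborel (\<lambda>x. H 2 i x * (W 0 i x)\<^sup>2 + H 1 i x * (2 * W 0 i x * W 1 i x))"
    and j4: "integrable lborel (\<lambda>x. (H 1 i x * H 1 i x + H 0 i x * H 2 i x) * W 0 i x + (H 0 i x * H 1 i x) * W 1 i x)"
    by (rule B1_integrable[OF _ i], (rule B_rules' at)+; fail)+
  have W0: "is_primitive (W 0 i) (W 1 i)" "is_primitive (G 0 i) (G 1 i)"
    using primWG[OF i, of 0] k3 by simp_all
  have W1: "is_primitive (W 1 i) (W 2 i)" "is_primitive (G 1 i) (G 2 i)"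
    using primWG[OF i, of 1] k3 by (simp_all add: numeral_2_eq_2)
  have H0: "is_primitive (H 0 i) (H 1 i)" "is_primitive (H 1 i) (H 2 i)"
    using primH[OF i, of 0] primH[OF i, of 1] k3 by (simp_all add: numeral_2_eq_2)
  have z1: "(LBINT x. G 2 i x * W 1 i x + G 1 i x * W 2 i x) = 0"
    by (rule integral_derivative_eq_0[OF is_primitive_mult[OF W1(2) W1(1)] _ j1],
        rule B1_integrable[OF _ i], (rule B_rules' at)+)
  have z2: "(LBINT x. W 2 i x * (W 0 i x)\<^sup>2 + W 1 i x * (2 * W 0 i x * W 1 i x)) = 0"
  proof (rule integral_derivative_eq_0[OF _ _ j2])
    show "is_primitive (\<lambda>x. W 1 i x * (W 0 i x * W 0 i x)) (\<lambda>x. W 2 i x * (W 0 i x)\<^sup>2 + W 1 i x * (2 * W 0 i x * W 1 i x))"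
      using is_primitive_mult[OF W1(1) is_primitive_mult[OF W0(1) W0(1)]] by (simp add: power2_eq_square mult_ac)
    show "integrable lborel (\<lambda>x. W 1 i x * (W 0 i x * W 0 i x))"
      by (rule B1_integrable[OF _ i], (rule B_rules' at)+)
  qed
  have z3: "(LBINT x. H 2 i x * (W 0 i x)\<^sup>2 + H 1 i x * (2 * W 0 i x * W 1 i x)) = 0"
  proof (rule integral_derivative_eq_0[OF _ _ j3])
    show "is_primitive (\<lambda>x. H 1 i x * (W 0 i x * W 0 i x)) (\<lambda>x. H 2 i x * (W 0 i x)\<^sup>2 + H 1 i x * (2 * W 0 i x * W 1 i x))"
      using is_primitive_mult[OF H0(2) is_primitive_mult[OF W0(1) W0(1)]] by (simp add: power2_eq_square mult_ac)
    show "integrable lborel (\<lambda>x. H 1 i x * (W 0 i x * W 0 i x))"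
      by (rule B1_integrable[OF _ i], (rule B_rules' at)+)
  qed
  have z4: "(LBINT x. (H 1 i x * H 1 i x + H 0 i x * H 2 i x) * W 0 i x + (H 0 i x * H 1 i x) * W 1 i x) = 0"
    by (rule integral_derivative_eq_0[OF is_primitive_mult[OF is_primitive_mult[OF H0] W0(1)] _ j4],
        rule B1_integrable[OF _ i], (rule B_rules' at)+)
  show "?l i = (LBINT x. ?err i x)"
  proof -
    have p4: "((cmod (P 1 i x))\<^sup>2)\<^sup>2 = (cmod (P 1 i x))^4" for x by simp
    let ?f = "\<lambda>x. 1/2 * (cmod (P 3 i x))\<^sup>2 + 1/4 * (H 2 i x)\<^sup>2 + 5/4 * (cmod (P 1 i x))^4
      + 5/2 * (H 2 i x * (cmod (P 1 i x))\<^sup>2) - 5/2 * (H 0 i x * (cmod (P 2 i x))\<^sup>2)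
      - 5/4 * (H 0 i x * (H 1 i x)\<^sup>2) + 15/4 * ((H 0 i x)\<^sup>2 * (cmod (P 1 i x))\<^sup>2) + 5/16 * (H 0 i x)^4
      - 5/2 * (H 2 i x * (W 0 i x)\<^sup>2 + H 1 i x * (2 * W 0 i x * W 1 i x))
      + \<sigma> * (1/2 * ((\<i> * P 3 i x) \<bullet> P 2 i x) - 5/2 * (H 0 i x * ((\<i> * P 2 i x) \<bullet> P 1 i x))
        + 5/4 * (((H 0 i x)\<^sup>2 + H 0 i x) * ((\<i> * P 1 i x) \<bullet> P 0 i x)) + 5/2 * (1/2 * (H 0 i x * W 0 i x))
        - 1/2 * (G 2 i x * W 1 i x + G 1 i x * W 2 i x) - 1/2 * (W 2 i x * (W 0 i x)\<^sup>2 + W 1 i x * (2 * W 0 i x * W 1 i x))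
        - 5/4 * ((H 1 i x * H 1 i x + H 0 i x * H 2 i x) * W 0 i x + (H 0 i x * H 1 i x) * W 1 i x))
      - (1/4 * (H 2 i x + \<sigma> * W 2 i x)\<^sup>2 - 5/4 * ((H 0 i x + \<sigma> * W 0 i x) * (H 1 i x + \<sigma> * W 1 i x)\<^sup>2)
         + 5/16 * (H 0 i x + \<sigma> * W 0 i x)^4)"
    have id: "?f x = ?err i x" for x
      unfolding p4[symmetric] norm_P_sq[OF P_eq(1)[OF i]] norm_P_sq[OF P_eq(2)[OF i]] norm_P_sq[OF P_eq(3)[OF i]]
          inner_P(1)[OF P_eq(1)[OF i] P0_eq] inner_P(1)[OF P_eq(2)[OF i] P_eq(1)[OF i]]
          inner_P(1)[OF P_eq(3)[OF i] P_eq(2)[OF i]]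
      by (rule density_identity3[OF s R_eq])
    \<comment> \<open>The four integrals that vanish by parts are subtracted with the coefficients
      prescribed by \<open>density_identity3\<close>.\<close>
    have "?l i = ?l i - 5/2 * (LBINT x. H 2 i x * (W 0 i x)\<^sup>2 + H 1 i x * (2 * W 0 i x * W 1 i x))
      - \<sigma> * (1/2 * (LBINT x. G 2 i x * W 1 i x + G 1 i x * W 2 i x)
         + 1/2 * (LBINT x. W 2 i x * (W 0 i x)\<^sup>2 + W 1 i x * (2 * W 0 i x * W 1 i x))
         + 5/4 * (LBINT x. (H 1 i x * H 1 i x + H 0 i x * H 2 i x) * W 0 i x + (H 0 i x * H 1 i x) * W 1 i x))"
      by (simp only: z1 z2 z3 z4)  simp
    also have "\<dots> = (LBINT x. ?f x)"
      unfolding integral_combination3[OF int(1) int(2) int(3) int(4) int(5) int(6) int(7) int(8) j3 int(9) int(10) int(11) int(12) j1 j2 j4 int(13) int(14) int(15)]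
      unfolding energy_def energy3_def z1 z2 z3 z4 by simp
    also have "\<dots> = (LBINT x. ?err i x)" by (simp only: id)
    finally show ?thesis .
  qed
qed

end

section \<open>One constant for all admissible data\<close>

text \<open>The counterpart of \<open>energy\<close> for the momenta, with the imaginary part of
  \<open>q\<close> in the place of the derivative of the phase.\<close>

definition momentum :: "nat \<Rightarrow> (nat \<Rightarrow> real \<Rightarrow> complex) \<Rightarrow> real" where
  "momentum k p =
     (if k = 1 then 1/2 * (LBINT x. eta_deriv 0 p x * Im (log_deriv 0 p x))
      else if k = 2 then
        1/2 * (LBINT x. (\<i> * p 2 x) \<bullet> p 1 x) - 3/4 * (LBINT x. eta_deriv 0 p x * ((\<i> * p 1 x) \<bullet> p 0 x))
        - 3/2 * (1/2 * (LBINT x. eta_deriv 0 p x * Im (log_deriv 0 p x)))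
      else
        1/2 * (LBINT x. (\<i> * p 3 x) \<bullet> p 2 x) - 5/2 * (LBINT x. eta_deriv 0 p x * ((\<i> * p 2 x) \<bullet> p 1 x))
        + 5/4 * (LBINT x. ((eta_deriv 0 p x)\<^sup>2 + eta_deriv 0 p x) * ((\<i> * p 1 x) \<bullet> p 0 x))
        + 5/2 * (1/2 * (LBINT x. eta_deriv 0 p x * Im (log_deriv 0 p x))))"

definition kdv_arg :: "real \<Rightarrow> nat \<Rightarrow> (nat \<Rightarrow> real \<Rightarrow> complex) \<Rightarrow> real \<Rightarrow> real" where
  "kdv_arg \<sigma> j p x = eta_deriv j p x + \<sigma> * Im (log_deriv j p x)"

text \<open>The KdV invariants of the rescaled function, up to the factor \<open>18 / \<epsilon>\<^sup>2\<^sup>k\<^sup>+\<^sup>1\<close>.\<close>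

definition kdv_limit :: "nat \<Rightarrow> real \<Rightarrow> (nat \<Rightarrow> real \<Rightarrow> complex) \<Rightarrow> real" where
  "kdv_limit k \<sigma> p =
     (if k = 1 then 1/4 * (LBINT x. (kdv_arg \<sigma> 0 p x)\<^sup>2)
      else if k = 2 then 1/4 * (LBINT x. (kdv_arg \<sigma> 1 p x)\<^sup>2) - 1/4 * (LBINT x. (kdv_arg \<sigma> 0 p x)^3)
      else 1/4 * (LBINT x. (kdv_arg \<sigma> 2 p x)\<^sup>2)
        - 5/4 * (LBINT x. kdv_arg \<sigma> 0 p x * (kdv_arg \<sigma> 1 p x)\<^sup>2)
        + 5/16 * (LBINT x. (kdv_arg \<sigma> 0 p x)^4))"

text \<open>The largest index set over which \<open>gp_family\<close> can be interpreted: all pairs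
  of a scale and a chain of representatives that are admissible for \<open>A\<close> and
  \<open>k\<close>. A constant uniform over it depends on \<open>A\<close>, \<open>k\<close> and
  \<open>\<sigma>\<close> alone.\<close>

definition gp_data :: "real \<Rightarrow> nat \<Rightarrow> (real \<times> (nat \<Rightarrow> real \<Rightarrow> complex)) set" where
  "gp_data A k = {(\<epsilon>, p). 0 < \<epsilon> \<and> \<epsilon> * (1 + 5 * A) < 1 \<and> (\<forall>j\<le>k. is_primitive (p j) (p (Suc j))) \<and>
     (\<forall>j. 1 \<le> j \<and> j \<le> Suc k \<longrightarrow> integrable lborel (\<lambda>x. (cmod (p j x))\<^sup>2)) \<and>
     integrable lborel (\<lambda>x. (eta_deriv 0 p x)\<^sup>2) \<and>
     (\<forall>j. 1 \<le> j \<and> j \<le> Suc k \<longrightarrow> 18 / \<epsilon> ^ (2 * j + 1) * energy j p \<le> A)}"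

lemma gp_family_gp_data:
  assumes A: "0 < A" and k: "1 \<le> k" "k \<le> 3"
  shows "gp_family (gp_data A k) fst (\<lambda>j i. snd i j) k A"
proof
  show "fst i \<le> 1" if "i \<in> gp_data A k" for i
  proof -
    have "0 < fst i" "fst i * (1 + 5 * A) < 1" using that by (auto simp: gp_data_def)
    moreover have "fst i * 1 \<le> fst i * (1 + 5 * A)" using \<open>0 < fst i\<close> A by (intro mult_left_mono) auto
    ultimately show ?thesis by linarith
  qed
qed (use A k in \<open>auto simp: gp_data_def\<close>)

lemma kdv_approximation:
  assumes A: "0 < A" and k: "1 \<le> k" "k \<le> 3" and s: "\<sigma>\<^sup>2 = 2"
  obtains C where "C \<ge> 0" "\<And>\<epsilon> p. (\<epsilon>, p) \<in> gp_data A k \<Longrightarrow>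
    \<bar>energy k p + \<sigma> * momentum k p - kdv_limit k \<sigma> p\<bar> \<le> C * \<epsilon> ^ (2 * k + 3)"
proof -
  interpret gp_family "gp_data A k" fst "\<lambda>j i. snd i j" k A
    by (rule gp_family_gp_data[OF A k])
  \<comment> \<open>One power is the weight built into \<open>bigO\<close>; after division by the
    scale the exponent is \<open>2 * k + 3\<close>.\<close>
  have "bigO (2 * k + 4) (\<lambda>i. energy k (snd i) + \<sigma> * momentum k (snd i) - kdv_limit k \<sigma> (snd i))"
  proof -
    consider "k = 1" | "k = 2" | "k = 3" using k by linarith
    then show ?thesis
    proof cases
      case 1
      then show ?thesis using kdv_approximation1[OF s]
        by (simp add: momentum_def kdv_limit_def kdv_arg_def W_def)
    next
      case 2
      then show ?thesis using kdv_approximation2[OF s]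
        by (simp add: momentum_def kdv_limit_def kdv_arg_def W_def)
    next
      case 3
      then show ?thesis using kdv_approximation3[OF s]
        by (simp add: momentum_def kdv_limit_def kdv_arg_def W_def)
    qed
  qed
  then obtain C where C: "C \<ge> 0" "\<And>i. i \<in> gp_data A k \<Longrightarrow>
      fst i * \<bar>energy k (snd i) + \<sigma> * momentum k (snd i) - kdv_limit k \<sigma> (snd i)\<bar> \<le> C * fst i ^ (2 * k + 4)"
    unfolding bigO_def by blast
  show ?thesis
  proof (rule that[OF C(1)])
    fix \<epsilon> p assume i: "(\<epsilon>, p) \<in> gp_data A k"
    have e: "\<epsilon> > 0" using e_pos[OF i] by simp
    have "\<epsilon> * \<bar>energy k p + \<sigma> * momentum k p - kdv_limit k \<sigma> p\<bar> \<le> \<epsilon> * (C * \<epsilon> ^ (2 * k + 3))"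
      using C(2)[OF i] by (simp add: power_add eval_nat_numeral mult_ac)
    then show "\<bar>energy k p + \<sigma> * momentum k p - kdv_limit k \<sigma> p\<bar> \<le> C * \<epsilon> ^ (2 * k + 3)"
      using e by simp
  qed
qed

section \<open>The phase and the change of scale\<close>

lemma is_primitive_cong_AE:
  assumes p: "is_primitive u v" and ae: "AE x in lborel. v x = v' x" and v': "locally_integrable v'"
  shows "is_primitive u v'"
  unfolding is_primitive_def
proof (intro conjI allI impI v')
  fix a b :: real assume "a \<le> b"
  have "(LBINT x:{a..b}. v x) = (LBINT x:{a..b}. v' x)"
    by (rule set_lebesgue_integral_cong_AE)
       (use ae locally_integrable_borel[OF v'] locally_integrable_borel[OF is_primitive_locally_integrable[OF p]]
        in \<open>auto elim: AE_mp\<close>)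
  then show "u b - u a = (LBINT x:{a..b}. v' x)"
    using is_primitive_eq[OF p \<open>a \<le> b\<close>] by simp
qed

lemma has_weak_deriv_weak_deriv: "has_weak_deriv u v \<Longrightarrow> has_weak_deriv u (weak_deriv u)"
  unfolding weak_deriv_def by (rule someI[of "has_weak_deriv u"])

lemma continuous_eq_if_AE_eq:
  fixes f g :: "real \<Rightarrow> 'a::real_normed_vector"
  assumes f: "continuous_on UNIV f" and g: "continuous_on UNIV g" and ae: "AE x in lborel. f x = g x"
  shows "f x = g x"
proof -
  have o: "open {x. f x \<noteq> g x}"
    by (intro open_Collect_neq f g)
  have "{x. f x \<noteq> g x} \<in> null_sets lborel"
    using ae o by (simp add: AE_iff_null_sets)
  then have "negligible {x. f x \<noteq> g x}"
    using null_sets_completionI negligible_iff_null_sets by blast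
  then have "{x. f x \<noteq> g x} = {}" using o open_not_negligible by blast
  then show ?thesis by blast
qed

text \<open>Let \<open>L\<close> be a primitive of \<open>v / u\<close>. Then
  \<open>u exp (- L)\<close> is constant, so the imaginary part of \<open>L\<close> is a phase of
  \<open>u\<close> up to a constant. Two phases differ by values in a discrete set, and continuity
  is all that is known of \<open>\<phi>\<close>, but it forces the difference to be
  constant.\<close>

lemma phase_primitive:
  fixes u v :: "real \<Rightarrow> complex" and \<phi> :: "real \<Rightarrow> real"
  assumes u: "is_primitive u v" and v: "continuous_on UNIV v" and nz: "\<And>x. u x \<noteq> 0"
    and \<phi>: "continuous_on UNIV \<phi>"
    and eq: "\<And>x. u x = complex_of_real (cmod (u x)) * exp (\<i> * complex_of_real (\<phi> x))"
  shows "is_primitive \<phi> (\<lambda>x. Im (v x * inverse (u x)))"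
proof -
  define q where "q x = v x * inverse (u x)" for x
  have cq: "continuous_on UNIV q"
    unfolding q_def using is_primitive_continuous[OF u] v nz by (intro continuous_intros) auto
  obtain L where L: "is_primitive L q"
    using is_primitive_integral[OF locally_integrable_continuous[OF cq]] by blast
  have dL: "(L has_vector_derivative q x) (at x)" for x
    by (rule is_primitive_has_vector_derivative[OF L cq])
  have "((\<lambda>x. u x * exp (- L x)) has_vector_derivative 0) (at x)" for x
  proof -
    have "((\<lambda>x. exp (- L x)) has_vector_derivative (- q x) * exp (- L x)) (at x)"
      using field_vector_diff_chain_at[of "\<lambda>x. - L x" "- q x" x exp "exp (- L x)"] dL[of x]
      by (auto simp: o_def intro!: derivative_eq_intros)
    then have "((\<lambda>x. u x * exp (- L x)) has_vector_derivative (u x * ((- q x) * exp (- L x)) + v x * exp (- L x))) (at x)"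
      by (rule has_vector_derivative_mult[OF is_primitive_has_vector_derivative[OF u v]])
    moreover have "u x * ((- q x) * exp (- L x)) + v x * exp (- L x) = 0"
      using nz[of x] by (simp add: q_def)
    ultimately show ?thesis by simp
  qed
  then have "\<exists>c. \<forall>x\<in>UNIV. u x * exp (- L x) = c"
    by (intro has_derivative_zero_constant) (auto simp: has_vector_derivative_def)
  then obtain c where c: "\<And>x. u x * exp (- L x) = c" by auto
  have uc: "u x = c * exp (L x)" for x
    using c[of x] by (simp add: exp_minus field_simps)
  have c0: "c \<noteq> 0" using uc nz by fastforce
  define f where "f x = \<phi> x - Im (L x)" for x
  have expf: "exp (\<i> * complex_of_real (f x)) = c / complex_of_real (cmod c)" for x
  proof -
    have "complex_of_real (cmod (u x)) = complex_of_real (cmod c) * exp (complex_of_real (Re (L x)))"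
      by (simp add: uc norm_mult exp_of_real)
    then have "c * exp (L x) = complex_of_real (cmod c) * exp (complex_of_real (Re (L x))) * exp (\<i> * complex_of_real (\<phi> x))"
      using eq[of x] uc[of x] by simp
    also have "exp (L x) = exp (complex_of_real (Re (L x))) * exp (\<i> * complex_of_real (Im (L x)))"
      by (simp add: exp_add[symmetric] complex_eq[symmetric])
    finally have eq2: "c * exp (\<i> * complex_of_real (Im (L x))) = complex_of_real (cmod c) * exp (\<i> * complex_of_real (\<phi> x))"
      by (simp add: mult_ac)
    have fe: "exp (\<i> * complex_of_real (f x)) = exp (\<i> * complex_of_real (\<phi> x)) / exp (\<i> * complex_of_real (Im (L x)))"
      by (simp add: f_def exp_diff[symmetric] right_diff_distrib)
    have "exp (\<i> * complex_of_real (f x)) * exp (\<i> * complex_of_real (Im (L x))) = exp (\<i> * complex_of_real (\<phi> x))"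
      unfolding fe by simp
    with eq2 have "(complex_of_real (cmod c) * exp (\<i> * complex_of_real (f x))) * exp (\<i> * complex_of_real (Im (L x)))
        = c * exp (\<i> * complex_of_real (Im (L x)))"
      by (simp only: mult.assoc)
    then have "complex_of_real (cmod c) * exp (\<i> * complex_of_real (f x)) = c"
      by (simp only: mult_cancel_right exp_not_eq_zero) simp
    then show ?thesis using c0 by (simp add: field_simps)
  qed
  have cf: "continuous_on UNIV f"
    unfolding f_def by (intro continuous_intros \<phi> is_primitive_continuous[OF L])
  \<comment> \<open>By \<open>expf\<close> the exponential of \<open>\<i> f\<close> does not depend
    on the point, so distinct values of \<open>f\<close> are at least \<open>2 * pi\<close> apart; a
    continuous function on the connected line cannot jump.\<close>
  have "f constant_on UNIV"
  proof (rule continuous_discrete_range_constant[OF connected_UNIV cf])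
    fix x :: real
    have "2 * pi \<le> norm (f y - f x)" if "f y \<noteq> f x" for y
    proof -
      have "exp (\<i> * complex_of_real (f y)) = exp (\<i> * complex_of_real (f x))" by (simp add: expf)
      then obtain n :: int where "\<i> * complex_of_real (f y) = \<i> * complex_of_real (f x) + complex_of_real (of_int (2 * n) * pi) * \<i>"
        unfolding exp_eq by blast
      then have "\<i> * complex_of_real (f y) = \<i> * complex_of_real (f x + of_int (2 * n) * pi)"
        by (simp add: algebra_simps)
      then have n: "f y - f x = of_int (2 * n) * pi"
        by (simp only: mult_cancel_left of_real_eq_iff) simp
      then have "n \<noteq> 0" using that by auto
      then have "1 \<le> \<bar>real_of_int n\<bar>" by linarith
      then show ?thesis unfolding n by (simp add: abs_mult)
    qed
    then show "\<exists>e>0. \<forall>y. y \<in> UNIV \<and> f y \<noteq> f x \<longrightarrow> e \<le> norm (f y - f x)"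
      by (intro exI[of _ "2 * pi"]) auto
  qed
  then obtain d where d: "\<And>x. f x = d" by (auto simp: constant_on_def)
  have "is_primitive (\<lambda>x. Im (L x) + d) (\<lambda>x. Im (q x) + 0)"
    by (intro is_primitive_add is_primitive_const is_primitive_Im L)
  moreover have "Im (L x) + d = \<phi> x" for x using d[of x] by (simp add: f_def)
  ultimately show ?thesis by (simp add: q_def[abs_def])
qed

lemma is_primitive_scale:
  fixes u v :: "real \<Rightarrow> real"
  assumes p: "is_primitive u v" and c: "c > 0"
  shows "is_primitive (\<lambda>x. r * u (x / c)) (\<lambda>x. r / c * v (x / c))"
proof -
  note v = locally_integrableD[OF is_primitive_locally_integrable[OF p]]
  have ind: "indicator {a / c..b / c} (x / c) = (indicator {a..b} x :: real)" for a b x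
    using c by (auto simp: indicator_def divide_le_cancel)
  have int: "set_integrable lborel {a..b} (\<lambda>x. v (x / c))" for a b
    using lborel_integrable_real_affine[OF v[of "a / c" "b / c", unfolded set_integrable_def], of "1 / c" 0] c
    by (simp add: set_integrable_def ind)
  have I: "(LBINT x:{a..b}. v (x / c)) = c * (LBINT x:{a / c..b / c}. v x)" for a b
    using lborel_integral_real_affine[of "1 / c" "\<lambda>x. indicator {a / c..b / c} x *\<^sub>R v x" 0] c
    by (simp add: set_lebesgue_integral_def ind field_simps)
  show ?thesis
    unfolding is_primitive_def
  proof (intro conjI allI impI)
    show "locally_integrable (\<lambda>x. r / c * v (x / c))"
      unfolding locally_integrable_def using int by simp
    fix a b :: real assume "a \<le> b"
    then have "a / c \<le> b / c" using c by (simp add: divide_right_mono)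
    have "(LBINT x:{a..b}. r / c * v (x / c)) = r / c * (c * (LBINT x:{a / c..b / c}. v x))"
      using I by simp
    then show "r * u (b / c) - r * u (a / c) = (LBINT x:{a..b}. r / c * v (x / c))"
      using is_primitive_eq[OF p \<open>a / c \<le> b / c\<close>] c by (simp add: right_diff_distrib)
  qed
qed

lemma integral_scale:
  fixes f :: "real \<Rightarrow> real"
  assumes "c > 0"
  shows "(LBINT x. f (x / c)) = c * (LBINT x. f x)"
  using lborel_integral_real_affine[of "1 / c" f 0] assms by (simp add: field_simps)

section \<open>Return to the original variables\<close>

text \<open>Each weak derivative equals almost everywhere a primitive of the chosen next one.
  Exchanging that next one for its own representative, which does not affect integrals, yields a
  chain in which every member is a primitive of its successor.\<close>

lemma X_space_representative:
  assumes \<Psi>: "\<Psi> \<in> X_space (k + 1)"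
  obtains p where "\<And>j. j \<le> k \<Longrightarrow> is_primitive (p j) (p (Suc j))"
    "\<And>j. j \<le> Suc k \<Longrightarrow> AE x in lborel. wD j \<Psi> x = p j x"
    "\<And>j. j \<le> Suc k \<Longrightarrow> wD j \<Psi> \<in> borel_measurable borel"
    "\<And>j. 1 \<le> j \<Longrightarrow> j \<le> Suc k \<Longrightarrow> integrable lborel (\<lambda>x. (cmod (p j x))\<^sup>2)"
    "integrable lborel (\<lambda>x. (eta_deriv 0 p x)\<^sup>2)"
proof -
  have l\<Psi>: "locally_integrable \<Psi>" and fin: "finite_GL_energy \<Psi>" and sob: "wD 1 \<Psi> \<in> sobolev_H k"
    using \<Psi> by (auto simp: X_space_def)
  have sh: "wD j (wD 1 \<Psi>) = wD (Suc j) \<Psi>" for j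
    by (simp add: funpow_swap1)
  have sobP: "(\<forall>j\<le>k. square_integrable (wD (Suc j) \<Psi>)) \<and> (\<forall>j<k. \<exists>v. has_weak_deriv (wD (Suc j) \<Psi>) v)"
    using sob by (simp only: sobolev_H_def mem_Collect_eq sh)
  have w: "has_weak_deriv (wD j \<Psi>) (wD (Suc j) \<Psi>)" if "j \<le> k" for j
  proof -
    have "\<exists>v. has_weak_deriv (wD j \<Psi>) v"
    proof (cases j)
      case 0 then show ?thesis using fin by (simp add: finite_GL_energy_def)
    next
      case (Suc l)
      then show ?thesis using sobP that by (auto simp del: funpow.simps)
    qed
    then show ?thesis using has_weak_deriv_weak_deriv by auto
  qed
  have loc: "locally_integrable (wD j \<Psi>)" if "j \<le> Suc k" for j
    using w[of "j - 1"] that l\<Psi> by (cases j) (auto simp: has_weak_deriv_def)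
  have m: "wD j \<Psi> \<in> borel_measurable borel" if "j \<le> Suc k" for j
    by (rule locally_integrable_borel[OF loc[OF that]])
  have "\<exists>U. is_primitive U (wD (Suc j) \<Psi>) \<and> (AE x in lborel. wD j \<Psi> x = U x)" if "j \<le> k" for j
    using weak_deriv_imp_is_primitive[OF w[OF that]] by metis
  then obtain U where U: "\<And>j. j \<le> k \<Longrightarrow> is_primitive (U j) (wD (Suc j) \<Psi>)"
    "\<And>j. j \<le> k \<Longrightarrow> AE x in lborel. wD j \<Psi> x = U j x" by metis
  \<comment> \<open>The top derivative has no further weak derivative at its disposal and therefore
    keeps the chosen representative.\<close>
  define p where "p j = (if j \<le> k then U j else wD (Suc k) \<Psi>)" for j
  have ae: "AE x in lborel. wD j \<Psi> x = p j x" if "j \<le> Suc k" for j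
    using U(2)[of j] that by (cases "j \<le> k") (auto simp: p_def le_Suc_eq)
  have pl: "locally_integrable (p j)" if "j \<le> Suc k" for j
    using that loc[of "Suc k"] locally_integrable_continuous[OF is_primitive_continuous[OF U(1)]]
    by (auto simp: p_def)
  have pm: "p j \<in> borel_measurable borel" if "j \<le> Suc k" for j
    by (rule locally_integrable_borel[OF pl[OF that]])
  show ?thesis
  proof (rule that)
    show "is_primitive (p j) (p (Suc j))" if "j \<le> k" for j
      using is_primitive_cong_AE[OF U(1)[OF that] ae[of "Suc j"] pl[of "Suc j"]] that by (simp add: p_def)
    show "AE x in lborel. wD j \<Psi> x = p j x" "wD j \<Psi> \<in> borel_measurable borel" if "j \<le> Suc k" for j
      using ae[OF that] m[OF that] by auto
    show "integrable lborel (\<lambda>x. (cmod (p j x))\<^sup>2)" if j: "1 \<le> j" "j \<le> Suc k" for j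
    proof -
      obtain l where l: "j = Suc l" "l \<le> k" using j by (cases j) auto
      have "square_integrable (wD j \<Psi>)"
        using sobP l by blast
      then have "integrable lborel (\<lambda>x. (cmod (wD j \<Psi> x))\<^sup>2)" by (simp add: square_integrable_def)
      then show ?thesis
        by (rule integrable_cong_AE_imp) (use ae[OF j(2)] pm[OF j(2)] in \<open>auto elim: AE_mp\<close>)
    qed
    have "integrable lborel (\<lambda>x. (1 - (cmod (\<Psi> x))\<^sup>2)\<^sup>2)"
      using fin by (simp add: finite_GL_energy_def)
    then show "integrable lborel (\<lambda>x. (eta_deriv 0 p x)\<^sup>2)"
      by (rule integrable_cong_AE_imp) (use ae[of 0] pm[of 0] in \<open>auto simp: eta_deriv_def elim: AE_mp\<close>)
  qed
qed

text \<open>These reduce an equation between two linear combinations of integrals to equations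
  between corresponding integrals.\<close>

lemmas cong_rules = arg_cong2[where f = "(+) :: real \<Rightarrow> _"] arg_cong2[where f = "(-) :: real \<Rightarrow> _"]
  arg_cong2[where f = "(*) :: real \<Rightarrow> _"]

context
  fixes \<Psi> :: "real \<Rightarrow> complex" and p :: "nat \<Rightarrow> real \<Rightarrow> complex" and k :: nat
  assumes k: "1 \<le> k" "k \<le> 3"
    and prim: "\<And>j. j \<le> k \<Longrightarrow> is_primitive (p j) (p (Suc j))"
    and aeP: "\<And>j. j \<le> Suc k \<Longrightarrow> AE x in lborel. wD j \<Psi> x = p j x"
    and mP: "\<And>j. j \<le> Suc k \<Longrightarrow> wD j \<Psi> \<in> borel_measurable borel"
begin

lemma eta_borel: "eta \<Psi> \<in> borel_measurable borel"
  using mP[of 0] unfolding eta_def[abs_def] by simp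

lemma p_borel: "j \<le> Suc k \<Longrightarrow> p j \<in> borel_measurable borel"
  using is_primitive_borel[OF prim, of j] locally_integrable_borel[OF is_primitive_locally_integrable[OF prim[of k]]]
  by (cases "j \<le> k") (auto simp: le_Suc_eq)

lemma eta_AE:
  assumes "j \<le> k"
  shows "AE x in lborel. wD j (eta \<Psi>) x = eta_deriv j p x" "wD j (eta \<Psi>) \<in> borel_measurable borel"
    "eta_deriv j p \<in> borel_measurable borel"
proof -
  have pr: "is_primitive (eta_deriv l p) (eta_deriv (Suc l) p)" if "l < j" for l
    using assms that k by (intro eta_deriv_primitive prim) auto
  have "AE x in lborel. eta \<Psi> x = eta_deriv 0 p x"
    using aeP[of 0] by (auto simp: eta_def eta_deriv_def elim: AE_mp)
  from wD_AE[where U = "\<lambda>j. eta_deriv j p", OF eta_borel this pr, of j]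
  show "AE x in lborel. wD j (eta \<Psi>) x = eta_deriv j p x" "wD j (eta \<Psi>) \<in> borel_measurable borel" by auto
  show "eta_deriv j p \<in> borel_measurable borel"
  proof (cases j)
    case 0
    then show ?thesis using p_borel[of 0] by (simp add: eta_deriv_def[abs_def])
  next
    case (Suc l)
    then show ?thesis
      using locally_integrable_borel[OF is_primitive_locally_integrable[OF pr[of l]]] by simp
  qed
qed

text \<open>The invariant of index \<open>j\<close> contains derivatives of \<open>eta\<close> only
  up to order \<open>j - 1\<close>, hence within the range covered by \<open>eta_AE\<close>, so
  corresponding integrands agree almost everywhere.\<close>

lemma GP_E_eq:
  assumes j: "1 \<le> j" "j \<le> Suc k"
  shows "GP_E j \<Psi> = energy j p"
proof -
  consider "j = 1" | "j = 2" | "j = 3" | "j = 4" using j k by linarith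
  then show ?thesis
  proof cases
    case 1
    have [measurable]: "wD 1 \<Psi> \<in> borel_measurable borel" "p 1 \<in> borel_measurable borel"
      "eta_deriv 0 p \<in> borel_measurable borel" "\<Psi> \<in> borel_measurable borel"
      using mP[of 0] mP[of 1] p_borel[of 1] eta_AE(3)[of 0] by auto
    have ae: "AE x in lborel. wD 1 \<Psi> x = p 1 x \<and> 1 - (cmod (\<Psi> x))\<^sup>2 = eta_deriv 0 p x"
      using aeP[of 1] eta_AE(1)[of 0] by (auto simp: eta_def)
    have "GL_energy \<Psi> = energy1 p"
      unfolding GL_energy_def energy1_def
      by (intro refl cong_rules integral_cong_AE; ((rule eventually_mono[OF ae], simp only:) | measurable))
    then show ?thesis using 1 by (simp add: GP_E_def energy_def)
  next
    case 2
    have [measurable]: "wD 1 \<Psi> \<in> borel_measurable borel" "p 1 \<in> borel_measurable borel"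
      "wD 2 \<Psi> \<in> borel_measurable borel" "p 2 \<in> borel_measurable borel"
      "eta_deriv 0 p \<in> borel_measurable borel" "eta \<Psi> \<in> borel_measurable borel"
      "eta_deriv 1 p \<in> borel_measurable borel" "wD 1 (eta \<Psi>) \<in> borel_measurable borel"
      using 2 j by (intro mP p_borel eta_AE eta_borel; simp)+
    have ae: "AE x in lborel. wD 1 \<Psi> x = p 1 x \<and> wD 2 \<Psi> x = p 2 x \<and> eta \<Psi> x = eta_deriv 0 p x \<and>
        wD 1 (eta \<Psi>) x = eta_deriv 1 p x"
      using 2 j aeP[of 1] aeP[of 2] eta_AE(1)[of 0] eta_AE(1)[of 1] by simp
    have "GP_E2 \<Psi> = energy2 p"
      unfolding GP_E2_def energy2_def
      by (intro refl cong_rules integral_cong_AE; ((rule eventually_mono[OF ae], simp only:) | measurable))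
    then show ?thesis using 2 by (simp add: GP_E_def energy_def)
  next
    case 3
    have [measurable]: "wD 1 \<Psi> \<in> borel_measurable borel" "p 1 \<in> borel_measurable borel"
      "wD 2 \<Psi> \<in> borel_measurable borel" "p 2 \<in> borel_measurable borel"
      "wD 3 \<Psi> \<in> borel_measurable borel" "p 3 \<in> borel_measurable borel"
      "eta_deriv 0 p \<in> borel_measurable borel" "eta \<Psi> \<in> borel_measurable borel"
      "eta_deriv 1 p \<in> borel_measurable borel" "wD 1 (eta \<Psi>) \<in> borel_measurable borel"
      "eta_deriv 2 p \<in> borel_measurable borel" "wD 2 (eta \<Psi>) \<in> borel_measurable borel"
      using 3 j by (intro mP p_borel eta_AE eta_borel; simp)+
    have ae: "AE x in lborel. wD 1 \<Psi> x = p 1 x \<and> wD 2 \<Psi> x = p 2 x \<and> wD 3 \<Psi> x = p 3 x \<and> eta \<Psi> x = eta_deriv 0 p x \<and>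
        wD 1 (eta \<Psi>) x = eta_deriv 1 p x \<and> wD 2 (eta \<Psi>) x = eta_deriv 2 p x"
      using 3 j aeP[of 1] aeP[of 2] aeP[of 3] eta_AE(1)[of 0] eta_AE(1)[of 1] eta_AE(1)[of 2] by simp
    have "GP_E3 \<Psi> = energy3 p"
      unfolding GP_E3_def energy3_def
      by (intro refl cong_rules integral_cong_AE; ((rule eventually_mono[OF ae], simp only:) | measurable))
    then show ?thesis using 3 by (simp add: GP_E_def energy_def)
  next
    case 4
    have [measurable]: "wD 1 \<Psi> \<in> borel_measurable borel" "p 1 \<in> borel_measurable borel"
      "wD 2 \<Psi> \<in> borel_measurable borel" "p 2 \<in> borel_measurable borel"
      "wD 3 \<Psi> \<in> borel_measurable borel" "p 3 \<in> borel_measurable borel"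
      "wD 4 \<Psi> \<in> borel_measurable borel" "p 4 \<in> borel_measurable borel"
      "eta_deriv 0 p \<in> borel_measurable borel" "eta \<Psi> \<in> borel_measurable borel"
      "eta_deriv 1 p \<in> borel_measurable borel" "wD 1 (eta \<Psi>) \<in> borel_measurable borel"
      "eta_deriv 2 p \<in> borel_measurable borel" "wD 2 (eta \<Psi>) \<in> borel_measurable borel"
      "eta_deriv 3 p \<in> borel_measurable borel" "wD 3 (eta \<Psi>) \<in> borel_measurable borel"
      using 4 j by (intro mP p_borel eta_AE eta_borel; simp)+
    have ae: "AE x in lborel. wD 1 \<Psi> x = p 1 x \<and> wD 2 \<Psi> x = p 2 x \<and> wD 3 \<Psi> x = p 3 x \<and> wD 4 \<Psi> x = p 4 x \<and>
        eta \<Psi> x = eta_deriv 0 p x \<and>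
        wD 1 (eta \<Psi>) x = eta_deriv 1 p x \<and> wD 2 (eta \<Psi>) x = eta_deriv 2 p x \<and> wD 3 (eta \<Psi>) x = eta_deriv 3 p x"
      using 4 j aeP[of 1] aeP[of 2] aeP[of 3] aeP[of 4] eta_AE(1)[of 0] eta_AE(1)[of 1] eta_AE(1)[of 2] eta_AE(1)[of 3] by simp
    have "GP_E4 \<Psi> = energy4 p"
      unfolding GP_E4_def energy4_def
      by (intro refl cong_rules integral_cong_AE; ((rule eventually_mono[OF ae], simp only:) | measurable))
    then show ?thesis using 4 by (simp add: GP_E_def energy_def)
  qed
qed

text \<open>The polar form of \<open>\<Psi>\<close> is given almost everywhere only. For the
  representative \<open>p 0\<close> both sides are continuous, so it holds at every point, as
  \<open>phase_primitive\<close> requires.\<close>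

lemma phase_deriv:
  assumes nz: "\<And>x. p 0 x \<noteq> 0" and \<phi>: "phase_of \<Psi> \<phi>"
  shows "is_primitive \<phi> (\<lambda>x. Im (log_deriv 0 p x))"
proof -
  have p0: "is_primitive (p 0) (p 1)" and c1: "continuous_on UNIV (p 1)"
    using prim[of 0] is_primitive_continuous[OF prim[of 1]] k by auto
  have c0: "continuous_on UNIV (p 0)" by (rule is_primitive_continuous[OF p0])
  have c\<phi>: "continuous_on UNIV \<phi>" using \<phi> by (simp add: phase_of_def)
  have "AE x in lborel. \<Psi> x = complex_of_real (cmod (\<Psi> x)) * exp (\<i> * complex_of_real (\<phi> x))"
    using \<phi> by (simp add: phase_of_def)
  moreover have "AE x in lborel. \<Psi> x = p 0 x" using aeP[of 0] by simp
  ultimately have "AE x in lborel. p 0 x = complex_of_real (cmod (p 0 x)) * exp (\<i> * complex_of_real (\<phi> x))"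
    by eventually_elim simp
  then have "p 0 x = complex_of_real (cmod (p 0 x)) * exp (\<i> * complex_of_real (\<phi> x))" for x
    by (rule continuous_eq_if_AE_eq[rotated 2]) (intro c0 continuous_intros c\<phi>)+
  from phase_primitive[OF p0 c1 nz c\<phi> this] show ?thesis by (simp add: log_deriv_def)
qed

lemma wD_phase:
  assumes "is_primitive \<phi> (\<lambda>x. Im (log_deriv 0 p x))"
  shows "AE x in lborel. wD 1 \<phi> x = Im (log_deriv 0 p x)" "wD 1 \<phi> \<in> borel_measurable borel"
    "(\<lambda>x. Im (log_deriv 0 p x)) \<in> borel_measurable borel"
  using weak_deriv_AE[OF is_primitive_borel[OF assms] _ assms]
    locally_integrable_borel[OF is_primitive_locally_integrable[OF assms]] by simp_all

lemma GP_p_eq: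
  assumes ph: "is_primitive \<phi> (\<lambda>x. Im (log_deriv 0 p x))"
  shows "GP_p k \<Psi> \<phi> = momentum k p"
proof -
  define w where "w x = Im (log_deriv 0 p x)" for x
  have [measurable]: "wD 1 \<Psi> \<in> borel_measurable borel" "p 1 \<in> borel_measurable borel"
    "p 0 \<in> borel_measurable borel"
    "wD 2 \<Psi> \<in> borel_measurable borel" "p 2 \<in> borel_measurable borel"
    "eta_deriv 0 p \<in> borel_measurable borel" "eta \<Psi> \<in> borel_measurable borel"
    using k by (intro mP p_borel eta_AE eta_borel; simp)+
  have [measurable]: "\<Psi> \<in> borel_measurable borel"
    "wD 1 \<phi> \<in> borel_measurable borel" "w \<in> borel_measurable borel"
    using mP[of 0] wD_phase(2,3)[OF ph] by (simp_all add: w_def[abs_def])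
  have ae: "AE x in lborel. wD 1 \<Psi> x = p 1 x \<and> \<Psi> x = p 0 x \<and> wD 2 \<Psi> x = p 2 x \<and> eta \<Psi> x = eta_deriv 0 p x \<and>
        wD 1 \<phi> x = w x"
    using k aeP[of 0] aeP[of 1] aeP[of 2] eta_AE(1)[of 0] wD_phase(1)[OF ph] by (simp add: w_def)
  have 1: "GP_p1 \<Psi> \<phi> = 1/2 * (LBINT x. eta_deriv 0 p x * w x)"
    unfolding GP_p1_def
    by (intro refl cong_rules integral_cong_AE; ((rule eventually_mono[OF ae], simp only:) | measurable))
  consider "k = 1" | "k = 2" | "k = 3" using k by linarith
  then show ?thesis
  proof cases
    case 1
    then show ?thesis using \<open>GP_p1 \<Psi> \<phi> = _\<close> by (simp add: GP_p_def momentum_def w_def)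
  next
    case 2
    have "GP_P2 \<Psi> = 1/2 * (LBINT x. (\<i> * p 2 x) \<bullet> p 1 x) - 3/4 * (LBINT x. eta_deriv 0 p x * ((\<i> * p 1 x) \<bullet> p 0 x))"
      unfolding GP_P2_def
      by (intro refl cong_rules integral_cong_AE; ((rule eventually_mono[OF ae], simp only:) | measurable))
    then show ?thesis using 1 2 by (simp add: GP_p_def momentum_def w_def)
  next
    case 3
    have [measurable]: "wD 3 \<Psi> \<in> borel_measurable borel" "p 3 \<in> borel_measurable borel"
      using 3 by (intro mP p_borel; simp)+
    have ae3: "AE x in lborel. wD 3 \<Psi> x = p 3 x \<and> wD 1 \<Psi> x = p 1 x \<and> \<Psi> x = p 0 x \<and> wD 2 \<Psi> x = p 2 x \<and>
        eta \<Psi> x = eta_deriv 0 p x"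
      using ae aeP[of 3] 3 by auto
    have "GP_P3 \<Psi> = 1/2 * (LBINT x. (\<i> * p 3 x) \<bullet> p 2 x) - 5/2 * (LBINT x. eta_deriv 0 p x * ((\<i> * p 2 x) \<bullet> p 1 x))
        + 5/4 * (LBINT x. ((eta_deriv 0 p x)\<^sup>2 + eta_deriv 0 p x) * ((\<i> * p 1 x) \<bullet> p 0 x))"
      unfolding GP_P3_def
      by (intro refl cong_rules integral_cong_AE; ((rule eventually_mono[OF ae3], simp only:) | measurable))
    then show ?thesis using 1 3 by (simp add: GP_p_def momentum_def w_def)
  qed
qed

text \<open>The argument of the KdV invariant is \<open>3 / \<epsilon>^2\<close> times
  \<open>eta + s sqrt 2 w\<close> at \<open>x / \<epsilon>\<close>, and each derivative brings a
  further \<open>1 / \<epsilon>\<close>. With the factor \<open>\<epsilon>\<close> of the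
  substitution, all terms acquire the same power \<open>\<epsilon>^(- (2 k + 1))\<close>, and the
  powers of 3 combine with the KdV coefficients to those of \<open>kdv_limit\<close> times
  18.\<close>

lemma KdV_E_eq:
  assumes ph: "is_primitive \<phi> (\<lambda>x. Im (log_deriv 0 p x))" and nz: "\<And>x. p 0 x \<noteq> 0" and e: "\<epsilon> > 0"
  shows "KdV_E (k - 1) (\<lambda>x. (N_resc \<epsilon> \<Psi> x + s * wD 1 (Theta_resc \<epsilon> \<phi>) x) / 2)
     = 18 / \<epsilon> ^ (2 * k + 1) * kdv_limit k (s * sqrt 2) p"
proof -
  define v where "v x = (N_resc \<epsilon> \<Psi> x + s * wD 1 (Theta_resc \<epsilon> \<phi>) x) / 2" for x
  define V where "V j = kdv_arg (s * sqrt 2) j p" for j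
  \<comment> \<open>The explicit chain of derivatives of \<open>v\<close>; it is identified with
    \<open>wD j v\<close> through \<open>wD_AE\<close>.\<close>
  define VV where "VV j x = 3 / \<epsilon> ^ (2 + j) * V j (x / \<epsilon>)" for j x
  have primL: "is_primitive (\<lambda>x. Im (log_deriv j p x)) (\<lambda>x. Im (log_deriv (Suc j) p x))" if "Suc j \<le> k - 1" for j
    using that k by (intro is_primitive_Im log_deriv_primitive prim nz) auto
  have primV: "is_primitive (V j) (V (Suc j))" if "Suc j \<le> k - 1" for j
    unfolding V_def kdv_arg_def[abs_def]
    using that k by (intro is_primitive_add is_primitive_cmult primL eta_deriv_primitive prim) auto
  have primVV: "is_primitive (VV j) (VV (Suc j))" if "j < k - 1" for j
    using is_primitive_scale[OF primV e, of j "3 / \<epsilon> ^ (2 + j)"] that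
    unfolding VV_def[abs_def] by (simp add: mult.commute)
  have mL: "(\<lambda>x. Im (log_deriv j p x)) \<in> borel_measurable borel" if "j \<le> k - 1" for j
  proof (cases j)
    case 0 then show ?thesis using wD_phase(3)[OF ph] by simp
  next
    case (Suc l)
    then show ?thesis using locally_integrable_borel[OF is_primitive_locally_integrable[OF primL[of l]]] that by simp
  qed
  have mV: "V j \<in> borel_measurable borel" if "j \<le> k - 1" for j
    using mL[OF that] eta_AE(3)[of j] that k unfolding V_def kdv_arg_def[abs_def] by simp
  have mVV: "VV j \<in> borel_measurable borel" if "j \<le> k - 1" for j
    using mV[OF that] unfolding VV_def[abs_def] by simp
  have \<Theta>: "is_primitive (Theta_resc \<epsilon> \<phi>) (\<lambda>x. 6 * sqrt 2 / \<epsilon> / \<epsilon> * Im (log_deriv 0 p (x / \<epsilon>)))"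
    using is_primitive_scale[OF ph e, of "6 * sqrt 2 / \<epsilon>"] by (simp add: Theta_resc_def[abs_def])
  have m\<Theta>: "wD 1 (Theta_resc \<epsilon> \<phi>) \<in> borel_measurable borel"
    and ae\<Theta>: "AE x in lborel. wD 1 (Theta_resc \<epsilon> \<phi>) x = 6 * sqrt 2 / \<epsilon> / \<epsilon> * Im (log_deriv 0 p (x / \<epsilon>))"
    using weak_deriv_AE[OF is_primitive_borel[OF \<Theta>] _ \<Theta>] by simp_all
  have [measurable]: "eta \<Psi> \<in> borel_measurable borel" "eta_deriv 0 p \<in> borel_measurable borel"
    using eta_borel eta_AE(3)[of 0] by simp_all
  have mv: "v \<in> borel_measurable borel"
    using m\<Theta> unfolding v_def[abs_def] N_resc_def by simp
  have "AE x in lborel. eta \<Psi> x = eta_deriv 0 p x" using eta_AE(1)[of 0] by simp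
  \<comment> \<open>Null sets are preserved by the dilation, written in affine form to match
    \<open>AE_borel_affine\<close>.\<close>
  then have "AE x in lborel. eta \<Psi> (0 + 1 / \<epsilon> * x) = eta_deriv 0 p (0 + 1 / \<epsilon> * x)"
    using e by (intro AE_borel_affine) simp_all
  then have aev: "AE x in lborel. v x = VV 0 x"
    using ae\<Theta>
  proof eventually_elim
    case (elim x)
    then show ?case using e
      by (simp add: v_def N_resc_def VV_def V_def kdv_arg_def field_simps power2_eq_square)
  qed
  have ae: "AE x in lborel. wD j v x = VV j x" and mj: "wD j v \<in> borel_measurable borel" if "j \<le> k - 1" for j
    using wD_AE[where U = VV, OF mv aev primVV, of j] that by auto
  have sc: "(LBINT x. c * f (x / \<epsilon>)) = c * (\<epsilon> * (LBINT x. f x))" for f :: "real \<Rightarrow> real" and c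
    using integral_scale[OF e, of f] by simp
  have pow: "(LBINT x. (wD j v x) ^ n) = 3 ^ n / \<epsilon> ^ m * (\<epsilon> * (LBINT x. (V j x) ^ n))"
    if "j \<le> k - 1" and m: "m = (2 + j) * n" for j m n
  proof -
    have "(LBINT x. (wD j v x) ^ n) = (LBINT x. (VV j x) ^ n)"
      by (rule integral_cong_AE) (use mj[OF that(1)] mVV[OF that(1)] ae[OF that(1)] in auto)
    also have "\<dots> = (LBINT x. 3 ^ n / \<epsilon> ^ m * (V j (x / \<epsilon>)) ^ n)"
      by (simp only: VV_def power_mult_distrib power_divide power_mult m)
    finally show ?thesis unfolding sc[of _ "\<lambda>x. (V j x) ^ n"] .
  qed
  have pw: "\<epsilon>^4 = \<epsilon> * \<epsilon>^3" "\<epsilon>^6 = \<epsilon> * \<epsilon>^5" "\<epsilon>^8 = \<epsilon> * \<epsilon>^7"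
    by (simp_all add: eval_nat_numeral)
  consider "k = 1" | "k = 2" | "k = 3" using k by linarith
  then have "KdV_E (k - 1) v = 18 / \<epsilon> ^ (2 * k + 1) * kdv_limit k (s * sqrt 2) p"
  proof cases
    case 1
    show ?thesis using 1 e pow[of 0 4 2] by (simp add: KdV_E_def kdv_limit_def V_def pw)
  next
    case 2
    show ?thesis using 2 e pow[of 1 6 2] pow[of 0 6 3] by (simp add: KdV_E_def kdv_limit_def V_def pw field_simps)
  next
    case 3
    have "AE x in lborel. v x * (wD 1 v x)\<^sup>2 = VV 0 x * (VV 1 x)\<^sup>2"
      using ae[of 1] aev 3 by auto
    then have "(LBINT x. v x * (wD 1 v x)\<^sup>2) = (LBINT x. VV 0 x * (VV 1 x)\<^sup>2)"
      by (rule integral_cong_AE[rotated 2]) (use mv mj[of 1] mVV[of 0] mVV[of 1] 3 in simp_all)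
    also have "\<dots> = (LBINT x. 27 / \<epsilon>^8 * (V 0 (x / \<epsilon>) * (V 1 (x / \<epsilon>))\<^sup>2))"
    proof -
      have "\<epsilon>\<^sup>2 * (\<epsilon>^3)\<^sup>2 = \<epsilon>^8" by (simp add: eval_nat_numeral)
      then show ?thesis by (simp add: VV_def power_mult_distrib power_divide)
    qed
    also have "\<dots> = 27 / \<epsilon>^8 * (\<epsilon> * (LBINT x. V 0 x * (V 1 x)\<^sup>2))" by (rule sc)
    finally show ?thesis
      using 3 e pow[of 2 8 2] pow[of 0 8 4] by (simp add: KdV_E_def kdv_limit_def V_def pw field_simps)
  qed
  then show ?thesis by (simp add: v_def[abs_def])
qed

end

section \<open>Rescaled estimate and choice of the constants\<close>

definition kdv_error :: "nat \<Rightarrow> real \<Rightarrow> real \<Rightarrow> (real \<Rightarrow> complex) \<Rightarrow> (real \<Rightarrow> real) \<Rightarrow> real" where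
  "kdv_error k \<epsilon> s \<Psi> \<phi> = resc_E k \<epsilon> \<Psi> + s * sqrt 2 * resc_P k \<epsilon> \<Psi> \<phi>
     - KdV_E (k - 1) (\<lambda>x. (N_resc \<epsilon> \<Psi> x + s * wD 1 (Theta_resc \<epsilon> \<phi>) x) / 2)"

text \<open>The approximation is applied with \<open>s * sqrt 2\<close> for \<open>\<sigma>\<close>,
  which treats both signs at once. The factor \<open>18 / \<epsilon>^(2 k + 1)\<close> common to all
  three invariants turns the error \<open>\<epsilon>^(2 k + 3)\<close> into
  \<open>\<epsilon>^2\<close>.\<close>

lemma kdv_approximation_resc:
  assumes A: "0 < A" and k: "1 \<le> k" "k \<le> 3" and s: "s\<^sup>2 = 1"
  obtains C where "C \<ge> 0" "\<And>\<epsilon> \<Psi> \<phi>. 0 < \<epsilon> \<Longrightarrow> \<epsilon> * (1 + 5 * A) < 1 \<Longrightarrow> \<Psi> \<in> X_space (k + 1) \<Longrightarrow> phase_of \<Psi> \<phi> \<Longrightarrow>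
      (\<forall>j. 1 \<le> j \<and> j \<le> k + 1 \<longrightarrow> resc_E j \<epsilon> \<Psi> \<le> A) \<Longrightarrow>
      \<bar>kdv_error k \<epsilon> s \<Psi> \<phi>\<bar> \<le> C * \<epsilon>\<^sup>2"
proof -
  have s2: "(s * sqrt 2)\<^sup>2 = 2" using s by (simp add: power_mult_distrib)
  obtain C where C: "C \<ge> 0" "\<And>\<epsilon> p. (\<epsilon>, p) \<in> gp_data A k \<Longrightarrow>
      \<bar>energy k p + s * sqrt 2 * momentum k p - kdv_limit k (s * sqrt 2) p\<bar> \<le> C * \<epsilon> ^ (2 * k + 3)"
    using kdv_approximation[OF A k s2] by blast
  show ?thesis
  proof (rule that[of "18 * C"])
    show "0 \<le> 18 * C" using C(1) by simp
    fix \<epsilon> :: real and \<Psi> \<phi>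
    assume e: "0 < \<epsilon>" and e1: "\<epsilon> * (1 + 5 * A) < 1" and \<Psi>: "\<Psi> \<in> X_space (k + 1)" and \<phi>: "phase_of \<Psi> \<phi>"
      and E: "\<forall>j. 1 \<le> j \<and> j \<le> k + 1 \<longrightarrow> resc_E j \<epsilon> \<Psi> \<le> A"
    obtain p where p: "\<And>j. j \<le> k \<Longrightarrow> is_primitive (p j) (p (Suc j))"
      "\<And>j. j \<le> Suc k \<Longrightarrow> AE x in lborel. wD j \<Psi> x = p j x"
      "\<And>j. j \<le> Suc k \<Longrightarrow> wD j \<Psi> \<in> borel_measurable borel"
      "\<And>j. 1 \<le> j \<Longrightarrow> j \<le> Suc k \<Longrightarrow> integrable lborel (\<lambda>x. (cmod (p j x))\<^sup>2)"
      "integrable lborel (\<lambda>x. (eta_deriv 0 p x)\<^sup>2)"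
      using X_space_representative[OF \<Psi>] by blast
    note GP = GP_E_eq[OF k p(1,2,3)]
    have i: "(\<epsilon>, p) \<in> gp_data A k"
      using e e1 p(1,4,5) E GP by (auto simp: gp_data_def resc_E_def)
    interpret gp_family "gp_data A k" fst "\<lambda>j i. snd i j" k A
      by (rule gp_family_gp_data[OF A k])
    have nz: "p 0 x \<noteq> 0" for x using P0_bounds(3)[OF i, of x] by simp
    have ph: "is_primitive \<phi> (\<lambda>x. Im (log_deriv 0 p x))"
      by (rule phase_deriv[OF k p(1,2,3) nz \<phi>])
    have eqs: "GP_E k \<Psi> = energy k p" "GP_p k \<Psi> \<phi> = momentum k p"
      using k GP by (auto intro: GP_p_eq[OF k p(1,2,3) ph])
    have kdv: "KdV_E (k - 1) (\<lambda>x. (N_resc \<epsilon> \<Psi> x + s * wD 1 (Theta_resc \<epsilon> \<phi>) x) / 2)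
        = 18 / \<epsilon> ^ (2 * k + 1) * kdv_limit k (s * sqrt 2) p"
      by (rule KdV_E_eq[OF k p(1,2,3) ph nz e])
    let ?c = "18 / \<epsilon> ^ (2 * k + 1)"
    let ?x = "energy k p + s * sqrt 2 * momentum k p - kdv_limit k (s * sqrt 2) p"
    have "kdv_error k \<epsilon> s \<Psi> \<phi> = ?c * ?x"
      unfolding kdv_error_def resc_E_def resc_P_def eqs kdv by (simp add: algebra_simps add_divide_distrib)
    moreover have "\<bar>?c * ?x\<bar> \<le> ?c * (C * \<epsilon> ^ (2 * k + 3))"
      unfolding abs_mult using e C(2)[OF i] by (intro mult_mono) auto
    moreover have "?c * (C * \<epsilon> ^ (2 * k + 3)) = 18 * C * \<epsilon>\<^sup>2"
    proof -
      have "\<epsilon> ^ (2 * k + 3) = \<epsilon> ^ (2 * k + 1) * \<epsilon>\<^sup>2" by (simp add: power_add eval_nat_numeral)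
      then show ?thesis using e by simp
    qed
    ultimately show "\<bar>kdv_error k \<epsilon> s \<Psi> \<phi>\<bar> \<le> 18 * C * \<epsilon>\<^sup>2" by simp
  qed
qed

theorem proposition4p2:
  fixes A :: real
  assumes "A > 0"
  shows "\<exists>\<epsilon>\<^sub>A K\<^sub>A :: real. \<epsilon>\<^sub>A > 0 \<and> K\<^sub>A > 0 \<and>
    (\<forall>k::nat. 1 \<le> k \<and> k \<le> 3 \<longrightarrow>
      (\<forall>\<epsilon>::real. 0 < \<epsilon> \<and> \<epsilon> < \<epsilon>\<^sub>A \<longrightarrow>
        (\<forall>\<Psi> \<phi>. \<Psi> \<in> X_space (k + 1) \<and> GL_energy \<Psi> < 2 * sqrt 2 / 3 \<and> phase_of \<Psi> \<phi> \<and>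
            (\<forall>j. 1 \<le> j \<and> j \<le> k + 1 \<longrightarrow> resc_E j \<epsilon> \<Psi> \<le> A) \<longrightarrow>
          (\<forall>s\<in>{1, - 1 :: real}.
            \<bar>resc_E k \<epsilon> \<Psi> + s * sqrt 2 * resc_P k \<epsilon> \<Psi> \<phi>
              - KdV_E (k - 1)
                  (\<lambda>x. (N_resc \<epsilon> \<Psi> x + s * wD 1 (Theta_resc \<epsilon> \<phi>) x) / 2)\<bar>
            \<le> K\<^sub>A * \<epsilon>\<^sup>2))))"
proof -
  \<comment> \<open>The constant found so far depends on \<open>k\<close> and on the sign, while a
    single one is required; naming the property allows a choice for each of the six pairs.\<close>
  define Q where "Q k s C \<longleftrightarrow> (\<forall>\<epsilon> \<Psi> \<phi>. 0 < \<epsilon> \<longrightarrow> \<epsilon> * (1 + 5 * A) < 1 \<longrightarrow> \<Psi> \<in> X_space (k + 1) \<longrightarrow> phase_of \<Psi> \<phi> \<longrightarrow>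
      (\<forall>j. 1 \<le> j \<and> j \<le> k + 1 \<longrightarrow> resc_E j \<epsilon> \<Psi> \<le> A) \<longrightarrow>
      \<bar>kdv_error k \<epsilon> s \<Psi> \<phi>\<bar> \<le> C * \<epsilon>\<^sup>2)" for k :: nat and s C :: real
  have ex: "\<exists>C\<ge>0. Q k s C" if "k \<in> {1..3}" "s \<in> {1, -1}" for k :: nat and s :: real
  proof -
    have s: "s\<^sup>2 = 1" and k: "1 \<le> k" "k \<le> 3" using that by auto
    show ?thesis
    proof (rule kdv_approximation_resc[OF assms k s])
      fix C :: real assume "C \<ge> 0" and C: "\<And>\<epsilon> \<Psi> \<phi>. 0 < \<epsilon> \<Longrightarrow> \<epsilon> * (1 + 5 * A) < 1 \<Longrightarrow> \<Psi> \<in> X_space (k + 1) \<Longrightarrow>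
        phase_of \<Psi> \<phi> \<Longrightarrow> (\<forall>j. 1 \<le> j \<and> j \<le> k + 1 \<longrightarrow> resc_E j \<epsilon> \<Psi> \<le> A) \<Longrightarrow>
        \<bar>kdv_error k \<epsilon> s \<Psi> \<phi>\<bar> \<le> C * \<epsilon>\<^sup>2"
      show ?thesis unfolding Q_def using \<open>C \<ge> 0\<close> C by blast
    qed
  qed
  define C where "C z = (SOME C. C \<ge> 0 \<and> Q (fst z) (snd z) C)" for z
  have C: "C (k, s) \<ge> 0 \<and> Q k s (C (k, s))" if "k \<in> {1..3}" "s \<in> {1, -1}" for k s
    unfolding C_def fst_conv snd_conv by (rule someI_ex) (rule ex[OF that])
  \<comment> \<open>The sum dominates each of the six nonnegative constants, and the summand 1 makes
    \<open>K\<close> positive even if all of them are 0.\<close>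
  define K where "K = 1 + (\<Sum>z\<in>{1..3} \<times> {1, -1}. C z)"
  have CK: "C (k, s) \<le> K" if "k \<in> {1..3}" "s \<in> {1, -1}" for k s
  proof -
    have "C (k, s) \<le> (\<Sum>z\<in>{1..3} \<times> {1, -1}. C z)"
      using that C by (intro member_le_sum) auto
    then show ?thesis by (simp add: K_def)
  qed
  have "0 \<le> (\<Sum>z\<in>{1..3} \<times> {1, -1}. C z)" using C by (intro sum_nonneg) auto
  then have K: "K > 0" by (simp add: K_def)
  have e: "\<epsilon> * (1 + 5 * A) < 1" if "\<epsilon> < 1 / (1 + 5 * A)" for \<epsilon>
    using that assms by (simp add: pos_less_divide_eq)
  show ?thesis
    unfolding kdv_error_def[symmetric]
  \<comment> \<open>The threshold is the smallness condition
    \<open>\<epsilon> * (1 + 5 * A) < 1\<close> solved for \<open>\<epsilon>\<close>; it depends on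
    \<open>A\<close> only and serves all \<open>k\<close>.\<close>
  proof (rule exI[of _ "1 / (1 + 5 * A)"], rule exI[of _ K], intro conjI allI impI ballI)
    fix k :: nat and \<epsilon> :: real and \<Psi> \<phi> and s :: real
    assume k: "1 \<le> k \<and> k \<le> 3" and eps: "0 < \<epsilon> \<and> \<epsilon> < 1 / (1 + 5 * A)"
      and h: "\<Psi> \<in> X_space (k + 1) \<and> GL_energy \<Psi> < 2 * sqrt 2 / 3 \<and> phase_of \<Psi> \<phi> \<and>
            (\<forall>j. 1 \<le> j \<and> j \<le> k + 1 \<longrightarrow> resc_E j \<epsilon> \<Psi> \<le> A)" and s: "s \<in> {1, - 1}"
    have kk: "k \<in> {1..3}" using k by simp
    have "\<bar>kdv_error k \<epsilon> s \<Psi> \<phi>\<bar> \<le> C (k, s) * \<epsilon>\<^sup>2"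
      using C[OF kk s] eps e h unfolding Q_def by blast
    also have "\<dots> \<le> K * \<epsilon>\<^sup>2" using CK[OF kk s] by (intro mult_right_mono) auto
    finally show "\<bar>kdv_error k \<epsilon> s \<Psi> \<phi>\<bar> \<le> K * \<epsilon>\<^sup>2" .
  qed (use assms K in auto)
qed

end
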